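(* There exists a torsion-free $2$-generated simple group $G$ with a free subgroup $H$ of rank $2$ such that for every $h\in H\setminus\{1\}$, $$\lim_{n\to+\infty}\operatorname{cl}_G(h^n)=+\infty$$ (in particular, $G$ has infinite commutator width). Moreover, there exists such a group $G$ with decidable word and conjugacy problems.
   Context: For group elements, $[x,y]=xyx^{-1}y^{-1}$. For an element $g$ of the derived subgroup $[G,G]$, the commutator length $\operatorname{cl}_G(g)$ is the minimal $k\ge 0$ such that $g=[x_1,y_1]\cdots[x_k,y_k]$ for some $x_i,y_i\in G$ (so $\operatorname{cl}_G(1)=0$). The commutator width of $G$ is the maximum (possibly infinite) of $\operatorname{cl}_G(g)$ over $g\in[G,G]$. *)

theory Defs
  imports
    Complex_Main
    "HOL-Algebra.Generated_Groups"
    "HOL-Library.Extended_Nat"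
    "HOL-Library.Nat_Bijection"
begin

section \<open>Group-theoretic notions\<close>

definition torsion_free :: "('a, 'b) monoid_scheme \<Rightarrow> bool" where
  "torsion_free G \<longleftrightarrow>
     (\<forall>g \<in> carrier G. g \<noteq> \<one>\<^bsub>G\<^esub> \<longrightarrow> (\<forall>n::nat. 0 < n \<longrightarrow> g [^]\<^bsub>G\<^esub> n \<noteq> \<one>\<^bsub>G\<^esub>))"

definition two_generated :: "('a, 'b) monoid_scheme \<Rightarrow> bool" where
  "two_generated G \<longleftrightarrow> (\<exists>a \<in> carrier G. \<exists>b \<in> carrier G. generate G {a, b} = carrier G)"

text \<open>The locale \<open>simple_group\<close> of HOL-Algebra assumes \<open>order G > 1\<close>. Since the order of an
  infinite group is \<open>0\<close> there, that locale has no infinite instances; nontriviality is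
  therefore expressed through the carrier.\<close>

definition simple :: "('a, 'b) monoid_scheme \<Rightarrow> bool" where
  "simple G \<longleftrightarrow>
     group G \<and> carrier G \<noteq> {\<one>\<^bsub>G\<^esub>} \<and>
     (\<forall>N. N \<lhd> G \<longrightarrow> N = carrier G \<or> N = {\<one>\<^bsub>G\<^esub>})"


section \<open>Words and free groups\<close>

text \<open>A letter \<open>(x, False)\<close> stands for the generator \<open>x\<close>, and \<open>(x, True)\<close> for its inverse.\<close>

type_synonym 'x word = "('x \<times> bool) list"

definition words_over :: "'x set \<Rightarrow> 'x word set" where
  "words_over X = lists (X \<times> UNIV)"

definition reduced :: "'x word \<Rightarrow> bool" where
  "reduced w \<longleftrightarrow> successively (\<lambda>p q. \<not> (fst p = fst q \<and> snd p \<noteq> snd q)) w"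

definition letter_val :: "('a, 'b) monoid_scheme \<Rightarrow> ('x \<Rightarrow> 'a) \<Rightarrow> 'x \<times> bool \<Rightarrow> 'a" where
  "letter_val G \<sigma> p = (if snd p then inv\<^bsub>G\<^esub> (\<sigma> (fst p)) else \<sigma> (fst p))"

definition word_val :: "('a, 'b) monoid_scheme \<Rightarrow> ('x \<Rightarrow> 'a) \<Rightarrow> 'x word \<Rightarrow> 'a" where
  "word_val G \<sigma> w = foldr (\<lambda>p g. letter_val G \<sigma> p \<otimes>\<^bsub>G\<^esub> g) w \<one>\<^bsub>G\<^esub>"

text \<open>\<open>X\<close> is a free basis of \<open>F\<close> when every element of \<open>F\<close> is the value of exactly one
  reduced word in the elements of \<open>X\<close> and their inverses.\<close>

definition free_basis :: "('a, 'b) monoid_scheme \<Rightarrow> 'a set \<Rightarrow> bool" where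
  "free_basis F X \<longleftrightarrow>
     X \<subseteq> carrier F \<and>
     bij_betw (word_val F (\<lambda>x. x)) {w \<in> words_over X. reduced w} (carrier F)"

definition free_of_finite_rank :: "('a, 'b) monoid_scheme \<Rightarrow> nat \<Rightarrow> bool" where
  "free_of_finite_rank F r \<longleftrightarrow>
     group F \<and> (\<exists>X. finite X \<and> card X = r \<and> free_basis F X)"


section \<open>Commutator length and commutator width\<close>

text \<open>\<open>derived_set G (carrier G)\<close> is the set of all \<open>x \<otimes> y \<otimes> inv x \<otimes> inv y\<close>.\<close>

definition product_of_commutators :: "('a, 'b) monoid_scheme \<Rightarrow> nat \<Rightarrow> 'a \<Rightarrow> bool" where
  "product_of_commutators G k g \<longleftrightarrow>
     (\<exists>cs. length cs = k \<and> set cs \<subseteq> derived_set G (carrier G) \<and>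
           g = foldr (\<lambda>c h. c \<otimes>\<^bsub>G\<^esub> h) cs \<one>\<^bsub>G\<^esub>)"

text \<open>Meaningful only for \<open>g \<in> derived G (carrier G)\<close>; in a nonabelian simple group
  this is every element.\<close>

definition commutator_length :: "('a, 'b) monoid_scheme \<Rightarrow> 'a \<Rightarrow> nat" where
  "commutator_length G g = (LEAST k. product_of_commutators G k g)"

definition commutator_width :: "('a, 'b) monoid_scheme \<Rightarrow> enat" where
  "commutator_width G = (SUP g \<in> derived G (carrier G). enat (commutator_length G g))"


section \<open>Decidable sets of natural numbers\<close>

text \<open>Programs for the partial recursive functions. Arities are left implicit: a program is
  undefined on argument lists on which no evaluation rule applies.\<close>

datatype recf =
    Zero
  | Succ
  | Proj nat
  | Comp recf "recf list"
  | Prec recf recf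
  | Mu recf

inductive rec_eval :: "recf \<Rightarrow> nat list \<Rightarrow> nat \<Rightarrow> bool" where
  zero: "rec_eval Zero xs 0"
| succ: "rec_eval Succ [x] (Suc x)"
| proj: "i < length xs \<Longrightarrow> rec_eval (Proj i) xs (xs ! i)"
| comp: "list_all2 (\<lambda>g y. rec_eval g xs y) gs ys \<Longrightarrow> rec_eval f ys z \<Longrightarrow>
         rec_eval (Comp f gs) xs z"
| prec_0: "rec_eval f xs y \<Longrightarrow> rec_eval (Prec f g) (0 # xs) y"
| prec_Suc: "rec_eval (Prec f g) (n # xs) y \<Longrightarrow> rec_eval g (n # y # xs) z \<Longrightarrow>
         rec_eval (Prec f g) (Suc n # xs) z"
| mu: "rec_eval f (n # xs) 0 \<Longrightarrow> (\<And>m. m < n \<Longrightarrow> \<exists>y. rec_eval f (m # xs) y \<and> 0 < y) \<Longrightarrow>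
         rec_eval (Mu f) xs n"

text \<open>Evaluation is single-valued, so a program computes a partial function.\<close>

inductive_cases rec_eval_casesE:
  "rec_eval Zero xs z" "rec_eval Succ xs z" "rec_eval (Proj i) xs z"
  "rec_eval (Comp f gs) xs z" "rec_eval (Prec f g) (0 # xs) z"
  "rec_eval (Prec f g) (Suc n # xs) z" "rec_eval (Mu f) xs z"

lemma rec_eval_unique: "rec_eval f xs y \<Longrightarrow> rec_eval f xs z \<Longrightarrow> y = z"
proof (induction arbitrary: z rule: rec_eval.induct)
  case (zero xs)
  then show ?case by (rule rec_eval_casesE(1)) simp
next
  case (succ x)
  then show ?case by (rule rec_eval_casesE(2)) simp
next
  case (proj i xs)
  from proj.prems show ?case by (rule rec_eval_casesE(3)) simp
next
  case (comp xs gs ys f y)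
  from comp.prems obtain ys' where
    ys': "list_all2 (\<lambda>g y. rec_eval g xs y) gs ys'" "rec_eval f ys' z"
    by (rule rec_eval_casesE(4))
  note len = list_all2_lengthD[OF comp.IH(1)] list_all2_lengthD[OF ys'(1)]
  have "ys = ys'"
  proof (rule nth_equalityI)
    show "length ys = length ys'"
      using len by simp
    fix i assume "i < length ys"
    with len have "rec_eval (gs ! i) xs (ys' ! i)"
      and "\<And>z. rec_eval (gs ! i) xs z \<Longrightarrow> ys ! i = z"
      using list_all2_nthD2[OF comp.IH(1)] list_all2_nthD2[OF ys'(1), of i] by simp_all
    then show "ys ! i = ys' ! i" by blast
  qed
  with comp.IH(2) ys'(2) show ?case by simp
next
  case (prec_0 f xs y g)
  from prec_0.prems have "rec_eval f xs z" by (rule rec_eval_casesE(5))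
  then show ?case by (rule prec_0.IH)
next
  case (prec_Suc f g n xs y w)
  from prec_Suc.prems obtain y' where
    y': "rec_eval (Prec f g) (n # xs) y'" "rec_eval g (n # y' # xs) z"
    by (rule rec_eval_casesE(6))
  from prec_Suc.IH(1)[OF y'(1)] y'(2) show ?case by (simp add: prec_Suc.IH(2))
next
  case (mu f n xs)
  from mu.prems have z: "rec_eval f (z # xs) 0"
    "\<And>m. m < z \<Longrightarrow> \<exists>y. rec_eval f (m # xs) y \<and> 0 < y"
    by (auto elim!: rec_eval_casesE(7))
  show ?case
  proof (cases n z rule: linorder_cases)
    case less
    then obtain y where "rec_eval f (n # xs) y" "0 < y" using z(2) by blast
    then show ?thesis using mu.IH(1) by auto
  next
    case greater
    then show ?thesis using mu.IH(2) z(1) by blast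
  qed
qed

definition decidable_set :: "nat set \<Rightarrow> bool" where
  "decidable_set A \<longleftrightarrow> (\<exists>f. \<forall>n. rec_eval f [n] (if n \<in> A then 1 else 0))"


section \<open>Word problem and conjugacy problem\<close>

text \<open>Both problems concern words in a finite generating tuple \<open>gs\<close>, the letter \<open>(i, e)\<close>
  denoting \<open>gs ! i\<close> or its inverse. Their decidability does not depend on the choice of \<open>gs\<close>.\<close>

definition generating_tuple :: "('a, 'b) monoid_scheme \<Rightarrow> 'a list \<Rightarrow> bool" where
  "generating_tuple G gs \<longleftrightarrow> set gs \<subseteq> carrier G \<and> generate G (set gs) = carrier G"

definition word_code :: "nat word \<Rightarrow> nat" where
  "word_code w = list_encode (map (\<lambda>(i, e). 2 * i + of_bool e) w)"

definition word_problem :: "('a, 'b) monoid_scheme \<Rightarrow> 'a list \<Rightarrow> nat word set" where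
  "word_problem G gs =
     {w \<in> words_over {..<length gs}. word_val G (\<lambda>i. gs ! i) w = \<one>\<^bsub>G\<^esub>}"

definition conjugate_in :: "('a, 'b) monoid_scheme \<Rightarrow> 'a \<Rightarrow> 'a \<Rightarrow> bool" where
  "conjugate_in G g h \<longleftrightarrow> (\<exists>x \<in> carrier G. h = x \<otimes>\<^bsub>G\<^esub> g \<otimes>\<^bsub>G\<^esub> inv\<^bsub>G\<^esub> x)"

definition conjugacy_problem :: "('a, 'b) monoid_scheme \<Rightarrow> 'a list \<Rightarrow> (nat word \<times> nat word) set" where
  "conjugacy_problem G gs =
     {(u, v). u \<in> words_over {..<length gs} \<and> v \<in> words_over {..<length gs} \<and>
        conjugate_in G (word_val G (\<lambda>i. gs ! i) u) (word_val G (\<lambda>i. gs ! i) v)}"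

definition decidable_word_problem :: "('a, 'b) monoid_scheme \<Rightarrow> bool" where
  "decidable_word_problem G \<longleftrightarrow>
     (\<exists>gs. generating_tuple G gs \<and> decidable_set (word_code ` word_problem G gs))"

definition decidable_conjugacy_problem :: "('a, 'b) monoid_scheme \<Rightarrow> bool" where
  "decidable_conjugacy_problem G \<longleftrightarrow>
     (\<exists>gs. generating_tuple G gs \<and>
        decidable_set ((\<lambda>(u, v). prod_encode (word_code u, word_code v)) ` conjugacy_problem G gs))"

end

theory Submission
  imports Defs "HOL-Combinatorics.Transposition"
begin

text \<open>The group is an amalgam of the free groups on \<open>a, t\<close> and on \<open>b,
  x_0, x_1, \<dots>\<close>. They act on the integers and on the natural numbers, and the two
  stabilizers of 0, free of infinite rank, are identified by matching free generators, where
  \<open>t\<close> becomes \<open>b^6\<close>. The matching runs through an enumeration that makes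
  as many elements as possible conjugate: every element becomes conjugate to 1, to
  \<open>t\<close>, to a power of \<open>a\<close>, or to an alternating product of
  \<open>a\<close> and three fixed words \<open>rho_1, rho_2, rho_3\<close>. Hence a normal
  subgroup other than the trivial one contains \<open>t\<close> and then everything, and no
  element has finite order.

  The second action commutes with a rotation of order 3, so the stabilizer of 0 also fixes the
  points 1 and 2. Weighting the entries of a normal form that are 1, 2 or anything else by 1, -1
  and 0 therefore gives a well-defined list \<open>P g\<close>, the pattern of \<open>g\<close>,
  and the patterns of \<open>g\<close>, \<open>h\<close> and \<open>g + h\<close> overlap like the
  sides of a triangle in a tree. Counting occurrences of a list minus those of its negated
  reversal is thus a quasimorphism. It is bounded by a multiple of \<open>k\<close> on products of
  \<open>k\<close> commutators. For each nontrivial element of a free subgroup whose patterns spell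
  out the reduced words, some choice of the list makes it grow linearly on the powers.

  The action also shows that the listed elements are conjugate only in the obvious cases. Since
  the defining relations are computable, searching for a derivation of a conjugation to a listed
  element therefore decides the word problem and the conjugacy problem.\<close>

text \<open>Matching a free basis of one stabilizer with a free basis of the other always gives an
  amalgam, so the whole freedom of the matching can be spent on forcing conjugacies. These must not
  destroy the patterns. The pattern of an element depends only on the double cosets of the common
  subgroup C that its normal form passes through, and the actions are chosen so that few of them
  exist. In the first factor C moves the point 1 to every nonzero integer, so the complement of C is
  the double coset of \<open>a\<close> alone. In the second factor C fixes 1 and 2 and is transitive
  on the points from 3 on, which leaves three double cosets, represented by the rho's. The
  conjugacies forced on alternating products erase only the factors from C between these
  representatives. Hence the pattern survives, separates the remaining classes and still carries the
  quasimorphism. One prescribed conjugacy per generator is made possible by multiplying a matched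
  generator of the first factor by a word in generators of smaller rank, a triangular change that
  again gives a free basis.\<close>

section \<open>Computable functions\<close>

text \<open>Functions of \<open>k\<close> arguments are represented as functions on lists, which serve as
  environments for the closure rules below.\<close>

definition rec_fun :: "nat \<Rightarrow> (nat list \<Rightarrow> nat) \<Rightarrow> bool" where
  "rec_fun k f \<longleftrightarrow> (\<exists>p. \<forall>xs. length xs = k \<longrightarrow> rec_eval p xs (f xs))"

lemma rec_fun_zero: "rec_fun k (\<lambda>_. 0)"
  unfolding rec_fun_def by (blast intro: rec_eval.zero)

lemma rec_fun_proj: "i < k \<Longrightarrow> rec_fun k (\<lambda>xs. xs ! i)"
  unfolding rec_fun_def by (blast intro: rec_eval.proj)

lemma rec_fun_comp:
  assumes f: "rec_fun (length gs) f" and gs: "\<And>g. g \<in> set gs \<Longrightarrow> rec_fun k g"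
  shows "rec_fun k (\<lambda>xs. f (map (\<lambda>g. g xs) gs))"
proof -
  obtain p where p: "\<And>xs. length xs = length gs \<Longrightarrow> rec_eval p xs (f xs)"
    using f unfolding rec_fun_def by blast
  have "\<forall>g\<in>set gs. \<exists>q. \<forall>xs. length xs = k \<longrightarrow> rec_eval q xs (g xs)"
    using gs unfolding rec_fun_def by blast
  then obtain q where q: "\<And>g xs. g \<in> set gs \<Longrightarrow> length xs = k \<Longrightarrow> rec_eval (q g) xs (g xs)"
    by metis
  have "rec_eval (Comp p (map q gs)) xs (f (map (\<lambda>g. g xs) gs))" if "length xs = k" for xs
  proof (rule rec_eval.comp)
    show "list_all2 (\<lambda>g y. rec_eval g xs y) (map q gs) (map (\<lambda>g. g xs) gs)"
      using q that by (auto simp: list_all2_conv_all_nth)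
  qed (simp add: p)
  then show ?thesis unfolding rec_fun_def by blast
qed

lemma rec_fun_app1: "rec_fun 1 (\<lambda>xs. f (xs ! 0)) \<Longrightarrow> rec_fun k g \<Longrightarrow> rec_fun k (\<lambda>xs. f (g xs))"
  using rec_fun_comp[of "[g]" "\<lambda>xs. f (xs ! 0)" k] by simp

lemma rec_fun_app2:
  "rec_fun 2 (\<lambda>xs. f (xs ! 0) (xs ! 1)) \<Longrightarrow> rec_fun k g \<Longrightarrow> rec_fun k h \<Longrightarrow>
    rec_fun k (\<lambda>xs. f (g xs) (h xs))"
  using rec_fun_comp[of "[g, h]" "\<lambda>xs. f (xs ! 0) (xs ! 1)" k] by (auto simp: numeral_2_eq_2)

lemma rec_fun_Suc: "rec_fun k f \<Longrightarrow> rec_fun k (\<lambda>xs. Suc (f xs))"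
proof (rule rec_fun_app1[where f = Suc])
  have "rec_eval Succ xs (Suc (xs ! 0))" if "length xs = 1" for xs
    using that rec_eval.succ by (auto simp: length_Suc_conv)
  then show "rec_fun 1 (\<lambda>xs. Suc (xs ! 0))" unfolding rec_fun_def by blast
qed

lemma rec_fun_const: "rec_fun k (\<lambda>_. c)"
  by (induction c) (auto intro: rec_fun_zero rec_fun_Suc)

text \<open>\<open>Prec\<close> recurses on its first argument only. Composing it with
  \<open>n\<close> followed by all projections lets the number of iterations be any computable
  function of an environment that remains available to \<open>g\<close>.\<close>

lemma rec_fun_rec:
  assumes n: "rec_fun k n" and a: "rec_fun k a" and g: "rec_fun (Suc (Suc k)) g"
  shows "rec_fun k (\<lambda>xs. rec_nat (a xs) (\<lambda>m y. g (m # y # xs)) (n xs))"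
proof -
  obtain pa where pa: "\<And>xs. length xs = k \<Longrightarrow> rec_eval pa xs (a xs)"
    using a unfolding rec_fun_def by blast
  obtain pg where pg: "\<And>xs. length xs = Suc (Suc k) \<Longrightarrow> rec_eval pg xs (g xs)"
    using g unfolding rec_fun_def by blast
  have "rec_eval (Prec pa pg) (m # xs) (rec_nat (a xs) (\<lambda>m y. g (m # y # xs)) m)"
    if "length xs = k" for m xs
  proof (induction m)
    case 0
    then show ?case using pa that by (auto intro: rec_eval.prec_0)
  next
    case (Suc m)
    show ?case by (rule rec_eval.prec_Suc[OF Suc.IH]) (use pg that in auto)
  qed
  then have R: "rec_fun (Suc k) (\<lambda>xs. rec_nat (a (tl xs)) (\<lambda>m y. g (m # y # tl xs)) (hd xs))"
    unfolding rec_fun_def by (intro exI[of _ "Prec pa pg"]) (auto simp: length_Suc_conv)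
  have "rec_fun (length (n # map (\<lambda>i xs. xs ! i) [0..<k]))
      (\<lambda>xs. rec_nat (a (tl xs)) (\<lambda>m y. g (m # y # tl xs)) (hd xs))"
    using R by simp
  from rec_fun_comp[OF this, of k]
  have "rec_fun k (\<lambda>xs. rec_nat (a (map ((\<lambda>g. g xs) \<circ> (\<lambda>i xs. xs ! i)) [0..<k]))
      (\<lambda>m y. g (m # y # map ((\<lambda>g. g xs) \<circ> (\<lambda>i xs. xs ! i)) [0..<k])) (n xs))"
    using n by (force intro: rec_fun_proj)
  moreover have "map ((\<lambda>g. g xs) \<circ> (\<lambda>i xs. xs ! i)) [0..<k] = xs" if "length xs = k" for xs :: "nat list"
    unfolding that[symmetric] by (simp add: o_def map_nth)
  ultimately show ?thesis unfolding rec_fun_def by simp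
qed

lemma rec_fun_Least:
  assumes f: "rec_fun (Suc k) f" and ex: "\<And>xs. length xs = k \<Longrightarrow> \<exists>n. f (n # xs) = 0"
  shows "rec_fun k (\<lambda>xs. LEAST n. f (n # xs) = 0)"
proof -
  obtain p where p: "\<And>xs. length xs = Suc k \<Longrightarrow> rec_eval p xs (f xs)"
    using f unfolding rec_fun_def by blast
  have "rec_eval (Mu p) xs (LEAST n. f (n # xs) = 0)" if "length xs = k" for xs
  proof (rule rec_eval.mu)
    have "f ((LEAST n. f (n # xs) = 0) # xs) = 0" using ex[OF that] by (rule LeastI_ex)
    then show "rec_eval p ((LEAST n. f (n # xs) = 0) # xs) 0"
      using p[of "(LEAST n. f (n # xs) = 0) # xs"] that by simp
    fix m assume "m < (LEAST n. f (n # xs) = 0)"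
    then have "0 < f (m # xs)" using not_less_Least by blast
    then show "\<exists>y. rec_eval p (m # xs) y \<and> 0 < y" using p[of "m # xs"] that by auto
  qed
  then show ?thesis unfolding rec_fun_def by blast
qed

section \<open>Closure under arithmetic and the pairing function\<close>

lemma rec_fun_add: "rec_fun k f \<Longrightarrow> rec_fun k g \<Longrightarrow> rec_fun k (\<lambda>xs. f xs + g xs)"
proof -
  assume f: "rec_fun k f" and g: "rec_fun k g"
  have "rec_fun (Suc (Suc k)) (\<lambda>ys. Suc (ys ! 1))" by (intro rec_fun_Suc rec_fun_proj) simp
  from rec_fun_rec[OF g f this]
  have "rec_fun k (\<lambda>xs. rec_nat (f xs) (\<lambda>m. Suc) (g xs))" by simp
  moreover have "rec_nat a (\<lambda>m. Suc) b = a + b" for a b by (induction b) auto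
  ultimately show ?thesis by (simp only:)
qed

lemma rec_fun_pred: "rec_fun k f \<Longrightarrow> rec_fun k (\<lambda>xs. f xs - 1)"
proof -
  assume f: "rec_fun k f"
  have "rec_fun (Suc (Suc k)) (\<lambda>ys. ys ! 0)" by (intro rec_fun_proj) simp
  from rec_fun_rec[OF f rec_fun_zero this]
  have "rec_fun k (\<lambda>xs. rec_nat 0 (\<lambda>m y. m) (f xs))" by simp
  moreover have "rec_nat 0 (\<lambda>m y. m) b = b - 1" for b by (induction b) auto
  ultimately show ?thesis by (simp only:)
qed

lemma rec_fun_diff: "rec_fun k f \<Longrightarrow> rec_fun k g \<Longrightarrow> rec_fun k (\<lambda>xs. f xs - g xs)"
proof -
  assume f: "rec_fun k f" and g: "rec_fun k g"
  have "rec_fun (Suc (Suc k)) (\<lambda>ys. ys ! 1 - 1)" by (rule rec_fun_pred, rule rec_fun_proj) simp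
  from rec_fun_rec[OF g f this]
  have "rec_fun k (\<lambda>xs. rec_nat (f xs) (\<lambda>m y. y - 1) (g xs))" by simp
  moreover have "rec_nat a (\<lambda>m y. y - 1) b = a - b" for a b :: nat by (induction b) auto
  ultimately show ?thesis by (simp only:)
qed

lemma rec_fun_mult: "rec_fun k f \<Longrightarrow> rec_fun k g \<Longrightarrow> rec_fun k (\<lambda>xs. f xs * g xs)"
proof -
  assume f: "rec_fun k f" and g: "rec_fun k g"
  have "rec_fun (Suc (Suc 2)) (\<lambda>ys. ys ! 1 + ys ! 2)" by (rule rec_fun_add; rule rec_fun_proj) simp_all
  from rec_fun_rec[OF rec_fun_proj[of 1 2] rec_fun_zero this]
  have "rec_fun 2 (\<lambda>xs. rec_nat 0 (\<lambda>m y. y + xs ! 0) (xs ! 1))" by simp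
  moreover have "rec_nat 0 (\<lambda>m y. y + a) b = a * b" for a b :: nat by (induction b) auto
  ultimately have "rec_fun 2 (\<lambda>xs. xs ! 0 * xs ! 1)" by (simp only:)
  from rec_fun_app2[OF this f g] show ?thesis .
qed

lemma rec_fun_triangle: "rec_fun k f \<Longrightarrow> rec_fun k (\<lambda>xs. triangle (f xs))"
proof -
  assume f: "rec_fun k f"
  have "rec_fun (Suc (Suc k)) (\<lambda>ys. ys ! 1 + Suc (ys ! 0))"
    by (rule rec_fun_add, rule rec_fun_proj, simp, rule rec_fun_Suc, rule rec_fun_proj) simp
  from rec_fun_rec[OF f rec_fun_zero this]
  have "rec_fun k (\<lambda>xs. rec_nat 0 (\<lambda>m y. y + Suc m) (f xs))" by simp
  moreover have "rec_nat 0 (\<lambda>m y. y + Suc m) b = triangle b" for b by (induction b) auto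
  ultimately show ?thesis by (simp only:)
qed

lemma rec_fun_prod_encode:
  "rec_fun k f \<Longrightarrow> rec_fun k g \<Longrightarrow> rec_fun k (\<lambda>xs. prod_encode (f xs, g xs))"
  unfolding prod_encode_def split_conv by (rule rec_fun_add[OF rec_fun_triangle[OF rec_fun_add]])

lemma triangle_mono: "m \<le> n \<Longrightarrow> triangle m \<le> triangle n"
  by (induction n) (auto simp: le_Suc_eq)

text \<open>The codes of the pairs with sum s fill the interval from \<open>triangle s\<close> up
  to, but excluding, \<open>triangle (Suc s)\<close>. A search finds this diagonal, and both
  coordinates then follow by subtraction.\<close>

lemma prod_decode_sum: "(LEAST s. z < triangle (Suc s)) = fst (prod_decode z) + snd (prod_decode z)"
proof -
  obtain m n where mn: "prod_decode z = (m, n)" by fastforce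
  then have z: "z = triangle (m + n) + m" using prod_decode_inverse[of z] by (simp add: prod_encode_def)
  have "(LEAST s. z < triangle (Suc s)) = m + n"
  proof (rule Least_equality)
    show "m + n \<le> s" if "z < triangle (Suc s)" for s
    proof (rule ccontr)
      assume "\<not> m + n \<le> s"
      then have "triangle (Suc s) \<le> triangle (m + n)" by (intro triangle_mono) simp
      with that z show False by simp
    qed
  qed (simp add: z)
  then show ?thesis by (simp add: mn)
qed

lemma rec_fun_prod_decode:
  shows "rec_fun k f \<Longrightarrow> rec_fun k (\<lambda>xs. fst (prod_decode (f xs)))"
    and "rec_fun k f \<Longrightarrow> rec_fun k (\<lambda>xs. snd (prod_decode (f xs)))"
proof -
  define S where "S z = fst (prod_decode z) + snd (prod_decode z)" for z
  have "rec_fun (Suc 1) (\<lambda>ys. Suc (ys ! 1) - triangle (Suc (ys ! 0)))"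
    by (rule rec_fun_diff[OF rec_fun_Suc rec_fun_triangle[OF rec_fun_Suc]]; rule rec_fun_proj) simp_all
  from rec_fun_Least[OF this]
  have "rec_fun 1 (\<lambda>xs. LEAST s. Suc ((s # xs) ! 1) - triangle (Suc ((s # xs) ! 0)) = 0)"
  proof this
    show "\<exists>s. Suc ((s # xs) ! 1) - triangle (Suc ((s # xs) ! 0)) = 0" for xs :: "nat list"
      by (rule exI[of _ "xs ! 0"]) simp
  qed
  then have "rec_fun 1 (\<lambda>xs. LEAST s. Suc (xs ! 0) - triangle (Suc s) = 0)" by simp
  moreover have "(LEAST s. Suc z - triangle (Suc s) = 0) = S z" for z
    unfolding S_def prod_decode_sum[symmetric] by (simp only: diff_is_0_eq Suc_le_eq)
  ultimately have S: "rec_fun 1 (\<lambda>xs. S (xs ! 0))" by (simp only:)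
  have z: "z = triangle (S z) + fst (prod_decode z)" for z
    using prod_decode_inverse[of z] by (simp add: S_def prod_encode_def case_prod_unfold)
  have fst: "fst (prod_decode z) = z - triangle (S z)" for z using z[of z] by linarith
  have snd: "snd (prod_decode z) = S z - (z - triangle (S z))" for z
    using fst[of z] by (simp add: S_def)
  note S' = rec_fun_app1[OF S]
  show "rec_fun k f \<Longrightarrow> rec_fun k (\<lambda>xs. fst (prod_decode (f xs)))"
    unfolding fst by (rule rec_fun_diff[OF _ rec_fun_triangle[OF S']])
  show "rec_fun k f \<Longrightarrow> rec_fun k (\<lambda>xs. snd (prod_decode (f xs)))"
    unfolding snd by (rule rec_fun_diff[OF S' rec_fun_diff[OF _ rec_fun_triangle[OF S']]])
qed

section \<open>Computable functions of one argument\<close>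

definition cf :: "(nat \<Rightarrow> nat) \<Rightarrow> bool" where
  "cf f \<longleftrightarrow> rec_fun 1 (\<lambda>xs. f (xs ! 0))"

lemma cf_iff: "cf f \<longleftrightarrow> (\<exists>p. \<forall>n. rec_eval p [n] (f n))"
proof -
  have "(\<forall>xs. length xs = 1 \<longrightarrow> rec_eval p xs (f (xs ! 0))) \<longleftrightarrow> (\<forall>n. rec_eval p [n] (f n))" for p
  proof
    assume "\<forall>n. rec_eval p [n] (f n)"
    then show "\<forall>xs. length xs = 1 \<longrightarrow> rec_eval p xs (f (xs ! 0))"
      by (auto simp: length_Suc_conv)
  next
    assume *: "\<forall>xs. length xs = 1 \<longrightarrow> rec_eval p xs (f (xs ! 0))"
    show "\<forall>n. rec_eval p [n] (f n)" using *[rule_format, of "[n]" for n] by simp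
  qed
  then show ?thesis by (simp add: cf_def rec_fun_def)
qed

lemma cf_id: "cf (\<lambda>n. n)"
  unfolding cf_def by (rule rec_fun_proj) simp

lemma cf_comp: "cf f \<Longrightarrow> cf g \<Longrightarrow> cf (\<lambda>n. f (g n))"
  unfolding cf_def by (rule rec_fun_app1)

lemma cf_basic:
  shows "cf (\<lambda>_. c)"
    and "cf f \<Longrightarrow> cf (\<lambda>n. Suc (f n))"
    and "cf f \<Longrightarrow> cf g \<Longrightarrow> cf (\<lambda>n. f n + g n)"
    and "cf f \<Longrightarrow> cf g \<Longrightarrow> cf (\<lambda>n. f n - g n)"
    and "cf f \<Longrightarrow> cf g \<Longrightarrow> cf (\<lambda>n. f n * g n)"
    and "cf f \<Longrightarrow> cf g \<Longrightarrow> cf (\<lambda>n. prod_encode (f n, g n))"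
    and "cf f \<Longrightarrow> cf (\<lambda>n. fst (prod_decode (f n)))"
    and "cf f \<Longrightarrow> cf (\<lambda>n. snd (prod_decode (f n)))"
  unfolding cf_def
  by (rule rec_fun_const rec_fun_Suc rec_fun_add rec_fun_diff rec_fun_mult rec_fun_prod_encode
      rec_fun_prod_decode; assumption)+

subsection \<open>Encodable types\<close>

text \<open>The function \<open>dec\<close> need not be injective; normalizing a code must be computable.\<close>

class coded =
  fixes enc :: "'a \<Rightarrow> nat" and dec :: "nat \<Rightarrow> 'a"
  assumes dec_enc [simp]: "dec (enc x) = x"
    and cf_norm: "cf (\<lambda>n. enc (dec n))"

lemma enc_inject [simp]: "enc x = enc y \<longleftrightarrow> x = y"
  by (metis dec_enc)

definition cmp :: "('a::coded \<Rightarrow> 'b::coded) \<Rightarrow> bool" where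
  "cmp f \<longleftrightarrow> cf (\<lambda>n. enc (f (dec n)))"

named_theorems cmp_intros

instantiation nat :: coded
begin
definition "enc (n :: nat) = n"
definition "dec (n :: nat) = n"
instance by standard (simp_all add: enc_nat_def dec_nat_def cf_id)
end

instantiation bool :: coded
begin
definition "enc (b :: bool) = (if b then 1 else 0 :: nat)"
definition "dec (n :: nat) = (n \<noteq> 0)"
instance
proof
  show "dec (enc x) = x" for x :: bool by (simp add: enc_bool_def dec_bool_def)
  have "cf (\<lambda>n. 1 - (1 - n))" by (intro cf_basic cf_id)
  moreover have "(\<lambda>n. 1 - (1 - n)) = (\<lambda>n. enc (dec n :: bool))"
    by (auto simp: enc_bool_def dec_bool_def fun_eq_iff)
  ultimately show "cf (\<lambda>n. enc (dec n :: bool))" by simp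
qed
end

instantiation prod :: (coded, coded) coded
begin
definition "enc x = prod_encode (enc (fst x), enc (snd x))"
definition "dec n = (dec (fst (prod_decode n)), dec (snd (prod_decode n)))"
instance
proof
  show "dec (enc x) = x" for x :: "'a \<times> 'b" by (simp add: enc_prod_def dec_prod_def)
  have "cf (\<lambda>n. prod_encode (enc (dec (fst (prod_decode n)) :: 'a), enc (dec (snd (prod_decode n)) :: 'b)))"
    by (rule cf_basic(6)[OF cf_comp[OF cf_norm[where 'a = 'a] cf_basic(7)[OF cf_id]]
          cf_comp[OF cf_norm[where 'a = 'b] cf_basic(8)[OF cf_id]]])
  then show "cf (\<lambda>n. enc (dec n :: 'a \<times> 'b))" by (simp add: enc_prod_def dec_prod_def)
qed
end

lemma cmp_id [cmp_intros]: "cmp (\<lambda>x. x)"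
  by (simp add: cmp_def cf_norm)

lemma cmp_const [cmp_intros]: "cmp (\<lambda>x. c)"
  unfolding cmp_def by (rule cf_basic)

lemma cmp_comp: "cmp f \<Longrightarrow> cmp g \<Longrightarrow> cmp (\<lambda>x. f (g x))"
  unfolding cmp_def using cf_comp[of "\<lambda>n. enc (f (dec n))" "\<lambda>n. enc (g (dec n))"] by simp

lemma cmp_Pair [cmp_intros]: "cmp f \<Longrightarrow> cmp g \<Longrightarrow> cmp (\<lambda>x. (f x, g x))"
  unfolding cmp_def by (simp add: enc_prod_def cf_basic)

lemma cmp_comp2: "cmp (\<lambda>p. f (fst p) (snd p)) \<Longrightarrow> cmp g \<Longrightarrow> cmp h \<Longrightarrow> cmp (\<lambda>x. f (g x) (h x))"
  using cmp_comp[of "\<lambda>p. f (fst p) (snd p)" "\<lambda>x. (g x, h x)"] by (simp add: cmp_Pair)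

lemma cmp_comp3:
  "cmp (\<lambda>p. f (fst p) (fst (snd p)) (snd (snd p))) \<Longrightarrow> cmp g \<Longrightarrow> cmp h \<Longrightarrow> cmp k \<Longrightarrow>
    cmp (\<lambda>x. f (g x) (h x) (k x))"
  using cmp_comp[of "\<lambda>p. f (fst p) (fst (snd p)) (snd (snd p))" "\<lambda>x. (g x, h x, k x)"]
  by (simp add: cmp_Pair)

lemma cmp_fst0: "cmp (fst :: 'a::coded \<times> 'b::coded \<Rightarrow> 'a)"
  and cmp_snd0: "cmp (snd :: 'a::coded \<times> 'b::coded \<Rightarrow> 'b)"
proof -
  show "cmp (fst :: 'a \<times> 'b \<Rightarrow> 'a)"
    unfolding cmp_def dec_prod_def fst_conv by (rule cf_comp[OF cf_norm cf_basic(7)[OF cf_id]])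
  show "cmp (snd :: 'a \<times> 'b \<Rightarrow> 'b)"
    unfolding cmp_def dec_prod_def snd_conv by (rule cf_comp[OF cf_norm cf_basic(8)[OF cf_id]])
qed

lemma cmp_fst [cmp_intros]: "cmp f \<Longrightarrow> cmp (\<lambda>x. fst (f x))"
  by (rule cmp_comp[OF cmp_fst0])

lemma cmp_snd [cmp_intros]: "cmp f \<Longrightarrow> cmp (\<lambda>x. snd (f x))"
  by (rule cmp_comp[OF cmp_snd0])

lemma cmp_case_prod [cmp_intros]:
  "cmp (\<lambda>x. f x (fst (q x)) (snd (q x))) \<Longrightarrow> cmp (\<lambda>x. case q x of (a, b) \<Rightarrow> f x a b)"
  by (simp add: case_prod_unfold)

lemma cmp_enc [cmp_intros]: "cmp f \<Longrightarrow> cmp (\<lambda>x. enc (f x))"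
  by (simp add: cmp_def enc_nat_def)

lemma cmp_dec [cmp_intros]: "cmp f \<Longrightarrow> cmp (\<lambda>x. dec (f x))"
  unfolding cmp_def enc_nat_def by (rule cf_comp[OF cf_norm])

lemma cmp_arith [cmp_intros]:
  fixes f g :: "'a::coded \<Rightarrow> nat"
  shows "cmp f \<Longrightarrow> cmp (\<lambda>x. Suc (f x))"
    and "cmp f \<Longrightarrow> cmp g \<Longrightarrow> cmp (\<lambda>x. f x + g x)"
    and "cmp f \<Longrightarrow> cmp g \<Longrightarrow> cmp (\<lambda>x. f x - g x)"
    and "cmp f \<Longrightarrow> cmp g \<Longrightarrow> cmp (\<lambda>x. f x * g x)"
    and "cmp f \<Longrightarrow> cmp g \<Longrightarrow> cmp (\<lambda>x. prod_encode (f x, g x))"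
    and "cmp f \<Longrightarrow> cmp (\<lambda>x. prod_decode (f x))"
  unfolding cmp_def enc_nat_def enc_prod_def by (auto intro: cf_basic)

lemma cmp_if [cmp_intros]:
  assumes "cmp P" "cmp f" "cmp g"
  shows "cmp (\<lambda>x. if P x then f x else g x)"
proof -
  have "cf (\<lambda>n. enc (P (dec n)) * enc (f (dec n)) + (1 - enc (P (dec n))) * enc (g (dec n)))"
    using assms unfolding cmp_def by (intro cf_basic)
  moreover have "(\<lambda>n. enc (P (dec n)) * enc (f (dec n)) + (1 - enc (P (dec n))) * enc (g (dec n))) =
    (\<lambda>n. enc (if P (dec n) then f (dec n) else g (dec n)))"
    by (auto simp: enc_bool_def)
  ultimately show ?thesis by (simp add: cmp_def)
qed

lemma cmp_bool [cmp_intros]: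
  shows "cmp P \<Longrightarrow> cmp (\<lambda>x. \<not> P x)"
    and "cmp P \<Longrightarrow> cmp Q \<Longrightarrow> cmp (\<lambda>x. P x \<and> Q x)"
    and "cmp P \<Longrightarrow> cmp Q \<Longrightarrow> cmp (\<lambda>x. P x \<or> Q x)"
    and "cmp P \<Longrightarrow> cmp Q \<Longrightarrow> cmp (\<lambda>x. P x \<longrightarrow> Q x)"
proof -
  have *: "(\<not> p) = (if p then False else True)" "(p \<and> q) = (if p then q else False)"
    "(p \<or> q) = (if p then True else q)" "(p \<longrightarrow> q) = (if p then q else True)" for p q by simp_all
  show "cmp P \<Longrightarrow> cmp (\<lambda>x. \<not> P x)" unfolding *(1) by (intro cmp_if cmp_const)
  show "cmp P \<Longrightarrow> cmp Q \<Longrightarrow> cmp (\<lambda>x. P x \<and> Q x)" unfolding *(2) by (intro cmp_if cmp_const)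
  show "cmp P \<Longrightarrow> cmp Q \<Longrightarrow> cmp (\<lambda>x. P x \<or> Q x)" unfolding *(3) by (intro cmp_if cmp_const)
  show "cmp P \<Longrightarrow> cmp Q \<Longrightarrow> cmp (\<lambda>x. P x \<longrightarrow> Q x)" unfolding *(4) by (intro cmp_if cmp_const)
qed

lemma cmp_less_eq_nat [cmp_intros]:
  fixes f g :: "'a::coded \<Rightarrow> nat"
  assumes "cmp f" "cmp g"
  shows "cmp (\<lambda>x. f x \<le> g x)" "cmp (\<lambda>x. f x < g x)"
proof -
  have "cf (\<lambda>n. 1 - (enc (f (dec n)) - enc (g (dec n))))"
    using assms unfolding cmp_def by (intro cf_basic)
  moreover have "1 - (enc (f x) - enc (g x)) = enc (f x \<le> g x)" for x
    by (auto simp: enc_bool_def enc_nat_def)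
  ultimately show "cmp (\<lambda>x. f x \<le> g x)" by (simp add: cmp_def)
  have "cf (\<lambda>n. 1 - (Suc (enc (f (dec n))) - enc (g (dec n))))"
    using assms unfolding cmp_def by (intro cf_basic)
  moreover have "1 - (Suc (enc (f x)) - enc (g x)) = enc (f x < g x)" for x
    by (auto simp: enc_bool_def enc_nat_def)
  ultimately show "cmp (\<lambda>x. f x < g x)" by (simp add: cmp_def)
qed

lemma cmp_eq [cmp_intros]:
  assumes "cmp f" "cmp g"
  shows "cmp (\<lambda>x. f x = g x)"
proof -
  have "cmp (\<lambda>x. enc (f x) \<le> enc (g x) \<and> enc (g x) \<le> enc (f x))"
    by (intro cmp_intros assms)
  moreover have "enc a \<le> enc b \<and> enc b \<le> enc a \<longleftrightarrow> a = b" for a b :: 'b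
    by (metis antisym_conv enc_inject order_refl)
  ultimately show ?thesis by simp
qed

text \<open>The recursion runs on codes. Since \<open>dec\<close> undoes \<open>enc\<close>, the
  coded iteration only ever holds codes of the true intermediate values.\<close>

lemma cmp_rec_nat:
  assumes n: "cmp n" and a: "cmp a" and g: "cmp (\<lambda>p. g (fst p) (fst (snd p)) (snd (snd p)))"
  shows "cmp (\<lambda>x. rec_nat (a x) (\<lambda>m y. g x m y) (n x))"
proof -
  let ?G = "\<lambda>k. enc (g (dec (fst (prod_decode k))) (fst (prod_decode (snd (prod_decode k))))
    (dec (snd (prod_decode (snd (prod_decode k))))))"
  have G: "rec_fun 1 (\<lambda>xs. ?G (xs ! 0))"
    using g unfolding cmp_def cf_def by (simp add: dec_prod_def dec_nat_def)
  have G3: "rec_fun (Suc (Suc 1)) (\<lambda>ys. ?G (prod_encode (ys ! 2, prod_encode (ys ! 0, ys ! 1))))"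
    by (rule rec_fun_app1[OF G], rule rec_fun_prod_encode[OF rec_fun_proj rec_fun_prod_encode];
        (rule rec_fun_proj)?) simp_all
  have "rec_fun 1 (\<lambda>xs. enc (n (dec (xs ! 0))))" "rec_fun 1 (\<lambda>xs. enc (a (dec (xs ! 0))))"
    using n a by (simp_all add: cmp_def cf_def)
  from rec_fun_rec[OF this G3]
  have "rec_fun 1 (\<lambda>xs. rec_nat (enc (a (dec (xs ! 0))))
      (\<lambda>m y. enc (g (dec (xs ! 0)) m (dec y))) (enc (n (dec (xs ! 0)))))"
    by simp
  moreover have "rec_nat (enc (a x)) (\<lambda>m y. enc (g x m (dec y))) k = enc (rec_nat (a x) (g x) k)" for x k
    by (induction k) auto
  ultimately show ?thesis by (simp add: cmp_def cf_def enc_nat_def)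
qed

lemma cmp_Least [cmp_intros]:
  fixes P :: "'a::coded \<Rightarrow> nat \<Rightarrow> bool"
  assumes P: "cmp (\<lambda>p. P (fst p) (snd p))" and ex: "\<And>x. \<exists>n. P x n"
  shows "cmp (\<lambda>x. LEAST n. P x n)"
proof -
  have "cf (\<lambda>k. 1 - enc (P (dec (fst (prod_decode k))) (snd (prod_decode k))))"
    using P unfolding cmp_def by (intro cf_basic) (simp add: dec_prod_def dec_nat_def)
  then have Q: "rec_fun 1 (\<lambda>xs. 1 - enc (P (dec (fst (prod_decode (xs ! 0)))) (snd (prod_decode (xs ! 0)))))"
    unfolding cf_def .
  have "rec_fun (Suc 1) (\<lambda>ys. prod_encode (ys ! 1, ys ! 0))"
    by (rule rec_fun_prod_encode; rule rec_fun_proj) simp_all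
  from rec_fun_app1[OF Q this]
  have "rec_fun (Suc 1) (\<lambda>ys. 1 - enc (P (dec (ys ! 1)) (ys ! 0)))" by simp
  from rec_fun_Least[OF this]
  have "rec_fun 1 (\<lambda>xs. LEAST n. 1 - enc (P (dec ((n # xs) ! 1)) ((n # xs) ! 0)) = 0)"
  proof this
    fix xs :: "nat list"
    obtain n where "P (dec (xs ! 0)) n" using ex by blast
    then show "\<exists>n. 1 - enc (P (dec ((n # xs) ! 1)) ((n # xs) ! 0)) = 0"
      by (auto simp: enc_bool_def)
  qed
  moreover have "1 - enc b = 0 \<longleftrightarrow> b" for b :: bool by (simp add: enc_bool_def)
  ultimately show ?thesis by (simp add: cmp_def cf_def enc_nat_def)
qed

text \<open>Adding the alternative \<open>b x \<le> n\<close> makes the minimization total; the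
  bounded quantifier holds exactly if the search stops before the bound.\<close>

lemma cmp_ex_less [cmp_intros]:
  fixes P :: "'a::coded \<Rightarrow> nat \<Rightarrow> bool"
  assumes P: "cmp (\<lambda>p. P (fst p) (snd p))" and b: "cmp b"
  shows "cmp (\<lambda>x. \<exists>n<b x. P x n)"
proof -
  have "cmp (\<lambda>x. LEAST n. P x n \<or> b x \<le> n)"
  proof (rule cmp_Least)
    show "cmp (\<lambda>p. P (fst p) (snd p) \<or> b (fst p) \<le> snd p)"
      by (intro cmp_bool cmp_less_eq_nat P cmp_comp[OF b] cmp_fst cmp_snd cmp_id)
  qed blast
  then have "cmp (\<lambda>x. (LEAST n. P x n \<or> b x \<le> n) < b x)"
    by (intro cmp_less_eq_nat b)
  moreover have "(LEAST n. P x n \<or> b x \<le> n) < b x \<longleftrightarrow> (\<exists>n<b x. P x n)" for x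
  proof
    assume "(LEAST n. P x n \<or> b x \<le> n) < b x"
    moreover have "P x (LEAST n. P x n \<or> b x \<le> n) \<or> b x \<le> (LEAST n. P x n \<or> b x \<le> n)"
      by (rule LeastI[of _ "b x"]) simp
    ultimately show "\<exists>n<b x. P x n" by auto
  next
    assume "\<exists>n<b x. P x n"
    then obtain n where "n < b x" "P x n" by blast
    moreover from this have "(LEAST n. P x n \<or> b x \<le> n) \<le> n" by (intro Least_le) simp
    ultimately show "(LEAST n. P x n \<or> b x \<le> n) < b x" by simp
  qed
  ultimately show ?thesis by simp
qed

lemma cmp_div_mod [cmp_intros]:
  fixes f :: "'a::coded \<Rightarrow> nat"
  assumes "cmp f" "0 < c"
  shows "cmp (\<lambda>x. f x div c)" "cmp (\<lambda>x. f x mod c)"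
proof -
  have "cmp (\<lambda>x. LEAST q. f x < Suc q * c)"
  proof (intro cmp_intros cmp_comp[OF assms(1)])
    show "\<exists>q. f x < Suc q * c" for x
      using assms(2) by (intro exI[of _ "f x"]) (cases c, auto)
  qed
  moreover have "(LEAST q. f x < Suc q * c) = f x div c" for x
  proof (rule Least_equality)
    show "f x < Suc (f x div c) * c" using assms(2) by (rule dividend_less_div_times[THEN order.strict_trans2]) simp
    show "f x div c \<le> q" if "f x < Suc q * c" for q
      using that assms(2) by (simp add: div_less_iff_less_mult less_Suc_eq_le[symmetric])
  qed
  ultimately show *: "cmp (\<lambda>x. f x div c)" by simp
  have "cmp (\<lambda>x. f x - f x div c * c)" by (intro cmp_intros assms(1) *)
  then show "cmp (\<lambda>x. f x mod c)" by (simp add: minus_div_mult_eq_mod)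
qed

subsection \<open>Integers\<close>

lemma int_encode_nonneg: "int_encode (int n) = 2 * n"
  by (simp add: int_encode_def sum_encode_def)

lemma int_encode_neg: "int_encode (- int n - 1) = Suc (2 * n)"
  by (simp add: int_encode_def sum_encode_def)

lemma nat_int_decode: "nat (int_decode n) = (if n mod 2 = 0 then n div 2 else 0)"
  by (auto simp: int_decode_def sum_decode_def even_iff_mod_2_eq_zero)

lemma nat_minus_int_decode: "nat (- int_decode n) = (if n mod 2 = 0 then 0 else Suc (n div 2))"
  by (auto simp: int_decode_def sum_decode_def even_iff_mod_2_eq_zero nat_add_distrib)

instantiation int :: coded
begin
definition "enc (i :: int) = int_encode i"
definition "dec n = int_decode n"
instance by standard (simp_all add: enc_int_def dec_int_def cf_id)
end

lemma cmp_int_diff: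
  assumes "cmp f" "cmp g"
  shows "cmp (\<lambda>x. int (f x) - int (g x))"
proof -
  have "cmp (\<lambda>x. if g x \<le> f x then 2 * (f x - g x) else Suc (2 * (g x - f x - 1)))"
    by (intro cmp_intros assms)
  moreover have "(if b \<le> a then 2 * (a - b) else Suc (2 * (b - a - 1))) = int_encode (int a - int b)" for a b
  proof (cases "b \<le> a")
    case True
    then show ?thesis using int_encode_nonneg[of "a - b"] by (simp add: of_nat_diff)
  next
    case False
    then have "int a - int b = - int (b - a - 1) - 1" by (simp add: of_nat_diff)
    then show ?thesis using False int_encode_neg[of "b - a - 1"] by simp
  qed
  ultimately show ?thesis by (simp add: cmp_def enc_int_def enc_nat_def)
qed

lemma cmp_int [cmp_intros]: "cmp f \<Longrightarrow> cmp (\<lambda>x. int (f x))"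
  using cmp_int_diff[of f "\<lambda>_. 0"] by (simp add: cmp_const)

lemma cmp_nat [cmp_intros]: "cmp f \<Longrightarrow> cmp (\<lambda>x. nat (f x))"
proof (rule cmp_comp[of nat])
  have "cmp (\<lambda>n::nat. if n mod 2 = 0 then n div 2 else 0)" by (intro cmp_intros) simp_all
  then show "cmp nat" by (simp add: cmp_def enc_nat_def dec_nat_def dec_int_def nat_int_decode cong: if_cong)
qed

lemma cmp_nat_minus: "cmp f \<Longrightarrow> cmp (\<lambda>x. nat (- f x))"
proof (rule cmp_comp[of "\<lambda>i. nat (- i)"])
  have "cmp (\<lambda>n::nat. if n mod 2 = 0 then 0 else Suc (n div 2))" by (intro cmp_intros) simp_all
  then show "cmp (\<lambda>i. nat (- i))"
    by (simp add: cmp_def enc_nat_def dec_nat_def dec_int_def nat_minus_int_decode cong: if_cong)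
qed

text \<open>An integer i is the difference of \<open>nat i\<close> and \<open>nat (- i)\<close>.
  Each operation is rewritten as an operation on such differences, so that only natural numbers are
  computed with.\<close>

lemma cmp_int_arith [cmp_intros]:
  fixes f g :: "'a::coded \<Rightarrow> int"
  assumes f: "cmp f"
  shows "cmp (\<lambda>x. - f x)" "cmp (\<lambda>x. \<bar>f x\<bar>)"
    and "cmp g \<Longrightarrow> cmp (\<lambda>x. f x + g x)"
    and "cmp g \<Longrightarrow> cmp (\<lambda>x. f x - g x)"
    and "cmp g \<Longrightarrow> cmp (\<lambda>x. f x \<le> g x)"
    and "cmp g \<Longrightarrow> cmp (\<lambda>x. f x < g x)"
proof -
  note n = cmp_nat[OF f] cmp_nat_minus[OF f]
  have "cmp (\<lambda>x. int (nat (- f x)) - int (nat (f x)))" by (intro cmp_int_diff n)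
  moreover have "int (nat (- f x)) - int (nat (f x)) = - f x" for x by linarith
  ultimately show "cmp (\<lambda>x. - f x)" by (simp only:)
  have "cmp (\<lambda>x. int (nat (f x) + nat (- f x)))" by (intro cmp_int cmp_arith n)
  moreover have "int (nat (f x) + nat (- f x)) = \<bar>f x\<bar>" for x by linarith
  ultimately show "cmp (\<lambda>x. \<bar>f x\<bar>)" by (simp only:)
  assume g: "cmp g"
  note n = n cmp_nat[OF g] cmp_nat_minus[OF g]
  have "cmp (\<lambda>x. int (nat (f x) + nat (g x)) - int (nat (- f x) + nat (- g x)))"
    by (intro cmp_int_diff cmp_arith n)
  moreover have "int (nat (f x) + nat (g x)) - int (nat (- f x) + nat (- g x)) = f x + g x" for x
    by linarith
  ultimately show "cmp (\<lambda>x. f x + g x)" by (simp only:)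
  have "cmp (\<lambda>x. int (nat (f x) + nat (- g x)) - int (nat (- f x) + nat (g x)))"
    by (intro cmp_int_diff cmp_arith n)
  moreover have "int (nat (f x) + nat (- g x)) - int (nat (- f x) + nat (g x)) = f x - g x" for x
    by linarith
  ultimately show "cmp (\<lambda>x. f x - g x)" by (simp only:)
  have "cmp (\<lambda>x. nat (f x) + nat (- g x) \<le> nat (- f x) + nat (g x))"
    by (intro cmp_less_eq_nat cmp_arith n)
  moreover have "nat (f x) + nat (- g x) \<le> nat (- f x) + nat (g x) \<longleftrightarrow> f x \<le> g x" for x
    by linarith
  ultimately show "cmp (\<lambda>x. f x \<le> g x)" by (simp only:)
  have "cmp (\<lambda>x. nat (f x) + nat (- g x) < nat (- f x) + nat (g x))"
    by (intro cmp_less_eq_nat cmp_arith n)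
  moreover have "nat (f x) + nat (- g x) < nat (- f x) + nat (g x) \<longleftrightarrow> f x < g x" for x
    by linarith
  ultimately show "cmp (\<lambda>x. f x < g x)" by (simp only:)
qed

subsection \<open>Lists\<close>

lemma list_encode_length: "length xs \<le> list_encode xs"
proof (induction xs)
  case (Cons x xs)
  then show ?case using le_prod_encode_2[of "list_encode xs" x] by simp
qed simp

lemma list_encode_elem: "x \<in> set xs \<Longrightarrow> x < list_encode xs"
proof (induction xs)
  case (Cons y xs)
  then show ?case
    using le_prod_encode_1[of y "list_encode xs"] le_prod_encode_2[of "list_encode xs" y] by auto
qed simp

text \<open>This is proved on bare codes because normalizing a list code is itself such a map, so
  the statement has to precede the instance for lists. One pass reverses the list while applying
  \<open>F\<close>, the second reverses it back. Each pass is iterated as often as the code says,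
  which is at least the length; an exhausted state no longer changes.\<close>

lemma cf_map_code:
  assumes F: "cf F"
  shows "cf (\<lambda>n. list_encode (map F (list_decode n)))"
proof -
  \<comment> \<open>The state is the pair of the unread part of the list and the reversed output.\<close>
  define step where "step = (\<lambda>(a::nat, b::nat). if a = 0 then (a, b)
    else (snd (prod_decode (a - 1)), Suc (prod_encode (F (fst (prod_decode (a - 1))), b))))"
  have F': "cmp f \<Longrightarrow> cmp (\<lambda>x. F (f x))" for f :: "'z::coded \<Rightarrow> nat"
    using F cmp_comp[of F f] by (simp add: cmp_def enc_nat_def dec_nat_def)
  define rv where "rv a = snd (rec_nat (a, 0) (\<lambda>_. step) a)" for a
  have it: "cmp (\<lambda>a::nat. rec_nat (a, 0::nat) (\<lambda>_. step) a)"
    unfolding step_def case_prod_unfold by (intro cmp_rec_nat cmp_intros F')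
  have run: "rec_nat (a, b) (\<lambda>_. step) n = (list_encode (drop n xs),
      list_encode (rev (map F (take n xs)) @ ys))"
    if "a = list_encode xs" "b = list_encode ys" for n a b xs ys
  proof (induction n)
    case (Suc n)
    show ?case
    proof (cases "drop n xs")
      case Nil
      then show ?thesis using Suc by (simp add: step_def)
    next
      case (Cons y zs)
      then have "n < length xs" and y: "y = xs ! n" and "zs = drop (Suc n) xs"
        by (metis drop_all list.distinct(1) not_less, metis Cons nth_via_drop, metis Cons drop_Suc list.sel(3) tl_drop)
      then show ?thesis using Suc Cons by (simp add: step_def take_Suc_conv_app_nth)
    qed
  qed (use that in simp)
  have rv: "rv (list_encode xs) = list_encode (rev (map F xs))" for xs
    using run[of "list_encode xs" xs 0 "[]" "list_encode xs"] list_encode_length[of xs]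
    by (simp add: rv_def)
  define step2 where "step2 = (\<lambda>(a::nat, b::nat). if a = 0 then (a, b)
    else (snd (prod_decode (a - 1)), Suc (prod_encode (fst (prod_decode (a - 1)), b))))"
  define rv2 where "rv2 a = snd (rec_nat (a, 0) (\<lambda>_. step2) a)" for a
  have it2: "cmp (\<lambda>a::nat. rec_nat (a, 0::nat) (\<lambda>_. step2) a)"
    unfolding step2_def case_prod_unfold by (intro cmp_rec_nat cmp_intros)
  have run2: "rec_nat (a, b) (\<lambda>_. step2) n = (list_encode (drop n xs),
      list_encode (rev (take n xs) @ ys))"
    if "a = list_encode xs" "b = list_encode ys" for n a b xs ys
  proof (induction n)
    case (Suc n)
    show ?case
    proof (cases "drop n xs")
      case Nil
      then show ?thesis using Suc by (simp add: step2_def)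
    next
      case (Cons y zs)
      then have "n < length xs" and y: "y = xs ! n" and "zs = drop (Suc n) xs"
        by (metis drop_all list.distinct(1) not_less, metis Cons nth_via_drop, metis Cons drop_Suc list.sel(3) tl_drop)
      then show ?thesis using Suc Cons by (simp add: step2_def take_Suc_conv_app_nth)
    qed
  qed (use that in simp)
  have rv2: "rv2 (list_encode xs) = list_encode (rev xs)" for xs
    using run2[of "list_encode xs" xs 0 "[]" "list_encode xs"] list_encode_length[of xs]
    by (simp add: rv2_def)
  have "cmp (\<lambda>n::nat. rv2 (rv n))"
    unfolding rv_def rv2_def by (intro cmp_comp[OF it2] cmp_intros it)
  moreover have "rv2 (rv n) = list_encode (map F (list_decode n))" for n
    using rv[of "list_decode n"] rv2[of "rev (map F (list_decode n))"] by simp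
  ultimately show ?thesis by (simp add: cmp_def enc_nat_def dec_nat_def)
qed

instantiation list :: (coded) coded
begin
definition "enc xs = list_encode (map enc xs)"
definition "dec n = map dec (list_decode n)"
instance
proof
  show "dec (enc x) = x" for x :: "'a list"
    by (simp add: enc_list_def dec_list_def o_def)
  show "cf (\<lambda>n. enc (dec n :: 'a list))"
    using cf_map_code[OF cf_norm[where 'a = 'a]] by (simp add: enc_list_def dec_list_def o_def)
qed
end

lemma cmp_Cons [cmp_intros]: "cmp f \<Longrightarrow> cmp g \<Longrightarrow> cmp (\<lambda>x. f x # g x)"
  unfolding cmp_def enc_list_def by (simp add: cf_basic)

lemma cmp_case_list [cmp_intros]:
  assumes l: "cmp l" and a: "cmp a" and b: "cmp (\<lambda>p. b (fst p) (fst (snd p)) (snd (snd p)))"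
  shows "cmp (\<lambda>x. case l x of [] \<Rightarrow> a x | y # ys \<Rightarrow> b x y ys)"
proof -
  let ?e = "\<lambda>x. enc (l x) - 1"
  have "cmp (\<lambda>x. if enc (l x) = 0 then a x
      else b x (dec (fst (prod_decode (?e x)))) (dec (snd (prod_decode (?e x)))))"
    by (intro cmp_intros a l cmp_comp3[OF b])
  moreover have "(if enc xs = 0 then a x
      else b x (dec (fst (prod_decode (enc xs - 1)))) (dec (snd (prod_decode (enc xs - 1))))) =
      (case xs of [] \<Rightarrow> a x | y # ys \<Rightarrow> b x y ys)" for x xs
    by (cases xs) (simp_all add: enc_list_def dec_list_def o_def)
  ultimately show ?thesis by simp
qed

lemma cmp_fold [cmp_intros]:
  assumes l: "cmp l" and a: "cmp a" and f: "cmp (\<lambda>p. f (fst p) (fst (snd p)) (snd (snd p)))"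
  shows "cmp (\<lambda>x. fold (f x) (l x) (a x))"
proof -
  define step where "step x = (\<lambda>q. case fst q of [] \<Rightarrow> ([], snd q) | y # ys \<Rightarrow> (ys, f x y (snd q)))" for x
  have "cmp (\<lambda>x. snd (rec_nat (l x, a x) (\<lambda>_. step x) (enc (l x))))"
    unfolding step_def by (intro cmp_intros cmp_rec_nat l a cmp_comp3[OF f])
  moreover have "rec_nat (ys, c) (\<lambda>_. step x) n = (drop n ys, fold (f x) (take n ys) c)" for x ys c n
  proof (induction n)
    case (Suc n)
    show ?case
    proof (cases "drop n ys")
      case Nil
      then show ?thesis using Suc by (simp add: step_def)
    next
      case (Cons y zs)
      then have "n < length ys" and y: "y = ys ! n" and "zs = drop (Suc n) ys"
        by (metis drop_all list.distinct(1) not_less, metis Cons nth_via_drop, metis Cons drop_Suc list.sel(3) tl_drop)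
      then show ?thesis using Suc Cons by (simp add: step_def take_Suc_conv_app_nth)
    qed
  qed simp
  moreover have "length ys \<le> enc ys" for ys :: "'b list"
    using list_encode_length[of "map enc ys"] by (simp add: enc_list_def)
  ultimately show ?thesis by simp
qed

lemma cmp_rev [cmp_intros]: "cmp l \<Longrightarrow> cmp (\<lambda>x. rev (l x))"
proof -
  assume "cmp l"
  then have "cmp (\<lambda>x. fold (\<lambda>y ys. y # ys) (l x) [])" by (intro cmp_intros)
  then show ?thesis by (simp add: rev_conv_fold)
qed

lemma cmp_foldr [cmp_intros]:
  assumes l: "cmp l" and a: "cmp a" and f: "cmp (\<lambda>p. f (fst p) (fst (snd p)) (snd (snd p)))"
  shows "cmp (\<lambda>x. foldr (f x) (l x) (a x))"
  unfolding foldr_conv_fold by (intro cmp_intros l a f)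

lemma cmp_map [cmp_intros]:
  assumes l: "cmp l" and f: "cmp (\<lambda>p. f (fst p) (snd p))"
  shows "cmp (\<lambda>x. map (f x) (l x))"
proof -
  have "cmp (\<lambda>x. foldr (\<lambda>y ys. f x y # ys) (l x) [])" by (intro cmp_intros l cmp_comp2[OF f])
  moreover have "foldr (\<lambda>y ys. g y # ys) xs [] = map g xs" for g :: "'b \<Rightarrow> 'c" and xs
    by (induction xs) auto
  ultimately show ?thesis by simp
qed

lemma cmp_append [cmp_intros]: "cmp l \<Longrightarrow> cmp k \<Longrightarrow> cmp (\<lambda>x. l x @ k x)"
proof -
  assume "cmp l" "cmp k"
  then have "cmp (\<lambda>x. foldr (\<lambda>y ys. y # ys) (l x) (k x))" by (intro cmp_intros)
  moreover have "foldr (\<lambda>y ys. y # ys) xs ys = xs @ ys" for xs ys :: "'b list"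
    by (induction xs) auto
  ultimately show ?thesis by simp
qed

lemma cmp_concat [cmp_intros]: "cmp l \<Longrightarrow> cmp (\<lambda>x. concat (l x))"
proof -
  assume "cmp l"
  then have "cmp (\<lambda>x. foldr (\<lambda>y ys. y @ ys) (l x) [])" by (intro cmp_intros)
  moreover have "foldr (\<lambda>y ys. y @ ys) xs [] = concat xs" for xs :: "'b list list"
    by (induction xs) auto
  ultimately show ?thesis by simp
qed

lemma cmp_length [cmp_intros]: "cmp l \<Longrightarrow> cmp (\<lambda>x. length (l x))"
proof -
  assume "cmp l"
  then have "cmp (\<lambda>x. foldr (\<lambda>y n. Suc n) (l x) 0)" by (intro cmp_intros)
  moreover have "foldr (\<lambda>y n. Suc n) xs 0 = length xs" for xs :: "'b list" by (induction xs) auto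
  ultimately show ?thesis by simp
qed

lemma cmp_tl [cmp_intros]: "cmp l \<Longrightarrow> cmp (\<lambda>x. tl (l x))"
proof -
  assume "cmp l"
  then have "cmp (\<lambda>x. case l x of [] \<Rightarrow> [] | y # ys \<Rightarrow> ys)" by (intro cmp_intros)
  then show ?thesis by (simp add: tl_def)
qed

lemma cmp_drop [cmp_intros]: "cmp n \<Longrightarrow> cmp l \<Longrightarrow> cmp (\<lambda>x. drop (n x) (l x))"
proof -
  assume "cmp n" "cmp l"
  then have "cmp (\<lambda>x. rec_nat (l x) (\<lambda>_ ys. tl ys) (n x))" by (intro cmp_rec_nat cmp_intros)
  moreover have "rec_nat xs (\<lambda>_ ys. tl ys) k = drop k xs" for xs :: "'b list" and k
    by (induction k) (auto simp: drop_Suc tl_drop)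
  ultimately show ?thesis by simp
qed

lemma cmp_take [cmp_intros]: "cmp n \<Longrightarrow> cmp l \<Longrightarrow> cmp (\<lambda>x. take (n x) (l x))"
proof -
  assume "cmp n" "cmp l"
  then have "cmp (\<lambda>x. rev (drop (length (l x) - n x) (rev (l x))))" by (intro cmp_intros)
  moreover have "rev (drop (length xs - k) (rev xs)) = take k xs" for xs :: "'b list" and k
    by (cases "k \<le> length xs") (simp_all add: drop_rev)
  ultimately show ?thesis by simp
qed

lemma cmp_butlast [cmp_intros]: "cmp l \<Longrightarrow> cmp (\<lambda>x. butlast (l x))"
  unfolding butlast_conv_take by (intro cmp_take cmp_arith(3) cmp_length cmp_const)

lemma cmp_replicate [cmp_intros]:
  assumes n: "cmp n" and f: "cmp f"
  shows "cmp (\<lambda>x. replicate (n x) (f x))"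
proof -
  have "cmp (\<lambda>x. rec_nat [] (\<lambda>_ ys. f x # ys) (n x))"
    by (intro cmp_rec_nat cmp_intros n cmp_comp[OF f])
  moreover have "rec_nat [] (\<lambda>_ ys. y # ys) k = replicate k y" for y :: 'b and k
    by (induction k) auto
  ultimately show ?thesis by simp
qed

lemma cmp_list_all [cmp_intros]:
  assumes l: "cmp l" and f: "cmp (\<lambda>p. f (fst p) (snd p))"
  shows "cmp (\<lambda>x. list_all (f x) (l x))"
proof -
  have "cmp (\<lambda>x. foldr (\<lambda>y b. f x y \<and> b) (l x) True)"
    by (intro cmp_intros l cmp_comp2[OF f])
  moreover have "foldr (\<lambda>y b. g y \<and> b) xs True = list_all g xs" for g :: "'b \<Rightarrow> bool" and xs
    by (induction xs) auto
  ultimately show ?thesis by simp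
qed

section \<open>Words and free equality\<close>

definition winv :: "'x word \<Rightarrow> 'x word" where
  "winv w = rev (map (\<lambda>(g, e). (g, \<not> e)) w)"

lemma winv_simps [simp]:
  "winv [] = []" "winv ((g, e) # w) = winv w @ [(g, \<not> e)]"
  "winv (u @ v) = winv v @ winv u" "winv (winv w) = w"
  by (auto simp: winv_def rev_map o_def case_prod_unfold)

inductive feq :: "'x word \<Rightarrow> 'x word \<Rightarrow> bool" (infix \<open>\<doteq>\<close> 50) where
  refl [simp, intro!]: "w \<doteq> w"
| sym: "u \<doteq> v \<Longrightarrow> v \<doteq> u"
| trans: "u \<doteq> v \<Longrightarrow> v \<doteq> w \<Longrightarrow> u \<doteq> w"
| cancel: "u @ (g, e) # (g, \<not> e) # v \<doteq> u @ v"

lemmas [trans] = feq.trans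

lemma feq_append_left: "u \<doteq> v \<Longrightarrow> w @ u \<doteq> w @ v"
proof (induction rule: feq.induct)
  case (cancel u g e v)
  show ?case using feq.cancel[of "w @ u" g e v] by simp
qed (auto intro: feq.sym feq.trans)

lemma feq_append_right: "u \<doteq> v \<Longrightarrow> u @ w \<doteq> v @ w"
proof (induction rule: feq.induct)
  case (cancel u g e v)
  show ?case using feq.cancel[of u g e "v @ w"] by simp
qed (auto intro: feq.sym feq.trans)

lemma feq_append: "u \<doteq> u' \<Longrightarrow> v \<doteq> v' \<Longrightarrow> u @ v \<doteq> u' @ v'"
  by (meson feq.trans feq_append_left feq_append_right)

lemma feq_winv: "u \<doteq> v \<Longrightarrow> winv u \<doteq> winv v"
proof (induction rule: feq.induct)
  case (cancel u g e v)
  show ?case using feq.cancel[of "winv v" g e "winv u"] by simp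
qed (auto intro: feq.sym feq.trans)

lemma feq_winv_right [simp]: "w @ winv w \<doteq> []"
proof (induction w)
  case (Cons x w)
  obtain g e where x: "x = (g, e)" by fastforce
  have "(g, e) # (w @ winv w) @ [(g, \<not> e)] \<doteq> (g, e) # [] @ [(g, \<not> e)]"
    using feq_append[OF feq_append_left[OF Cons.IH, of "[(g, e)]"] feq.refl[of "[(g, \<not> e)]"]] by simp
  also have "\<dots> \<doteq> []" using feq.cancel[of "[]" g e "[]"] by simp
  finally show ?case by (simp add: x)
qed simp

lemma feq_winv_left [simp]: "winv w @ w \<doteq> []"
  using feq_winv_right[of "winv w"] by simp

lemma feq_cancel_mid: "u @ w @ winv w @ v \<doteq> u @ v" "u @ winv w @ w @ v \<doteq> u @ v"
proof -
  have "u @ (w @ winv w) @ v \<doteq> u @ [] @ v" for w :: "'a word"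
    by (intro feq_append feq_winv_right feq.refl)
  from this[of w] this[of "winv w"]
  show "u @ w @ winv w @ v \<doteq> u @ v" "u @ winv w @ w @ v \<doteq> u @ v" by simp_all
qed

definition subst :: "('x \<Rightarrow> 'y word) \<Rightarrow> 'x word \<Rightarrow> 'y word" where
  "subst h w = concat (map (\<lambda>(g, e). if e then winv (h g) else h g) w)"

lemma subst_simps [simp]:
  "subst h [] = []"
  "subst h ((g, e) # w) = (if e then winv (h g) else h g) @ subst h w"
  "subst h (u @ v) = subst h u @ subst h v"
  by (simp_all add: subst_def)

lemma subst_winv [simp]: "subst h (winv w) = winv (subst h w)"
  by (induction w) auto

lemma feq_subst: "u \<doteq> v \<Longrightarrow> subst h u \<doteq> subst h v"
proof (induction rule: feq.induct)
  case (cancel u g e v)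
  then show ?case
    using feq_cancel_mid(1)[of "subst h u" "h g" "subst h v"]
      feq_cancel_mid(2)[of "subst h u" "h g" "subst h v"] by (cases e) simp_all
qed (auto intro: feq.sym feq.trans)

section \<open>Reidemeister-Schreier rewriting for the stabilizer of a point\<close>

section \<open>Permutation actions with sections\<close>

text \<open>A letter acts on points of type \<^typ>\<open>'o\<close> and, above each point, contributes a word in the
  letters of the common subgroup. The words \<open>r n\<close> form a transversal of the stabilizer of
  \<open>z\<close>, and \<open>h s\<close> is the word for the \<open>s\<close>-th free generator of that stabilizer.\<close>

locale side =
  fixes p :: "'l \<Rightarrow> bool \<Rightarrow> 'o \<Rightarrow> 'o"
    and sec :: "'l \<Rightarrow> 'o \<Rightarrow> nat word"
    and r :: "'o \<Rightarrow> 'l word"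
    and z :: 'o
    and h :: "nat \<Rightarrow> 'l word"
  assumes p_inv: "p g e (p g (\<not> e) n) = n"
begin

definition pw :: "'l word \<Rightarrow> 'o \<Rightarrow> 'o" where
  "pw w n = foldr (\<lambda>(g, e). p g e) w n"

definition sec' :: "'l \<Rightarrow> bool \<Rightarrow> 'o \<Rightarrow> nat word" where
  "sec' g e n = (if e then winv (sec g (p g True n)) else sec g n)"

primrec sw :: "'l word \<Rightarrow> 'o \<Rightarrow> nat word" where
  "sw [] n = []"
| "sw (x # w) n = sec' (fst x) (snd x) (pw w n) @ sw w n"

lemma pw_simps [simp]:
  "pw [] n = n" "pw ((g, e) # w) n = p g e (pw w n)" "pw (u @ v) n = pw u (pw v n)"
  by (simp_all add: pw_def)

lemma p_inv' [simp]: "p g e (p g (\<not> e) n) = n" "p g (\<not> e) (p g e n) = n"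
  "p g True (p g False n) = n" "p g False (p g True n) = n"
  using p_inv[of g e] p_inv[of g "\<not> e"] p_inv[of g True] p_inv[of g False] by simp_all

lemma sec'_inv: "sec' g (\<not> e) (p g e n) = winv (sec' g e n)"
  by (cases e) (simp_all add: sec'_def)

lemma sw_append [simp]: "sw (u @ v) n = sw u (pw v n) @ sw v n"
  by (induction u) auto

lemma pw_feq: "u \<doteq> v \<Longrightarrow> pw u n = pw v n"
  by (induction arbitrary: n rule: feq.induct) auto

lemma sw_feq: "u \<doteq> v \<Longrightarrow> sw u n \<doteq> sw v n"
proof (induction arbitrary: n rule: feq.induct)
  case (cancel u g e v)
  have "sec' g e (p g (\<not> e) (pw v n)) = winv (sec' g (\<not> e) (pw v n))"
    using sec'_inv[of g "\<not> e" "pw v n"] by simp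
  then show ?case
    using feq_cancel_mid(2)[of "sw u (pw v n)" "sec' g (\<not> e) (pw v n)" "sw v n"] by simp
qed (blast intro: feq.sym feq.trans)+

lemma pw_winv: "pw (winv w) (pw w n) = n" "pw w (pw (winv w) n) = n"
proof -
  have "pw (winv w @ w) n = n" for w n
    using pw_feq[OF feq_winv_left, of w n] by simp
  from this[of w] this[of "winv w"] show "pw (winv w) (pw w n) = n" "pw w (pw (winv w) n) = n"
    by simp_all
qed

lemma pw_inj: "pw w m = pw w n \<Longrightarrow> m = n"
  by (metis pw_winv(1))

text \<open>The hypothesis concerns only the letters that occur in \<open>u\<close>. This lets the
  lemma serve as the inductive step when the generators \<open>h s\<close> are themselves defined by
  recursion.\<close>

lemma sw_subst_on:
  assumes "\<And>s e. (s, e) \<in> set u \<Longrightarrow> pw (h s) z = z \<and> sw (h s) z \<doteq> [(s, False)]"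
  shows "pw (subst h u) z = z \<and> sw (subst h u) z \<doteq> u"
  using assms
proof (induction u)
  case (Cons x u)
  obtain s e where x: "x = (s, e)" by fastforce
  have IH: "pw (subst h u) z = z" "sw (subst h u) z \<doteq> u" using Cons by (auto simp: x)
  have s: "pw (h s) z = z" "sw (h s) z \<doteq> [(s, False)]" using Cons.prems by (auto simp: x)
  have s': "pw (winv (h s)) z = z" using pw_winv(1)[of "h s" z] s by simp
  have inv: "sw (winv (h s)) z \<doteq> [(s, True)]"
  proof -
    have e: "sw (winv (h s)) z @ sw (h s) z \<doteq> []"
      using sw_feq[OF feq_winv_left[of "h s"], of z] by (simp add: s)
    have "sw (winv (h s)) z \<doteq> sw (winv (h s)) z @ [(s, False)] @ [(s, True)]"
      using feq.cancel[of "sw (winv (h s)) z" s False "[]"] feq.sym by fastforce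
    also have "\<dots> \<doteq> sw (winv (h s)) z @ sw (h s) z @ [(s, True)]"
      by (intro feq_append feq.refl feq.sym[OF s(2)])
    also have "\<dots> \<doteq> [(s, True)]"
      using feq_append_right[OF e, of "[(s, True)]"] by simp
    finally show ?thesis .
  qed
  show ?case
    using feq_append[OF inv IH(2)] feq_append[OF s(2) IH(2)] IH(1) s s' by (simp add: x)
qed simp

end

text \<open>\<open>sec_h\<close> says that \<open>sec g n\<close> is the Schreier generator of the
  edge \<open>g\<close> at \<open>n\<close>, written in the generators \<open>h s\<close>.
  \<open>pw_h\<close> and \<open>sw_h\<close> make \<open>sw\<close> a left inverse of substitution,
  so the words \<open>h s\<close> form a free basis of the stabilizer of \<open>z\<close>.\<close>

locale good_side = side +
  assumes r_z: "r z = []"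
    and pw_r: "pw (r n) z = n"
    and sec_h: "subst h (sec g n) \<doteq> winv (r (p g False n)) @ [(g, False)] @ r n"
    and pw_h: "pw (h s) z = z"
    and sw_h: "sw (h s) z \<doteq> [(s, False)]"
begin

lemma sec'_h: "subst h (sec' g e n) \<doteq> winv (r (p g e n)) @ [(g, e)] @ r n"
proof (cases e)
  case True
  have "winv (subst h (sec g (p g True n))) \<doteq> winv (winv (r n) @ [(g, False)] @ r (p g True n))"
    using sec_h[of g "p g True n"] by (intro feq_winv) simp
  then show ?thesis using True by (simp add: sec'_def)
qed (use sec_h in \<open>simp add: sec'_def\<close>)

text \<open>Along the path of \<open>w\<close> the transversal words of consecutive Schreier
  generators cancel, and only the two outer ones remain.\<close>

lemma sw_transversal: "subst h (sw w n) \<doteq> winv (r (pw w n)) @ w @ r n"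
proof (induction w)
  case (Cons x w)
  obtain g e where x: "x = (g, e)" by fastforce
  have "subst h (sw (x # w) n) \<doteq>
    (winv (r (p g e (pw w n))) @ [(g, e)] @ r (pw w n)) @ winv (r (pw w n)) @ w @ r n"
    using feq_append[OF sec'_h[of g e "pw w n"] Cons.IH] by (simp add: x)
  also have "\<dots> \<doteq> winv (r (pw (x # w) n)) @ (x # w) @ r n"
    using feq_cancel_mid(1)[of "winv (r (p g e (pw w n))) @ [(g, e)]" "r (pw w n)" "w @ r n"]
    by (simp add: x)
  finally show ?case .
qed (use feq_winv_left in \<open>auto intro: feq.sym\<close>)

lemma sw_stab: "pw w z = z \<Longrightarrow> subst h (sw w z) \<doteq> w"
  using sw_transversal[of w z] by (simp add: r_z)

lemma pw_subst [simp]: "pw (subst h u) z = z" and sw_subst: "sw (subst h u) z \<doteq> u"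
  using sw_subst_on pw_h sw_h by blast+

end

section \<open>The second factor\<close>

text \<open>The letter \<open>0\<close> is \<open>b\<close>, the letter \<open>Suc n\<close> is \<open>x_n\<close>. Points come in blocks of three;
  \<open>b\<close> is the 6-cycle (0 3 1 4 2 5) and \<open>x_n\<close> exchanges the block of \<open>0\<close> with the block of \<open>6 + 3n\<close>.
  All letters commute with the rotation of the blocks, so the points 1 and 2 are told apart
  by the stabilizer of 0. A pair \<open>(l, m)\<close> names the generator of this stabilizer given by the
  edge labelled \<open>l\<close> at the point \<open>m + 5\<close> or \<open>m + 3\<close>.\<close>

fun bp :: "nat \<Rightarrow> bool \<Rightarrow> nat \<Rightarrow> nat" where
  "bp 0 e m = (if m < 3 then (if e then 3 + (m + 2) mod 3 else 3 + m)
     else if m < 6 then (if e then m - 3 else (m - 2) mod 3) else m)"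
| "bp (Suc n) e m = (if m < 3 then 6 + 3 * n + m
     else if 6 + 3 * n \<le> m \<and> m < 9 + 3 * n then m - (6 + 3 * n) else m)"

definition br :: "nat \<Rightarrow> nat word" where
  "br m = (if m < 3 then replicate (2 * m) (0, False)
     else if m < 6 then replicate (2 * m - 5) (0, False)
     else (Suc ((m - 6) div 3), False) # replicate (2 * (m mod 3)) (0, False))"

definition edge_pt :: "nat \<Rightarrow> nat \<Rightarrow> nat" where
  "edge_pt l m = (if l = 0 then m + 5 else m + 3)"

text \<open>The edges at points below \<open>edge_pt l 0\<close> form a spanning tree of the
  Schreier graph: \<open>b\<close> at the points 0 to 4 and every other letter at 0, 1, 2. The words
  \<open>br\<close> follow this tree, so these edges have trivial sections and each remaining edge
  is one free generator.\<close>

definition bsec :: "nat \<Rightarrow> nat \<Rightarrow> nat word" where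
  "bsec l m = (if m < edge_pt l 0 then [] else [(prod_encode (l, m - edge_pt l 0), False)])"

definition bh :: "nat \<Rightarrow> nat word" where
  "bh s = (case prod_decode s of (l, m) \<Rightarrow>
     winv (br (bp l False (edge_pt l m))) @ (l, False) # br (edge_pt l m))"

lemma bp_inv: "bp l e (bp l (\<not> e) m) = m"
proof (cases l)
  case 0
  consider "m = 0" | "m = 1" | "m = 2" | "m = 3" | "m = 4" | "m = 5" | "6 \<le> m" by linarith
  then show ?thesis using 0 by cases auto
qed auto

interpretation B: side bp bsec br 0 bh
  by standard (rule bp_inv)

lemma replicate_unroll:
  "replicate 1 x = [x]" "replicate 2 x = [x, x]" "replicate 3 x = [x, x, x]"
  "replicate 4 x = [x, x, x, x]" "replicate 5 x = [x, x, x, x, x]"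
  by (simp_all add: eval_nat_numeral)

lemma pw_replicate_b: "m < 3 \<Longrightarrow> B.pw (replicate (2 * m) (0, False)) 0 = m"
proof -
  assume "m < 3"
  then consider "m = 0" | "m = 1" | "m = 2" by linarith
  then show ?thesis by cases (simp_all add: replicate_unroll)
qed

lemma sw_replicate_b: "k \<le> 5 \<Longrightarrow> B.sw (replicate k (0, False)) 0 = []"
proof -
  assume "k \<le> 5"
  then consider "k = 0" | "k = 1" | "k = 2" | "k = 3" | "k = 4" | "k = 5" by linarith
  then show ?thesis
    by cases (simp_all add: replicate_unroll B.sec'_def bsec_def edge_pt_def)
qed

lemma pw_br: "B.pw (br m) 0 = m"
proof -
  consider "m < 3" | "m = 3" | "m = 4" | "m = 5" | "6 \<le> m" by linarith
  then show ?thesis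
  proof cases
    case 5
    then have "m = 6 + 3 * ((m - 6) div 3) + m mod 3"
      by presburger
    then show ?thesis using 5 pw_replicate_b[of "m mod 3"] by (simp add: br_def)
  qed (simp_all add: br_def pw_replicate_b replicate_unroll)
qed

lemma sw_br: "B.sw (br m) 0 = []"
proof (cases "m < 6")
  case True
  then show ?thesis by (auto simp: br_def intro: sw_replicate_b)
next
  case False
  then show ?thesis
    by (simp add: br_def sw_replicate_b pw_replicate_b B.sec'_def bsec_def edge_pt_def)
qed

lemma bp_edge: "m < edge_pt l 0 \<Longrightarrow> br (bp l False m) = (l, False) # br m"
proof (cases l)
  case 0
  assume "m < edge_pt l 0"
  then have "m < 5" using 0 by (simp add: edge_pt_def)
  then consider "m = 0" | "m = 1" | "m = 2" | "m = 3" | "m = 4" by linarith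
  then show ?thesis using 0 by cases (simp_all add: br_def replicate_unroll)
next
  case (Suc n)
  assume "m < edge_pt l 0"
  then have m: "m < 3" using Suc by (simp add: edge_pt_def)
  have "(3 * n + m) div 3 = n" "(6 + 3 * n + m) mod 3 = m"
    using m by presburger+
  then show ?thesis using Suc m by (simp add: br_def)
qed

interpretation B: good_side bp bsec br 0 bh
proof
  show "br 0 = []" by (simp add: br_def)
  show "B.pw (br m) 0 = m" for m by (rule pw_br)
  show "subst bh (bsec l m) \<doteq> winv (br (bp l False m)) @ [(l, False)] @ br m" for l m
  proof (cases "m < edge_pt l 0")
    case True
    then show ?thesis using feq_winv_left[of "br (bp l False m)"]
      by (simp add: bsec_def bp_edge feq.sym)
  next
    case False
    then have "edge_pt l (m - edge_pt l 0) = m" by (auto simp: edge_pt_def split: if_splits)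
    then show ?thesis using False by (simp add: bsec_def bh_def)
  qed
  have tr: "B.pw (winv (br m)) m = 0" for m
    using B.pw_winv(1)[of "br m" 0] by (simp add: pw_br)
  show "B.pw (bh s) 0 = 0" for s
    by (simp add: bh_def pw_br tr split: prod.split)
  have sw_inv: "B.sw (winv (br m)) m \<doteq> []" for m
    using B.sw_feq[OF feq_winv_left[of "br m"], of 0] by (simp add: pw_br sw_br)
  show "B.sw (bh s) 0 \<doteq> [(s, False)]" for s
  proof -
    obtain l m where s: "prod_decode s = (l, m)" by fastforce
    then have "prod_encode (l, m) = s" by (metis prod_decode_inverse)
    moreover have "\<not> edge_pt l m < edge_pt l 0" "edge_pt l m - edge_pt l 0 = m"
      by (simp_all add: edge_pt_def)
    ultimately show ?thesis
      using feq_append_right[OF sw_inv[of "bp l False (edge_pt l m)"], of "[(s, False)]"]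
      by (simp add: bh_def s pw_br sw_br B.sec'_def bsec_def)
  qed
qed

section \<open>The bijection between the two free bases\<close>

section \<open>Positions of the generators\<close>

text \<open>The generators of the stabilizer in the first factor are indexed by integers. Negative
  positions serve the words of the first factor, positions \<open>3i + 1\<close> and \<open>3i + 2\<close> serve the
  \<open>i\<close>-th step of the conjugation of cyclic alternating words, and the others are fillers.\<close>

definition dat :: "nat \<Rightarrow> (nat \<times> nat word) list" where
  "dat r = dec r"

text \<open>An index i = (r, j) names the entry j of the cyclic word coded by r. An entry (\<nu> -
  1, c) stands for the syllable \<open>a\<close> times c times the word \<open>rw \<nu>\<close>,
  where c is a word in the common generators. Indices beyond the end of the list get a harmless
  default, and \<open>nxt\<close> fixes them.\<close>

definition item :: "nat \<Rightarrow> nat \<times> nat word" where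
  "item i = (case prod_decode i of (r, j) \<Rightarrow> case drop j (dat r) of [] \<Rightarrow> (0, []) | x # xs \<Rightarrow> x)"

definition nu :: "nat \<Rightarrow> nat" where
  "nu i = Suc (fst (item i) mod 3)"

definition nxt :: "nat \<Rightarrow> nat" where
  "nxt i = (case prod_decode i of (r, j) \<Rightarrow>
     if Suc j < length (dat r) then prod_encode (r, Suc j)
     else if Suc j = length (dat r) then prod_encode (r, 0) else i)"

definition prv :: "nat \<Rightarrow> nat" where
  "prv i = (case prod_decode i of (r, j) \<Rightarrow>
     if length (dat r) \<le> j then i
     else if j = 0 then prod_encode (r, length (dat r) - 1) else prod_encode (r, j - 1))"

lemma nxt_prv [simp]: "nxt (prv i) = i" and prv_nxt [simp]: "prv (nxt i) = i"
proof -
  obtain r j where i: "i = prod_encode (r, j)" by (metis prod.collapse prod_decode_inverse)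
  show "nxt (prv i) = i" "prv (nxt i) = i"
    by (auto simp: i nxt_def prv_def)
qed

text \<open>Serves to single out the generator number \<open>nu i\<close> of an odd label: after the
  exchange it has index 1, while 0 keeps its place and the other indices from 2 on are numbered
  without gaps.\<close>

definition swp :: "nat \<Rightarrow> nat \<Rightarrow> nat" where
  "swp c m = (if m = 1 then c else if m = c then 1 else m)"

lemma swp_swp [simp]: "swp c (swp c m) = m"
  by (simp add: swp_def)

lemma swp_0: "0 < c \<Longrightarrow> swp c m = 0 \<longleftrightarrow> m = 0"
  by (auto simp: swp_def)

lemma nu_pos [simp]: "0 < nu i" "nu i \<noteq> 0"
  by (simp_all add: nu_def)

definition fil :: "nat \<Rightarrow> nat \<Rightarrow> int" where
  "fil l y = int (3 * prod_encode (l, y) + 3)"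

text \<open>The pair (0, 0) is \<open>b^6\<close> and gets position 0, where the first factor has
  \<open>t\<close>. An even label l from 2 on receives a negative position at (l, 0) and a filler at
  (l, 1); both are conjugates of the same letter, which ties the two positions together. An odd
  label 3 + 2i ties 3i + 2 to 3 \<open>nxt i\<close> + 1 in the same way. The label 1 gets fillers
  only, as its letter occurs in \<open>rw 3\<close>.\<close>

definition pos :: "nat \<Rightarrow> int" where
  "pos s = (case prod_decode s of (l, m) \<Rightarrow>
     if l = 0 then (if m = 0 then 0 else fil 0 (m - 1))
     else if l = 1 then fil 1 m
     else if l mod 2 = 0 then (if m = 0 then - 1 - int ((l - 2) div 2) else fil l (m - 1))
     else let i = (l - 3) div 2; m' = swp (nu i) m in
       if m = 0 then int (3 * i + 2) else if m' = 1 then int (3 * nxt i + 1) else fil l (m' - 2))"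

definition sg :: "int \<Rightarrow> nat" where
  "sg k = (if k < 0 then prod_encode (2 + 2 * nat (- 1 - k), 0)
     else if k = 0 then prod_encode (0, 0)
     else let j = nat (k - 1) div 3; c = nat (k - 1) mod 3 in
       if c = 0 then prod_encode (3 + 2 * prv j, nu (prv j))
       else if c = 1 then prod_encode (3 + 2 * j, 0)
       else case prod_decode j of (l, y) \<Rightarrow>
         if l = 1 then prod_encode (1, y)
         else if l mod 2 = 0 then prod_encode (l, Suc y)
         else prod_encode (l, swp (nu ((l - 3) div 2)) (y + 2)))"

lemma sg_pos [simp]: "sg (pos s) = s"
proof -
  obtain l m where s: "s = prod_encode (l, m)" by (metis prod.collapse prod_decode_inverse)
  have n3: "(3 * j + 2) div 3 = j" "(3 * j + 2) mod 3 = 2" "(3 * j + 1) div 3 = j"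
    "(3 * j + 1) mod 3 = 1" for j :: nat by simp_all presburger+
  have nf: "nat (fil a b - 1) div 3 = prod_encode (a, b)" "nat (fil a b - 1) mod 3 = 2"
    "0 < fil a b" "fil a b < 0 \<longleftrightarrow> False" "fil a b = 0 \<longleftrightarrow> False" for a b
    using n3[of "prod_encode (a, b)"] by (simp_all add: fil_def nat_diff_distrib nat_add_distrib nat_mult_distrib)
  have "l = 0 \<or> l = 1 \<or> (l \<ge> 2 \<and> l mod 2 = 0) \<or> (l \<ge> 3 \<and> l mod 2 = 1)" by presburger
  then consider "l = 0" | "l = 1" | "l \<ge> 2" "l mod 2 = 0" | "l \<ge> 3" "l mod 2 = 1"
    by (elim disjE conjE) simp_all
  then show ?thesis
  proof cases
    case 3
    then have "2 + 2 * ((l - 2) div 2) = l" by presburger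
    then show ?thesis using 3 nf[of l "m - 1"] by (auto simp: s pos_def sg_def Let_def)
  next
    case 4
    define i where "i = (l - 3) div 2"
    have l: "l = 3 + 2 * i" using 4 unfolding i_def by presburger
    have odd: "(3 + 2 * i) mod 2 = 1" by presburger
    define m' where "m' = swp (nu i) m"
    have m: "m = swp (nu i) m'" by (simp add: m'_def)
    consider "m = 0" | "m \<noteq> 0" "m' = 1" | "m \<noteq> 0" "m' \<ge> 2"
      using swp_0[of "nu i" m] by (force simp: m'_def[symmetric])
    then show ?thesis
    proof cases
      case 1
      then show ?thesis
        using n3[of i] by (simp add: s l pos_def sg_def odd nat_add_distrib nat_mult_distrib)
    next
      case 2
      then have "m = nu i" using m by (simp add: swp_def)
      then show ?thesis using 2
        by (simp add: s l pos_def sg_def odd Let_def swp_def nat_mult_distrib)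
    next
      case 3
      then obtain y where y: "m' = Suc (Suc y)" by (metis add_2_eq_Suc le_Suc_ex)
      then have "swp (nu i) (Suc (Suc y)) = m" using m by simp
      then show ?thesis using 3 nf[of l y]
        by (auto simp: s l pos_def sg_def odd Let_def m'_def[symmetric] y)
    qed
  qed (use nf in \<open>auto simp: s pos_def sg_def Let_def\<close>)
qed

lemma pos_sg [simp]: "pos (sg k) = k"
proof -
  consider "k < 0" | "k = 0" | "k > 0" by linarith
  then show ?thesis
  proof cases
    case 3
    define j where "j = nat (k - 1) div 3"
    define c where "c = nat (k - 1) mod 3"
    have k: "k = int (3 * j + c + 1)" using 3 unfolding j_def c_def by simp
    have sgk: "sg k = (if c = 0 then prod_encode (3 + 2 * prv j, nu (prv j))
       else if c = 1 then prod_encode (3 + 2 * j, 0)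
       else case prod_decode j of (l, y) \<Rightarrow>
         if l = 1 then prod_encode (1, y)
         else if l mod 2 = 0 then prod_encode (l, Suc y)
         else prod_encode (l, swp (nu ((l - 3) div 2)) (y + 2)))"
      using 3 by (simp add: sg_def Let_def j_def c_def)
    have "c < 3" by (simp add: c_def)
    then consider "c = 0" | "c = 1" | "c = 2" by linarith
    then show ?thesis
    proof cases
      case 1
      have "(3 + 2 * prv j) mod 2 = 1" by presburger
      then show ?thesis unfolding sgk using 1 k by (simp add: pos_def swp_def Let_def)
    next
      case 2
      have "(3 + 2 * j) mod 2 = 1" by presburger
      then show ?thesis unfolding sgk using 2 k by (simp add: pos_def Let_def)
    next
      case c2: 3
      obtain l y where ly: "prod_decode j = (l, y)" by fastforce
      then have j: "j = prod_encode (l, y)" by (metis prod_decode_inverse)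
      have "l = 1 \<or> l = 0 \<or> (l \<ge> 2 \<and> l mod 2 = 0) \<or> (l \<ge> 3 \<and> l mod 2 = 1)" by presburger
      then consider "l = 1" | "l = 0" | "l \<ge> 2" "l mod 2 = 0" | "l \<ge> 3" "l mod 2 = 1"
    by (elim disjE conjE) simp_all
      then have "pos (sg k) = fil l y"
      proof cases
        case 4
        have "swp (nu i) (Suc (Suc y)) = 0 \<longleftrightarrow> False" for i
          using swp_0[of "nu i" "Suc (Suc y)"] by simp
        then show ?thesis unfolding sgk using 4 c2 by (simp add: ly pos_def Let_def del: neq0_conv not_gr_zero)
      qed (use c2 in \<open>simp_all add: sgk ly pos_def Let_def\<close>)
      then show ?thesis using k c2 j by (simp add: fil_def)
    qed
  qed (auto simp: sg_def pos_def)
qed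

section \<open>The permutation of the first factor\<close>

text \<open>The letter \<open>t\<close> acts on the integers by \<open>tau\<close>, which fixes the nonnegative ones. The
  negative ones contain disjoint rows with centres \<open>ctr m\<close> and radii \<open>m\<close>, and the rows
  \<open>prod_encode (\<beta>, \<rho>)\<close> form the block \<open>\<beta>\<close>. An odd block belongs to a word \<open>f\<close> in the letters
  \<open>a\<close> (written \<open>False\<close>) and \<open>t\<close> (written \<open>True\<close>), applied from left to right; \<open>tau\<close> is chosen
  such that \<open>f\<close> labels a closed path through distinct points of the block. In the even blocks
  \<open>tau\<close> moves a point from distance 1 of a centre to any other distance.\<close>

definition ctr :: "nat \<Rightarrow> int" where
  "ctr m = - int (2 * (m + 1) * (m + 1))"

text \<open>The second alternative makes the search total. It never pre-empts the right answer,
  because a point of row m has absolute value at least m.\<close>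

definition row :: "int \<Rightarrow> nat" where
  "row v = (LEAST m. \<bar>v - ctr m\<bar> \<le> int m \<or> nat \<bar>v\<bar> < m)"

definition blk :: "int \<Rightarrow> nat" where
  "blk v = fst (prod_decode (row v))"

definition pt :: "nat \<Rightarrow> nat \<Rightarrow> int" where
  "pt \<beta> \<rho> = ctr (prod_encode (\<beta>, \<rho>))"

type_synonym edge = "int \<times> int \<times> bool"

text \<open>\<open>i\<close> counts the letters read and \<open>n\<close> is the length of the whole
  word. A \<open>t\<close>-letter jumps to the centre of the fresh row \<open>Suc i\<close>, except
  that a final \<open>t\<close>-letter returns to row 0; the letters \<open>a\<close> wander inside
  the current row. The flag of an edge tells whether \<open>tau\<close> or its inverse has to map
  \<open>u\<close> to \<open>w\<close>.\<close>

primrec path :: "nat \<Rightarrow> nat \<Rightarrow> nat \<Rightarrow> int \<Rightarrow> bool word \<Rightarrow> edge list" where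
  "path \<beta> n i p [] = []"
| "path \<beta> n i p (x # f) = (if fst x
     then let q = pt \<beta> (if Suc i = n then 0 else Suc i) in (p, q, snd x) # path \<beta> n (Suc i) q f
     else path \<beta> n (Suc i) (if snd x then p - 1 else p + 1) f)"

definition edges :: "nat \<Rightarrow> edge list" where
  "edges \<beta> = (if \<beta> mod 2 = 0 then (if \<beta> = 0 then [] else [(pt \<beta> 0 + 1, pt \<beta> 0 + dec (\<beta> div 2), False)])
     else let f = dec (\<beta> div 2) in path \<beta> (length f) 0 (pt \<beta> 0) f)"

text \<open>A product of transpositions in which an unreversed edge acts after the remaining list
  and a reversed edge before it. With this order a run of edges, each starting where the previous
  one ends, becomes a cycle in the prescribed direction.\<close>

fun ev :: "edge list \<Rightarrow> int \<Rightarrow> int" where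
  "ev [] v = v"
| "ev ((u, w, e) # es) v = (if e then ev es (transpose u w v) else transpose u w (ev es v))"

fun evi :: "edge list \<Rightarrow> int \<Rightarrow> int" where
  "evi [] v = v"
| "evi ((u, w, e) # es) v = (if e then transpose u w (evi es v) else evi es (transpose u w v))"

definition tau :: "int \<Rightarrow> int" where
  "tau v = ev (edges (blk v)) v"

definition taui :: "int \<Rightarrow> int" where
  "taui v = evi (edges (blk v)) v"

lemma ev_evi [simp]: "ev es (evi es v) = v" and evi_ev [simp]: "evi es (ev es v) = v"
  by (induction es arbitrary: v) (auto split: prod.splits)

lemma ctr_le: "ctr m \<le> - 2 * int m - 2"
proof -
  have "ctr m = - 2 * int (m * m) - 4 * int m - 2" by (simp add: ctr_def algebra_simps)
  then show ?thesis by linarith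
qed

text \<open>The quadratic centres leave gaps of 4m + 6 between the rows m and m + 1, more than the
  sum 2m + 1 of their radii.\<close>

lemma ctr_mono: "m < m' \<Longrightarrow> ctr m' + int m' < ctr m - int m"
proof -
  assume "m < m'"
  then have "int m + 1 \<le> int m'" by simp
  then have "2 * (int m + 2) * (int m + 2) + 3 * int m' \<le> 2 * (int m' + 1) * (int m' + 1) + 3 * (int m + 1)"
    using mult_mono[of "int m + 1" "int m'" "int m + 1" "int m'"] by (simp add: algebra_simps)
  then show ?thesis by (simp add: ctr_def algebra_simps)
qed

lemma row_ctr: "\<bar>d\<bar> \<le> int m \<Longrightarrow> row (ctr m + d) = m"
  unfolding row_def
proof (rule Least_equality)
  fix m' assume d: "\<bar>d\<bar> \<le> int m" and *: "\<bar>ctr m + d - ctr m'\<bar> \<le> int m' \<or> nat \<bar>ctr m + d\<bar> < m'"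
  have "ctr m \<le> - 2 * int m - 2" by (rule ctr_le)
  then have "m \<le> nat \<bar>ctr m + d\<bar>" using d by linarith
  then show "m \<le> m'" using * d ctr_mono[of m' m] by linarith
qed simp

lemma ctr_neg: "\<bar>d\<bar> \<le> int m \<Longrightarrow> ctr m + d < 0"
proof -
  have "ctr m \<le> - 2 * int m - 2" by (rule ctr_le)
  then show "\<bar>d\<bar> \<le> int m \<Longrightarrow> ctr m + d < 0" by linarith
qed

lemma pt_blk: "\<bar>d\<bar> \<le> int \<beta> \<Longrightarrow> blk (pt \<beta> \<rho> + d) = \<beta>"
  using le_prod_encode_1[of \<beta> \<rho>] by (simp add: blk_def pt_def row_ctr)

lemma pt_neg: "\<bar>d\<bar> \<le> int \<beta> \<Longrightarrow> pt \<beta> \<rho> + d < 0"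
  using le_prod_encode_1[of \<beta> \<rho>] by (simp add: pt_def ctr_neg)

lemma pt_inj: "pt \<beta> \<rho> + d = pt \<beta> \<rho>' + d' \<Longrightarrow> \<bar>d\<bar> \<le> int \<beta> \<Longrightarrow> \<bar>d'\<bar> \<le> int \<beta> \<Longrightarrow> \<rho> = \<rho>' \<and> d = d'"
proof -
  assume "pt \<beta> \<rho> + d = pt \<beta> \<rho>' + d'" "\<bar>d\<bar> \<le> int \<beta>" "\<bar>d'\<bar> \<le> int \<beta>"
  then show ?thesis
    using row_ctr[of d "prod_encode (\<beta>, \<rho>)"] row_ctr[of d' "prod_encode (\<beta>, \<rho>')"]
      le_prod_encode_1[of \<beta> \<rho>] le_prod_encode_1[of \<beta> \<rho>'] by (simp add: pt_def)
qed

lemma path_pts: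
  assumes "(u, w, e) \<in> set (path \<beta> n i (pt \<beta> \<rho> + d) f)" "\<rho> \<le> i" "i + length f = n" "\<bar>d\<bar> \<le> int i"
  shows "(\<exists>\<rho>' d'. u = pt \<beta> \<rho>' + d' \<and> \<bar>d'\<bar> \<le> int n \<and> (i < \<rho>' \<or> \<rho>' = \<rho>)) \<and>
    (\<exists>\<rho>'. w = pt \<beta> \<rho>' \<and> (i < \<rho>' \<or> \<rho>' = 0))"
  using assms
proof (induction f arbitrary: i \<rho> d)
  case (Cons x f)
  show ?case
  proof (cases "fst x")
    case False
    let ?d = "if snd x then d - 1 else d + 1"
    have "(u, w, e) \<in> set (path \<beta> n (Suc i) (pt \<beta> \<rho> + ?d) f)"
      using Cons.prems(1) False by (auto simp: algebra_simps split: if_splits)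
    from Cons.IH[OF this] Cons.prems show ?thesis by (fastforce split: if_splits)
  next
    case True
    let ?r = "if Suc i = n then 0 else Suc i"
    consider "u = pt \<beta> \<rho> + d" "w = pt \<beta> ?r" | "(u, w, e) \<in> set (path \<beta> n (Suc i) (pt \<beta> ?r) f)"
      using Cons.prems(1) True by (auto simp: Let_def)
    then show ?thesis
    proof cases
      case 1
      have "\<bar>d\<bar> \<le> int n" using Cons.prems(3,4) by simp
      with 1 show ?thesis by (intro conjI exI[of _ \<rho>] exI[of _ d] exI[of _ ?r]) auto
    next
      case 2
      then have "Suc i \<noteq> n" using Cons.prems(3) by (cases f) auto
      with Cons.IH[of "Suc i" "Suc i" 0] 2 Cons.prems(3)
      have "(\<exists>\<rho>' d'. u = pt \<beta> \<rho>' + d' \<and> \<bar>d'\<bar> \<le> int n \<and> (Suc i < \<rho>' \<or> \<rho>' = Suc i)) \<and>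
        (\<exists>\<rho>'. w = pt \<beta> \<rho>' \<and> (Suc i < \<rho>' \<or> \<rho>' = 0))" by simp
      then obtain \<rho>' d' \<rho>'' where "u = pt \<beta> \<rho>' + d'" "\<bar>d'\<bar> \<le> int n" "i < \<rho>'"
        "w = pt \<beta> \<rho>''" "i < \<rho>'' \<or> \<rho>'' = 0" by (elim conjE exE disjE) auto
      then show ?thesis by blast
    qed
  qed
qed simp

lemma length_dec_le: "length (dec n :: 'a::coded list) \<le> n"
  using list_encode_length[of "list_decode n"] by (simp add: dec_list_def)

lemma edges_blk:
  assumes "(u, w, e) \<in> set (edges \<beta>)"
  shows "blk u = \<beta>" "blk w = \<beta>" "u < 0" "w < 0"
proof -
  have "\<exists>\<rho> d \<rho>' d'. u = pt \<beta> \<rho> + d \<and> w = pt \<beta> \<rho>' + d' \<and> \<bar>d\<bar> \<le> int \<beta> \<and> \<bar>d'\<bar> \<le> int \<beta>"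
  proof (cases "\<beta> mod 2 = 0")
    case True
    have b: "\<bar>int_decode n\<bar> \<le> int n" for n
      using nat_int_decode[of n] nat_minus_int_decode[of n] by (auto split: if_splits)
    have "\<bar>dec (\<beta> div 2) :: int\<bar> \<le> int \<beta>" using b[of "\<beta> div 2"] by (simp add: dec_int_def)
    then show ?thesis using True assms by (fastforce simp: edges_def split: if_splits)
  next
    case False
    define f :: "bool word" where "f = dec (\<beta> div 2)"
    have "length f \<le> \<beta>" using length_dec_le[of "\<beta> div 2", where 'a = "bool \<times> bool"] by (simp add: f_def)
    moreover have "(u, w, e) \<in> set (path \<beta> (length f) 0 (pt \<beta> 0 + 0) f)"
      using assms False by (simp add: edges_def f_def Let_def)
    from path_pts[OF this] obtain \<rho> d \<rho>' where "u = pt \<beta> \<rho> + d" "\<bar>d\<bar> \<le> int (length f)" "w = pt \<beta> \<rho>'"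
      by auto
    ultimately show ?thesis by (intro exI[of _ \<rho>] exI[of _ d] exI[of _ \<rho>'] exI[of _ 0]) simp
  qed
  then show "blk u = \<beta>" "blk w = \<beta>" "u < 0" "w < 0" using pt_blk pt_neg by auto
qed

lemma ev_blk: "(\<And>u w e. (u, w, e) \<in> set es \<Longrightarrow> blk u = \<beta> \<and> blk w = \<beta>) \<Longrightarrow>
    blk v = \<beta> \<Longrightarrow> blk (ev es v) = \<beta> \<and> blk (evi es v) = \<beta>"
proof (induction es arbitrary: v)
  case (Cons x es)
  obtain u w e where x: "x = (u, w, e)" by (cases x)
  have uw: "blk u = \<beta>" "blk w = \<beta>" and es: "\<And>u w e. (u, w, e) \<in> set es \<Longrightarrow> blk u = \<beta> \<and> blk w = \<beta>"
    using Cons.prems(1) by (auto simp: x)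
  have tr: "blk (transpose u w x) = \<beta>" if "blk x = \<beta>" for x
    using uw that by (auto simp: transpose_def)
  show ?case using Cons.IH[OF es] Cons.prems(2) tr by (cases e) (auto simp: x)
qed simp

lemma tau_taui [simp]: "tau (taui v) = v" "taui (tau v) = v"
proof -
  have "blk (ev (edges (blk v)) v) = blk v" "blk (evi (edges (blk v)) v) = blk v"
    using ev_blk[of "edges (blk v)" "blk v" v] edges_blk by blast+
  then show "tau (taui v) = v" "taui (tau v) = v" by (simp_all add: tau_def taui_def)
qed

lemma ev_fix: "(\<And>u w e. (u, w, e) \<in> set es \<Longrightarrow> v \<noteq> u \<and> v \<noteq> w) \<Longrightarrow> ev es v = v"
proof (induction es)
  case (Cons x es)
  obtain u w e where x: "x = (u, w, e)" by (cases x)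
  have "v \<noteq> u" "v \<noteq> w" and es: "\<And>u w e. (u, w, e) \<in> set es \<Longrightarrow> v \<noteq> u \<and> v \<noteq> w"
    using Cons.prems by (auto simp: x)
  then show ?case using Cons.IH[OF es] by (auto simp: x)
qed simp

lemma tau_nonneg [simp]: "0 \<le> v \<Longrightarrow> tau v = v"
  unfolding tau_def by (rule ev_fix) (use edges_blk(3,4) in force)

subsection \<open>Transitivity\<close>

text \<open>\<open>tk z\<close> sends m to \<open>tau (m + z) - tau z\<close>, so such a
  \<open>z\<close> gives an element of the stabilizer of 0 that moves 1 to \<open>n\<close>. The
  even block ensures that this generator is not modified by \<open>cE\<close>; the size bound later
  guarantees that the fillers involved fix \<open>n\<close>.\<close>

lemma tau_row:
  assumes "n \<noteq> 0" "n \<noteq> 1"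
  obtains z where "tau z = z" "tau (z + 1) = z + n" "z < 0" "blk z mod 2 = 0" "\<bar>n\<bar> \<le> - z"
proof -
  define \<beta> where "\<beta> = 2 * int_encode n"
  have "int_encode n \<noteq> 0" using assms(1) by (metis int_encode_eq int_encode_nonneg mult_0_right of_nat_0)
  then have \<beta>: "\<beta> \<noteq> 0" "\<beta> mod 2 = 0" "\<beta> div 2 = int_encode n" "1 \<le> \<beta>" by (simp_all add: \<beta>_def)
  have e: "edges \<beta> = [(pt \<beta> 0 + 1, pt \<beta> 0 + n, False)]"
    using \<beta> by (simp add: edges_def dec_int_def)
  have "blk (pt \<beta> 0 + 0) = \<beta>" "blk (pt \<beta> 0 + 1) = \<beta>" using \<beta>(4) by (intro pt_blk; simp)+
  then have "tau (pt \<beta> 0) = pt \<beta> 0" "tau (pt \<beta> 0 + 1) = pt \<beta> 0 + n"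
    using assms by (simp_all add: tau_def e transpose_def)
  moreover have "\<bar>n\<bar> \<le> int (int_encode n)"
    using nat_int_decode[of "int_encode n"] nat_minus_int_decode[of "int_encode n"] by (auto split: if_splits)
  then have "\<bar>n\<bar> \<le> - pt \<beta> 0"
    using ctr_le[of "prod_encode (\<beta>, 0)"] le_prod_encode_1[of \<beta> 0] by (simp add: pt_def \<beta>_def)
  moreover have "pt \<beta> 0 < 0" using pt_neg[of 0 \<beta> 0] by simp
  moreover have "blk (pt \<beta> 0) = \<beta>" using pt_blk[of 0 \<beta> 0] by simp
  ultimately show ?thesis using that \<beta>(2) by simp
qed

subsection \<open>Closed paths\<close>

definition compat :: "edge \<Rightarrow> edge \<Rightarrow> bool" where
  "compat x y \<longleftrightarrow> (case (x, y) of ((u, w, e), (u', w', e')) \<Rightarrow>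
     u \<noteq> u' \<and> w \<noteq> w' \<and> u \<noteq> w' \<and> (w = u' \<longrightarrow> e = e'))"

text \<open>The tail of the list realizes its own edges, and the source of the head edge is fixed by
  the tail. The transposition of the head touches a later edge only if that edge starts at the
  target of the head. The two then have the same direction, and the head acts on the side where it
  leaves the later edge intact.\<close>

lemma ev_compat:
  assumes "sorted_wrt compat es" "(u, w, e) \<in> set es" "\<forall>(u, w, e)\<in>set es. u \<noteq> w"
  shows "if e then ev es w = u else ev es u = w"
  using assms
proof (induction es)
  case (Cons x es)
  obtain u0 w0 e0 where x: "x = (u0, w0, e0)" by (cases x)
  have c: "u0 \<noteq> u'" "w0 \<noteq> w'" "u0 \<noteq> w'" "w0 = u' \<Longrightarrow> e0 = e'" if "(u', w', e') \<in> set es" for u' w' e'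
    using Cons.prems(1) that by (force simp: x compat_def)+
  have fix0: "ev es u0 = u0" by (rule ev_fix) (use c in blast)
  show ?case
  proof (cases "(u, w, e) \<in> set es")
    case True
    then have IH: "if e then ev es w = u else ev es u = w"
      using Cons by (auto simp: x)
    show ?thesis
      using IH c[OF True] by (cases e; cases e0) (auto simp: x transpose_def)
  next
    case False
    then have eq: "u = u0" "w = w0" "e = e0" using Cons.prems(2) by (auto simp: x)
    show ?thesis using fix0 by (auto simp: x eq transpose_def)
  qed
qed simp


context
  fixes \<beta> n :: nat
  assumes n: "n \<le> \<beta>"
begin

text \<open>In a reduced word consecutive letters \<open>a\<close> have the same sign, so the offset
  from the centre grows in absolute value. The centre can thus be the source of an edge only if the
  path has not yet moved away from it.\<close>

lemma path_start:
  assumes "(pt \<beta> \<rho>, w, e) \<in> set (path \<beta> n i (pt \<beta> \<rho> + d) f)" "\<rho> \<le> i" "i + length f = n" "\<bar>d\<bar> \<le> int i"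
    "reduced f" "d \<noteq> 0 \<Longrightarrow> f \<noteq> [] \<Longrightarrow> \<not> fst (hd f) \<Longrightarrow> snd (hd f) \<longleftrightarrow> d < 0"
  shows "d = 0 \<and> hd f = (True, e)"
  using assms
proof (induction f arbitrary: i d)
  case (Cons x f)
  have red: "reduced f" "f \<noteq> [] \<Longrightarrow> fst (hd f) = fst x \<Longrightarrow> snd (hd f) = snd x"
    using Cons.prems(5) by (auto simp: reduced_def successively_Cons)
  show ?case
  proof (cases "fst x")
    case False
    let ?d = "if snd x then d - 1 else d + 1"
    have "?d \<noteq> 0" "?d < 0 \<longleftrightarrow> snd x" using Cons.prems(6) False by (cases "d = 0"; auto)+
    moreover have "(pt \<beta> \<rho>, w, e) \<in> set (path \<beta> n (Suc i) (pt \<beta> \<rho> + ?d) f)"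
      using Cons.prems(1) False by (auto simp: algebra_simps split: if_splits)
    ultimately show ?thesis using Cons.IH[of "Suc i" ?d] Cons.prems(2-4) red False
      by (auto split: if_splits)
  next
    case True
    let ?r = "if Suc i = n then 0 else Suc i"
    consider "pt \<beta> \<rho> = pt \<beta> \<rho> + d" "snd x = e" | "(pt \<beta> \<rho>, w, e) \<in> set (path \<beta> n (Suc i) (pt \<beta> ?r) f)"
      using Cons.prems(1) True by (auto simp: Let_def)
    then show ?thesis
    proof cases
      case 1
      then show ?thesis using True by (cases x) simp
    next
      case 2
      then have ne: "Suc i \<noteq> n" using Cons.prems(3) by (cases f) auto
      then have "(pt \<beta> \<rho>, w, e) \<in> set (path \<beta> n (Suc i) (pt \<beta> (Suc i) + 0) f)"
        using 2 by simp
      note path_pts[OF this]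
      moreover have "Suc i + length f = n" using Cons.prems(3) by simp
      ultimately obtain \<rho>' d' where "pt \<beta> \<rho> = pt \<beta> \<rho>' + d'" "\<bar>d'\<bar> \<le> int n"
        "Suc i < \<rho>' \<or> \<rho>' = Suc i" by auto
      then show ?thesis using pt_inj[of \<beta> \<rho> 0 \<rho>' d'] n Cons.prems(2) by simp
    qed
  qed
qed simp

text \<open>Every \<open>t\<close>-letter enters a new row, so only the closing edge needs care: its
  target is the centre of row 0. The last hypothesis, satisfied by words that start with a letter
  \<open>a\<close>, keeps this centre from being a source.\<close>

lemma path_compat:
  assumes "\<rho> \<le> i" "i + length f = n" "\<bar>d\<bar> \<le> int i" "reduced f"
    "d \<noteq> 0 \<Longrightarrow> f \<noteq> [] \<Longrightarrow> \<not> fst (hd f) \<Longrightarrow> snd (hd f) \<longleftrightarrow> d < 0"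
    "\<rho> = 0 \<Longrightarrow> d = 0 \<Longrightarrow> f \<noteq> [] \<Longrightarrow> \<not> fst (hd f)"
  shows "sorted_wrt compat (path \<beta> n i (pt \<beta> \<rho> + d) f) \<and>
    (\<forall>(u, w, e)\<in>set (path \<beta> n i (pt \<beta> \<rho> + d) f). u \<noteq> w)"
  using assms
proof (induction f arbitrary: i d \<rho>)
  case (Cons x f)
  have red: "reduced f" "f \<noteq> [] \<Longrightarrow> fst (hd f) = fst x \<Longrightarrow> snd (hd f) = snd x"
    using Cons.prems(4) by (auto simp: reduced_def successively_Cons)
  show ?case
  proof (cases "fst x")
    case False
    let ?d = "if snd x then d - 1 else d + 1"
    have "?d \<noteq> 0" "?d < 0 \<longleftrightarrow> snd x" using Cons.prems(5) False by (cases "d = 0"; auto)+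
    moreover have "path \<beta> n i (pt \<beta> \<rho> + d) (x # f) = path \<beta> n (Suc i) (pt \<beta> \<rho> + ?d) f"
      using False by (auto simp: algebra_simps)
    ultimately show ?thesis using Cons.IH[of \<rho> "Suc i" ?d] Cons.prems(1-3) red False
      by (auto split: if_splits)
  next
    case True
    let ?r = "if Suc i = n then 0 else Suc i"
    let ?es = "path \<beta> n (Suc i) (pt \<beta> ?r) f"
    have d: "\<bar>d\<bar> \<le> int \<beta>" using Cons.prems(2,3) n by simp
    have d0: "\<not> (\<rho> = 0 \<and> d = 0)" using Cons.prems(6) True by auto
    have "pt \<beta> \<rho> + d \<noteq> pt \<beta> ?r + 0"
      using pt_inj[of \<beta> \<rho> d ?r 0] d d0 Cons.prems(1) by (auto split: if_splits)
    moreover have IH: "sorted_wrt compat ?es \<and> (\<forall>(u, w, e)\<in>set ?es. u \<noteq> w)"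
    proof (cases f)
      case (Cons y f')
      then show ?thesis using Cons.IH[of "Suc i" "Suc i" 0] Cons.prems(2) red by simp
    qed simp
    moreover have "compat (pt \<beta> \<rho> + d, pt \<beta> ?r, snd x) (u, w, e)" if uwe: "(u, w, e) \<in> set ?es" for u w e
    proof -
      have ne: "Suc i \<noteq> n" using Cons.prems(2) uwe by (cases f) auto
      then have m: "(u, w, e) \<in> set (path \<beta> n (Suc i) (pt \<beta> (Suc i) + 0) f)" using uwe by simp
      note path_pts[OF m]
      moreover have "Suc i + length f = n" using Cons.prems(2) by simp
      ultimately obtain \<rho>' d' \<rho>''
        where u: "u = pt \<beta> \<rho>' + d'" "\<bar>d'\<bar> \<le> int n" "Suc i < \<rho>' \<or> \<rho>' = Suc i"
          and w: "w = pt \<beta> \<rho>''" "Suc i < \<rho>'' \<or> \<rho>'' = 0"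
        by auto
      have "pt \<beta> \<rho> + d \<noteq> u"
        using pt_inj[of \<beta> \<rho> d \<rho>' d'] u n d Cons.prems(1) by auto
      moreover have "pt \<beta> (Suc i) \<noteq> w" using pt_inj[of \<beta> "Suc i" 0 \<rho>'' 0] w by auto
      moreover have "pt \<beta> \<rho> + d \<noteq> w"
        using pt_inj[of \<beta> \<rho> d \<rho>'' 0] w d d0 Cons.prems(1) by auto
      moreover have "snd x = e" if "pt \<beta> (Suc i) = u"
      proof -
        have "(pt \<beta> (Suc i), w, e) \<in> set (path \<beta> n (Suc i) (pt \<beta> (Suc i) + 0) f)"
          using m that by simp
        from path_start[OF this] red Cons.prems(2) have "hd f = (True, e)" "f \<noteq> []"
          using uwe by auto
        then show ?thesis using red(2) True by simp
      qed
      ultimately show ?thesis using ne by (simp add: compat_def)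
    qed
    ultimately show ?thesis using True by (fastforce simp: Let_def)
  qed
qed simp

end

text \<open>The initial letter \<open>a\<close> lets the path close without a collision. The final
  \<open>t\<close>, not its inverse, makes the closing edge unreversed; the generator at its source
  is the one that survives.\<close>

definition adm :: "bool word \<Rightarrow> bool" where
  "adm f \<longleftrightarrow> f \<noteq> [] \<and> \<not> fst (hd f) \<and> last f = (True, False) \<and> reduced f"

lemma edges_adm:
  assumes "\<beta> mod 2 = 1" "adm (dec (\<beta> div 2))"
  shows "sorted_wrt compat (edges \<beta>)" "\<forall>(u, w, e)\<in>set (edges \<beta>). u \<noteq> w"
    "(u, w, e) \<in> set (edges \<beta>) \<Longrightarrow> if e then tau w = u else tau u = w"
proof -
  define f :: "bool word" where "f = dec (\<beta> div 2)"
  have l: "length f \<le> \<beta>" using length_dec_le[of "\<beta> div 2", where 'a = "bool \<times> bool"] by (simp add: f_def)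
  have e: "edges \<beta> = path \<beta> (length f) 0 (pt \<beta> 0 + 0) f" using assms(1) by (simp add: edges_def f_def Let_def)
  show c: "sorted_wrt compat (edges \<beta>)" "\<forall>(u, w, e)\<in>set (edges \<beta>). u \<noteq> w"
    unfolding e using path_compat[OF l, of 0 0 f 0] assms(2) by (auto simp: adm_def f_def)
  assume m: "(u, w, e) \<in> set (edges \<beta>)"
  have "blk u = \<beta>" "blk w = \<beta>" using edges_blk m by blast+
  then show "if e then tau w = u else tau u = w"
    using ev_compat[OF c(1) m c(2)] by (simp add: tau_def)
qed

section \<open>The first factor\<close>

definition apow :: "int \<Rightarrow> bool word" where
  "apow n = replicate (nat \<bar>n\<bar>) (False, n < 0)"

definition tk :: "int \<Rightarrow> bool word" where
  "tk k = winv (apow (tau k)) @ (True, False) # apow k"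

text \<open>The generator \<open>s\<close> of the common subgroup is \<open>tk (pos s)\<close> times a word \<open>cw s\<close> in other
  generators of smaller rank. For a word \<open>f\<close> encoded in an odd block, \<open>cE\<close> undoes the closed path
  except for its last edge, so that \<open>f\<close> is conjugate to the generator at the last edge.\<close>

definition cE :: "int \<Rightarrow> nat word" where
  "cE v = (let \<beta> = blk v; es = edges \<beta> in
     if \<beta> mod 2 = 1 \<and> adm (dec (\<beta> div 2)) \<and> v = fst (last es)
     then rev (map (\<lambda>(u, w, e). (sg (if e then w else u), e)) (butlast es)) else [])"

definition cw :: "nat \<Rightarrow> nat word" where
  "cw s = (case prod_decode s of (l, m) \<Rightarrow>
     if m \<noteq> 0 \<or> l < 2 then []
     else if l mod 2 = 0 then cE (- 1 - int ((l - 2) div 2)) else snd (item ((l - 3) div 2)))"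

definition rk :: "nat \<Rightarrow> nat" where
  "rk s = (case prod_decode s of (l, m) \<Rightarrow>
     if m \<noteq> 0 \<or> l < 2 then 0
     else if l mod 2 = 0 then (if cE (- 1 - int ((l - 2) div 2)) = [] then 0 else 1)
     else 2 + (l - 3) div 2)"

lemma cE_last: "cE v \<noteq> [] \<Longrightarrow> v = fst (last (edges (blk v)))"
  by (simp add: cE_def Let_def split: if_splits)

lemma sg_neg: "v < 0 \<Longrightarrow> sg v = prod_encode (2 + 2 * nat (- 1 - v), 0)"
  by (simp add: sg_def)

lemma cw_rk_sg_neg: "v < 0 \<Longrightarrow> cw (sg v) = cE v \<and> rk (sg v) = (if cE v = [] then 0 else 1)"
proof -
  assume v: "v < 0"
  have "(2 + 2 * nat (- 1 - v)) mod 2 = 0" by presburger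
  then show ?thesis using v by (simp add: sg_neg cw_def rk_def)
qed

lemma path_last:
  "f \<noteq> [] \<Longrightarrow> last f = (True, e) \<Longrightarrow> i + length f = n \<Longrightarrow>
    path \<beta> n i p f \<noteq> [] \<and> snd (last (path \<beta> n i p f)) = (pt \<beta> 0, e)"
proof (induction f arbitrary: i p)
  case (Cons x f)
  then show ?case by (cases "f = []") (auto simp: Let_def)
qed simp

lemma edges_last:
  assumes "\<beta> mod 2 = 1" "adm (dec (\<beta> div 2))"
  shows "edges \<beta> \<noteq> []" "snd (last (edges \<beta>)) = (pt \<beta> 0, False)"
  using path_last[of "dec (\<beta> div 2)" False 0 "length (dec (\<beta> div 2) :: bool word)" \<beta> "pt \<beta> 0"] assms
  by (auto simp: edges_def Let_def adm_def)

lemma dec_list_elem: "y \<in> set (dec n :: 'a::coded list) \<Longrightarrow> \<exists>k<n. y = dec k"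
  using list_encode_elem[of _ "list_decode n"] by (auto simp: dec_list_def)

text \<open>Codes dominate the codes of their components: \<open>s\<close> occurs in a word in a
  list with code r, and r is at most the code i of the pair (r, j).\<close>

lemma item_small:
  assumes "(s, e) \<in> set (snd (item i))"
  shows "s < i"
proof -
  obtain r j where i: "prod_decode i = (r, j)" by fastforce
  then have ri: "r \<le> i" using le_prod_encode_1[of r j] by (metis prod_decode_inverse)
  obtain x xs where d: "drop j (dat r) = x # xs" and x: "(s, e) \<in> set (snd x)"
    using assms by (auto simp: item_def i split: list.splits)
  have "x \<in> set (dat r)" using set_drop_subset[of j "dat r"] d by auto
  then obtain k where k: "k < r" "x = dec k" unfolding dat_def using dec_list_elem by blast
  obtain m c where mc: "prod_decode k = (m, c)" by fastforce
  then have "c \<le> k" using le_prod_encode_2[of c m] by (metis prod_decode_inverse)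
  have "(s, e) \<in> set (dec c)" using x k mc by (simp add: dec_prod_def)
  then obtain k' where k': "k' < c" "(s, e) = dec k'" using dec_list_elem by blast
  obtain s' e' where se: "prod_decode k' = (s', e')" by fastforce
  then have "s' \<le> k'" using le_prod_encode_1[of s' e'] by (metis prod_decode_inverse)
  moreover have "s = s'" using k' se by (simp add: dec_prod_def dec_nat_def)
  ultimately show ?thesis using \<open>c \<le> k\<close> k k' ri by simp
qed

text \<open>Inside the block, \<open>cE\<close> is nontrivial at most at the source of the last
  edge. An earlier unreversed edge has a different source by \<open>compat\<close>. An earlier
  reversed edge contributes its target, which could meet that source only if both edges had the same
  direction, while the last edge is unreversed.\<close>

lemma cE_not_last:
  assumes "(u, w, e) \<in> set (butlast (edges \<beta>))" "\<beta> mod 2 = 1" "adm (dec (\<beta> div 2))"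
  shows "cE (if e then w else u) = []"
proof (rule ccontr)
  let ?v = "if e then w else u"
  assume "\<not> ?thesis"
  then have v: "?v = fst (last (edges (blk ?v)))" by (rule cE_last)
  have m: "(u, w, e) \<in> set (edges \<beta>)" using assms(1) by (rule in_set_butlastD)
  then have "blk ?v = \<beta>" using edges_blk by auto
  with v have v: "?v = fst (last (edges \<beta>))" by simp
  note el = edges_last[OF assms(2,3)]
  have "sorted_wrt compat (butlast (edges \<beta>) @ [last (edges \<beta>)])"
    using edges_adm(1)[OF assms(2,3)] el by simp
  then have "compat (u, w, e) (last (edges \<beta>))"
    using assms(1) unfolding sorted_wrt_append by auto
  then show False using el(2) v by (cases "last (edges \<beta>)") (auto simp: compat_def split: if_splits)
qed

text \<open>There are three levels: unmodified generators of rank 0, closing edges of rank 1 whose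
  correction uses rank 0 only, and ranks \<open>2 + i\<close> for entries of cyclic words. In the
  last case a letter \<open>s'\<close> of the correction is smaller than \<open>i\<close>, and the
  label in its code is no larger than \<open>s'\<close>.\<close>

lemma rk_cw: "(s', e) \<in> set (cw s) \<Longrightarrow> rk s' < rk s"
proof -
  assume *: "(s', e) \<in> set (cw s)"
  obtain l m where s: "prod_decode s = (l, m)" by fastforce
  then have lm: "m = 0" "2 \<le> l" using * by (auto simp: cw_def split: if_splits)
  show ?thesis
  proof (cases "l mod 2 = 0")
    case True
    define v where "v = - 1 - int ((l - 2) div 2)"
    have c: "cw s = cE v" "rk s = (if cE v = [] then 0 else 1)"
      using lm True by (simp_all add: cw_def rk_def s v_def)
    have "blk v mod 2 = 1" "adm (dec (blk v div 2))"
      "(s', e) \<in> set (map (\<lambda>(u, w, e). (sg (if e then w else u), e)) (butlast (edges (blk v))))"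
      using * unfolding c cE_def Let_def by (auto split: if_splits)
    then obtain u w where uw: "(u, w, e) \<in> set (butlast (edges (blk v)))" and s': "s' = sg (if e then w else u)"
      by auto
    have "cE (if e then w else u) = []" by (rule cE_not_last) fact+
    moreover have "(if e then w else u) < 0" using in_set_butlastD[OF uw] edges_blk by auto
    ultimately have "rk s' = 0" using cw_rk_sg_neg s' by auto
    then show ?thesis using c * by auto
  next
    case False
    define i where "i = (l - 3) div 2"
    have c: "cw s = snd (item i)" "rk s = 2 + i"
      using lm False by (simp_all add: cw_def rk_def s i_def)
    have "s' < i" using item_small * c by auto
    obtain l' m' where s': "prod_decode s' = (l', m')" by fastforce
    then have "l' \<le> s'" using le_prod_encode_1[of l' m'] by (metis prod_decode_inverse)
    then have "rk s' < 2 + i" using \<open>s' < i\<close> unfolding rk_def s' by (auto; presburger)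
    then show ?thesis using c by simp
  qed
qed

text \<open>Restricts the recursive calls inside \<open>subst\<close> to letters that occur in the
  word, so that \<open>rk\<close> can justify the termination of \<open>ah\<close>.\<close>

lemma subst_cong [fundef_cong]:
  "u = v \<Longrightarrow> (\<And>g e. (g, e) \<in> set v \<Longrightarrow> h g = h' g) \<Longrightarrow> subst h u = subst h' v"
  unfolding subst_def by (rule arg_cong[of _ _ concat]) auto

function ah :: "nat \<Rightarrow> bool word" where
  "ah s = tk (pos s) @ subst ah (cw s)"
  by auto
termination by (relation "measure rk") (simp_all add: rk_cw)

declare ah.simps [simp del]

fun ap :: "bool \<Rightarrow> bool \<Rightarrow> int \<Rightarrow> int" where
  "ap False e n = (if e then n - 1 else n + 1)"
| "ap True e n = (if e then taui n else tau n)"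

text \<open>The equation defining \<open>ah (sg k)\<close>, solved for \<open>tk k\<close>: the word
  in the common generators that represents \<open>tk k\<close>.\<close>

definition sigma :: "int \<Rightarrow> nat word" where
  "sigma k = (sg k, False) # winv (cw (sg k))"

definition asec :: "bool \<Rightarrow> int \<Rightarrow> nat word" where
  "asec g k = (if g then sigma k else [])"

lemma asec_simps [simp]: "asec False k = []" "asec True k = sigma k"
  by (simp_all add: asec_def)

interpretation A: side ap asec apow 0 ah
proof
  show "ap g e (ap g (\<not> e) n) = n" for g e n by (cases g) auto
qed

lemma apow_0 [simp]: "apow 0 = []" by (simp add: apow_def)

lemma apow_Suc: "apow (1 + n) \<doteq> (False, False) # apow n"
proof (cases "0 \<le> n")
  case True
  then have "nat \<bar>1 + n\<bar> = Suc (nat \<bar>n\<bar>)" by linarith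
  then show ?thesis using True by (simp add: apow_def)
next
  case False
  then have "nat \<bar>n\<bar> = Suc (nat \<bar>1 + n\<bar>)" by linarith
  then have e: "apow n = (False, True) # apow (1 + n)" using False by (cases "n = - 1") (auto simp: apow_def)
  show ?thesis unfolding e using feq.cancel[of "[]" False False "apow (1 + n)"] by (simp add: feq.sym)
qed

lemma pw_apow: "A.pw (apow n) k = n + k" and sw_apow: "A.sw (apow n) k = []"
proof -
  have "A.pw (replicate j (False, e)) k = (if e then k - int j else k + int j) \<and>
    A.sw (replicate j (False, e)) k = []" for j e
    by (induction j) (auto simp: A.sec'_def)
  then show "A.pw (apow n) k = n + k" "A.sw (apow n) k = []" unfolding apow_def by auto
qed

lemma pw_winv_apow: "A.pw (winv (apow n)) k = k - n" and sw_winv_apow: "A.sw (winv (apow n)) k = []"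
proof -
  have "winv (apow n) = apow (- n)" by (cases "n = 0") (auto simp: apow_def winv_def)
  then show "A.pw (winv (apow n)) k = k - n" "A.sw (winv (apow n)) k = []"
    by (simp_all add: pw_apow sw_apow)
qed

lemma ah_good: "A.pw (ah s) 0 = 0 \<and> A.sw (ah s) 0 \<doteq> [(s, False)]"
proof (induction s rule: ah.induct)
  case (1 s)
  have *: "A.pw (subst ah (cw s)) 0 = 0" "A.sw (subst ah (cw s)) 0 \<doteq> cw s"
    using A.sw_subst_on[of "cw s"] 1 by blast+
  have t: "A.pw (tk k) 0 = 0" "A.sw (tk k) 0 = sigma k" for k
    by (simp_all add: tk_def pw_apow sw_apow pw_winv_apow sw_winv_apow A.sec'_def)
  have "A.sw (ah s) 0 \<doteq> sigma (pos s) @ cw s"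
    unfolding ah.simps[of s] using * by (simp add: t feq_append)
  also have "\<dots> \<doteq> [(s, False)]"
    using feq_cancel_mid(2)[of "[(s, False)]" "cw s" "[]"] by (simp add: sigma_def)
  finally show ?case using * t by (simp add: ah.simps[of s])
qed

interpretation A: good_side ap asec apow 0 ah
proof
  show "apow 0 = []" "A.pw (apow n) 0 = n" for n by (simp_all add: pw_apow)
  show "subst ah (asec g n) \<doteq> winv (apow (ap g False n)) @ [(g, False)] @ apow n" for g n
  proof (cases g)
    case True
    have "subst ah (sigma n) \<doteq> tk n"
      using feq_cancel_mid(1)[of "tk n" "subst ah (cw (sg n))" "[]"]
      by (simp add: sigma_def ah.simps[of "sg n"])
    then show ?thesis using True by (simp add: tk_def)
  next
    case False
    have "[] \<doteq> winv (apow (1 + n)) @ apow (1 + n)" by (rule feq.sym) simp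
    also have "\<dots> \<doteq> winv (apow (1 + n)) @ (False, False) # apow n"
      by (intro feq_append feq.refl apow_Suc)
    finally show ?thesis using False by (simp add: add.commute)
  qed
  show "A.pw (ah s) 0 = 0" "A.sw (ah s) 0 \<doteq> [(s, False)]" for s using ah_good by blast+
qed

section \<open>The amalgam by generators and relations\<close>

section \<open>The group\<close>

text \<open>The letter \<open>0\<close> is \<open>a\<close>, the letter \<open>Suc l\<close> is the letter \<open>l\<close> of the second factor, and
  \<open>t\<close> stands for \<open>b^6\<close>.\<close>

definition eA :: "bool word \<Rightarrow> nat word" where
  "eA = subst (\<lambda>g. if g then replicate 6 (1, False) else [(0, False)])"

definition eB :: "nat word \<Rightarrow> nat word" where
  "eB = subst (\<lambda>l. [(Suc l, False)])"

text \<open>Relating \<open>tk k\<close> to \<open>sigma k\<close> forces \<open>ah s\<close> and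
  \<open>bh s\<close> to agree, by induction on the rank. In this form the relators do not involve
  the recursive \<open>ah\<close>, which makes it plain that they are computable.\<close>

inductive geq :: "nat word \<Rightarrow> nat word \<Rightarrow> bool" (infix \<open>\<approx>\<close> 50) where
  feq: "u \<doteq> v \<Longrightarrow> u \<approx> v"
| rel: "u @ eA (tk k) @ v \<approx> u @ eB (subst bh (sigma k)) @ v"
| sym: "u \<approx> v \<Longrightarrow> v \<approx> u"
| trans: "u \<approx> v \<Longrightarrow> v \<approx> w \<Longrightarrow> u \<approx> w"

lemmas [trans] = geq.trans

lemma geq_append_left: "u \<approx> v \<Longrightarrow> w @ u \<approx> w @ v"
proof (induction rule: geq.induct)
  case (rel u k v)
  show ?case using geq.rel[of "w @ u" k v] by simp
qed (auto intro: geq.intros feq_append)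

lemma geq_append_right: "u \<approx> v \<Longrightarrow> u @ w \<approx> v @ w"
proof (induction rule: geq.induct)
  case (rel u k v)
  show ?case using geq.rel[of u k "v @ w"] by simp
qed (auto intro: geq.intros feq_append)

lemma geq_append: "u \<approx> u' \<Longrightarrow> v \<approx> v' \<Longrightarrow> u @ v \<approx> u' @ v'"
  by (meson geq.trans geq_append_left geq_append_right)

lemma geq_winv: "u \<approx> v \<Longrightarrow> winv u \<approx> winv v"
proof -
  assume uv: "u \<approx> v"
  have "winv u \<approx> winv u @ v @ winv v"
    using feq_cancel_mid(1)[of "winv u" v "[]"] by (simp add: geq.feq feq.sym)
  also have "\<dots> \<approx> winv u @ u @ winv v"
    by (intro geq_append_left geq_append_right geq.sym[OF uv])
  also have "\<dots> \<approx> winv v"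
    using feq_cancel_mid(2)[of "[]" u "winv v"] by (simp add: geq.feq)
  finally show ?thesis .
qed

quotient_type grp = "nat word" / geq
  by (intro equivpI reflpI sympI transpI) (auto intro: geq.intros)

instantiation grp :: group_add
begin
lift_definition zero_grp :: grp is "[]" .
lift_definition plus_grp :: "grp \<Rightarrow> grp \<Rightarrow> grp" is "(@)" by (rule geq_append)
lift_definition uminus_grp :: "grp \<Rightarrow> grp" is winv by (rule geq_winv)
definition minus_grp :: "grp \<Rightarrow> grp \<Rightarrow> grp" where "minus_grp g h = g + - h"
instance
proof
  show "(x + y) + z = x + (y + z)" for x y z :: grp by transfer (simp add: geq.feq)
  show "0 + x = x" "x + 0 = x" "- x + x = 0" for x :: grp by (transfer, simp add: geq.feq)+
  show "x + - y = x - y" for x y :: grp by (simp add: minus_grp_def)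
qed
end

lift_definition cls :: "nat word \<Rightarrow> grp" is "\<lambda>w. w" .

lemma cls_eq: "cls u = cls v \<longleftrightarrow> u \<approx> v" by transfer simp

lemma cls_surj: obtains w where "g = cls w"
  by transfer (auto intro: geq.feq)

lemma cls_simps [simp]: "cls [] = 0" "cls (u @ v) = cls u + cls v" "cls (winv u) = - cls u"
  by (transfer, simp add: geq.feq)+

lemma cls_feq: "u \<doteq> v \<Longrightarrow> cls u = cls v"
  by (simp add: cls_eq geq.feq)

definition gA :: "bool word \<Rightarrow> grp" where "gA w = cls (eA w)"
definition gB :: "nat word \<Rightarrow> grp" where "gB w = cls (eB w)"
definition gC :: "nat word \<Rightarrow> grp" where "gC w = gB (subst bh w)"

lemma gA_simps [simp]: "gA [] = 0" "gA (u @ v) = gA u + gA v" "gA (winv u) = - gA u"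
  and gB_simps [simp]: "gB [] = 0" "gB (u' @ v') = gB u' + gB v'" "gB (winv u') = - gB u'"
  and gC_simps [simp]: "gC [] = 0" "gC (u' @ v') = gC u' + gC v'" "gC (winv u') = - gC u'"
  by (simp_all add: gA_def gB_def gC_def eA_def eB_def)

lemma gA_feq: "u \<doteq> v \<Longrightarrow> gA u = gA v"
  and gB_feq: "u' \<doteq> v' \<Longrightarrow> gB u' = gB v'"
  and gC_feq: "u' \<doteq> v' \<Longrightarrow> gC u' = gC v'"
  by (simp_all add: gA_def gB_def gC_def eA_def eB_def cls_feq feq_subst)

lemma gA_Cons: "gA (x # w) = gA [x] + gA w"
  and gB_Cons: "gB (y # w') = gB [y] + gB w'"
  and gC_Cons: "gC (y # w') = gC [y] + gC w'"
  using gA_simps(2)[of "[x]" w] gB_simps(2)[of "[y]" w'] gC_simps(2)[of "[y]" w'] by simp_all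

lemma gX_inv: "gA [(l, True)] = - gA [(l, False)]" "gB [(g, True)] = - gB [(g, False)]"
  "gC [(g, True)] = - gC [(g, False)]"
  using gA_simps(3)[of "[(l, False)]"] gB_simps(3)[of "[(g, False)]"] gC_simps(3)[of "[(g, False)]"]
  by simp_all

lemma gA_tk: "gA (tk k) = gC (sigma k)"
  unfolding gA_def gB_def gC_def cls_eq using geq.rel[of "[]" k "[]"] by simp

lemma gA_subst_eq: "(\<And>s e. (s, e) \<in> set u \<Longrightarrow> gA (ah s) = gC [(s, False)]) \<Longrightarrow> gA (subst ah u) = gC u"
proof (induction u)
  case (Cons x u)
  obtain s e where x: "x = (s, e)" by fastforce
  have "gA (ah s) = gC [(s, False)]" "gA (subst ah u) = gC u" using Cons by (auto simp: x)
  then show ?case by (simp add: x gC_Cons[of "(s, e)" u] gX_inv)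
qed simp

text \<open>Induction along the recursion of \<open>ah\<close>: the correction \<open>cw s\<close>
  already has the same value in both factors, so it cancels against the correction contained in
  \<open>sigma\<close>.\<close>

lemma gA_ah: "gA (ah s) = gC [(s, False)]"
proof (induction s rule: ah.induct)
  case (1 s)
  have "gA (subst ah (cw s)) = gC (cw s)" using 1 by (rule gA_subst_eq)
  then show ?case
    by (simp add: ah.simps[of s] gA_tk sigma_def gC_Cons[of "(s, False)" "winv (cw s)"] add.assoc)
qed

lemma gA_subst [simp]: "gA (subst ah u) = gC u"
  by (rule gA_subst_eq) (rule gA_ah)

lemma gB_subst [simp]: "gB (subst bh u) = gC u"
  by (simp add: gC_def)

lemma gA_stab: "A.pw w 0 = 0 \<Longrightarrow> gA w = gC (A.sw w 0)"
  using gA_feq[OF A.sw_stab] by simp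

lemma gB_stab: "B.pw w 0 = 0 \<Longrightarrow> gB w = gC (B.sw w 0)"
  using gB_feq[OF B.sw_stab] by simp

lemma gA_trans: "gA w + gA (apow n) = gA (apow (A.pw w n)) + gC (A.sw w n)"
  using gA_feq[OF A.sw_transversal[of w n]] by (simp add: add.assoc)

lemma gB_trans: "gB w + gB (br n) = gB (br (B.pw w n)) + gC (B.sw w n)"
  using gB_feq[OF B.sw_transversal[of w n]] by (simp add: add.assoc)

abbreviation ga :: grp where "ga \<equiv> gA [(False, False)]"
abbreviation gb :: grp where "gb \<equiv> gB [(0, False)]"
abbreviation gt :: grp where "gt \<equiv> gA [(True, False)]"

lemma tau_0 [simp]: "tau 0 = 0" by simp

lemma bh_0: "bh 0 = replicate 6 (0, False)"
proof -
  have "prod_decode 0 = (0, 0)"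
    using prod_encode_inverse[of "(0, 0)"] by (simp add: prod_encode_def)
  then show ?thesis by (simp add: bh_def edge_pt_def br_def eval_nat_numeral)
qed

lemma gt_b6: "gt = gB (replicate 6 (0, False))"
  by (simp add: gA_def gB_def eA_def eB_def eval_nat_numeral)

lemma gt_C: "gt = gC [(0, False)]"
  by (simp add: gt_b6 gC_def bh_0)

lemma cls_letter: "cls [(0, e)] = gA [(False, e)]" "cls [(Suc l, e)] = gB [(l, e)]"
  by (simp_all add: gA_def gB_def eA_def eB_def)

section \<open>Normal forms and the action on cosets\<close>

definition rot :: "nat \<Rightarrow> nat" where
  "rot m = 3 * (m div 3) + (m mod 3 + 1) mod 3"

lemma rot_less_6: "rot 0 = 1" "rot 1 = 2" "rot (Suc 0) = 2" "rot 2 = 0" "rot 3 = 4" "rot 4 = 5" "rot 5 = 3"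
  by (simp_all add: rot_def)

lemma rot_block: "j < 3 \<Longrightarrow> rot (3 * q + j) = 3 * q + (j + 1) mod 3"
  unfolding rot_def by simp

lemma bp_rot: "bp l e (rot m) = rot (bp l e m)"
proof (cases l)
  case 0
  consider "m = 0" | "m = 1" | "m = 2" | "m = 3" | "m = 4" | "m = 5" | "6 \<le> m" by linarith
  then show ?thesis
  proof cases
    case 7
    then have "2 \<le> m div 3" by linarith
    then have "6 \<le> rot m" unfolding rot_def by linarith
    then show ?thesis using 0 7 by simp
  qed (use 0 in \<open>auto simp: rot_less_6 rot_def\<close>)
next
  case (Suc n)
  define q j where "q = m div 3" and "j = m mod 3"
  have j: "j < 3" and m: "m = 3 * q + j" by (simp_all add: q_def j_def)
  have j': "(j + 1) mod 3 < 3" by simp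
  consider "q = 0" | "q = n + 2" | "q \<noteq> 0" "q \<noteq> n + 2" by blast
  then show ?thesis
  proof cases
    case 1
    then have "bp l e m = 3 * (n + 2) + j" using Suc j m by simp
    then show ?thesis using Suc rot_block[OF j, of "n + 2"] rot_block[OF j, of 0] j' m 1 by simp
  next
    case 2
    then have "bp l e m = 3 * 0 + j" using Suc j m by simp
    then show ?thesis using Suc rot_block[OF j, of "n + 2"] rot_block[OF j, of 0] j' m 2 by simp
  next
    case 3
    have "bp l e (3 * q + i) = 3 * q + i" if "i < 3" for i
    proof -
      have "\<not> 3 * q + i < 3" using 3 by simp
      moreover have "\<not> (6 + 3 * n \<le> 3 * q + i \<and> 3 * q + i < 9 + 3 * n)" using 3 that by linarith
      ultimately show ?thesis using Suc by auto
    qed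
    from this[OF j] this[OF j'] show ?thesis by (simp add: m rot_block[OF j])
  qed
qed

lemma pw_rot: "B.pw w (rot m) = rot (B.pw w m)"
  by (induction w) (auto simp: bp_rot split: prod.splits)

definition chi :: "nat \<Rightarrow> int" where
  "chi m = (if m = 1 then 1 else if m = 2 then - 1 else 0)"

text \<open>An element fixing 0 commutes with the rotation, hence also fixes 1 =
  \<open>rot 0\<close> and 2 = \<open>rot 1\<close>.\<close>

lemma chi_stab: "B.pw w 0 = 0 \<Longrightarrow> chi (B.pw w m) = chi m"
proof -
  assume 0: "B.pw w 0 = 0"
  then have 1: "B.pw w 1 = 1" "B.pw w 2 = 2" using pw_rot[of w 0] pw_rot[of w 1] by (simp_all add: rot_less_6)
  show ?thesis
    using 1 B.pw_inj[of w m 1] B.pw_inj[of w m 2] by (auto simp: chi_def)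
qed

lemma rot_0: "rot m = 0 \<longleftrightarrow> m = 2"
proof (cases "m < 3")
  case True
  then consider "m = 0" | "m = 1" | "m = 2" by linarith
  then show ?thesis by cases (simp_all add: rot_less_6)
next
  case False
  then have "1 \<le> m div 3" by linarith
  then have "rot m \<noteq> 0" unfolding rot_def by linarith
  then show ?thesis using False by simp
qed

lemma rot_rot_0: "rot (rot m) = 0 \<longleftrightarrow> m = 1"
proof (cases "m < 3")
  case True
  then consider "m = 0" | "m = 1" | "m = 2" by linarith
  then show ?thesis by cases (simp_all add: rot_less_6)
next
  case False
  then have "1 \<le> m div 3" by linarith
  then have "3 \<le> rot m" unfolding rot_def by linarith
  then show ?thesis using False rot_0[of "rot m"] by simp
qed

text \<open>If an element takes a rotated copy of 0 to 0, it takes 0 to the copy rotated the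
  opposite way. Passing to inverses therefore exchanges the double cosets of 1 and 2, which is why
  their weights are opposite.\<close>

lemma chi_inv: "B.pw w m = 0 \<Longrightarrow> chi (B.pw w 0) = - chi m"
proof -
  assume m: "B.pw w m = 0"
  have 1: "m = 1 \<longleftrightarrow> B.pw w 0 = 2"
    using pw_rot[of w 0] rot_0[of "B.pw w 0"] m B.pw_inj[of w m 1] by (auto simp: rot_less_6)
  have "m = 2 \<longleftrightarrow> B.pw w 0 = 1"
    using pw_rot[of w 0] pw_rot[of w 1] rot_rot_0[of "B.pw w 0"] m B.pw_inj[of w m 2]
    by (auto simp: rot_less_6)
  with 1 show ?thesis by (auto simp: chi_def)
qed

text \<open>A \<open>ya\<close> lists the entries of a normal form starting in the first factor, a \<open>yb\<close> one starting
  in the second. The coset space is made of the pairs in which one component is empty.\<close>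

datatype ya = NA | CA int yb and yb = NB | CB nat ya

text \<open>An element of the common subgroup passes through a normal form from the left: it moves
  the first representative and continues on the remainder as its section there.\<close>

primrec actA :: "ya \<Rightarrow> nat word \<Rightarrow> ya" and actB :: "yb \<Rightarrow> nat word \<Rightarrow> yb" where
  "actA NA w = NA"
| "actA (CA n y) w = CA (A.pw (subst ah w) n) (actB y (A.sw (subst ah w) n))"
| "actB NB w = NB"
| "actB (CB m y) w = CB (B.pw (subst bh w) m) (actA y (B.sw (subst bh w) m))"

primrec wfA :: "ya \<Rightarrow> bool" and wfB :: "yb \<Rightarrow> bool" where
  "wfA NA = True"
| "wfA (CA n y) = (n \<noteq> 0 \<and> wfB y)"
| "wfB NB = True"
| "wfB (CB m y) = (m \<noteq> 0 \<and> wfA y)"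

primrec patA :: "ya \<Rightarrow> int list" and patB :: "yb \<Rightarrow> int list" where
  "patA NA = []"
| "patA (CA n y) = patB y"
| "patB NB = []"
| "patB (CB m y) = chi m # patA y"

primrec repA :: "ya \<Rightarrow> grp" and repB :: "yb \<Rightarrow> grp" where
  "repA NA = 0"
| "repA (CA n y) = gA (apow n) + repB y"
| "repB NB = 0"
| "repB (CB m y) = gB (br m) + repA y"

lemma pw_subst_0: "A.pw (subst ah w) n = 0 \<longleftrightarrow> n = 0" "B.pw (subst bh w) m = 0 \<longleftrightarrow> m = 0"
  using A.pw_inj[of "subst ah w" n 0] B.pw_inj[of "subst bh w" m 0] by auto

lemma act_feq:
  "u \<doteq> v \<Longrightarrow> actA x u = actA x v" "u \<doteq> v \<Longrightarrow> actB y u = actB y v"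
proof (induction x and y arbitrary: u v and u v)
  case (CA n y)
  have "subst ah u \<doteq> subst ah v" using CA.prems by (rule feq_subst)
  then show ?case using CA.IH[OF A.sw_feq] A.pw_feq by simp
next
  case (CB m y)
  have "subst bh u \<doteq> subst bh v" using CB.prems by (rule feq_subst)
  then show ?case using CB.IH[OF B.sw_feq] B.pw_feq by simp
qed simp_all

lemma act_append [simp]:
  "actA x (u @ v) = actA (actA x v) u" "actB y (u @ v) = actB (actB y v) u"
  by (induction x and y arbitrary: u v and u v) simp_all

lemma act_Nil [simp]: "actA x [] = x" "actB y [] = y"
  by (induction x and y) simp_all

lemma wf_act [simp]: "wfA (actA x w) \<longleftrightarrow> wfA x" "wfB (actB y w) \<longleftrightarrow> wfB y"
  by (induction x and y arbitrary: w and w) (simp_all add: pw_subst_0)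

lemma pat_act [simp]: "patA (actA x w) = patA x" "patB (actB y w) = patB y"
  by (induction x and y arbitrary: w and w) (simp_all add: chi_stab)

lemma act_eq_N [simp]: "actA x w = NA \<longleftrightarrow> x = NA" "actB y w = NB \<longleftrightarrow> y = NB"
  by (cases x; simp) (cases y; simp)

lemma rep_act: "\<exists>w'. gC w + repA x = repA (actA x w) + gC w'" "\<exists>w'. gC w + repB y = repB (actB y w) + gC w'"
proof (induction x and y arbitrary: w and w)
  case (CA n y)
  obtain w' where w': "gC (A.sw (subst ah w) n) + repB y = repB (actB y (A.sw (subst ah w) n)) + gC w'"
    using CA.IH by blast
  have "gC w + repA (CA n y) = gA (apow (A.pw (subst ah w) n)) + (gC (A.sw (subst ah w) n) + repB y)"
    using gA_trans[of "subst ah w" n] by (simp add: add.assoc[symmetric])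
  then show ?case unfolding w' by (auto simp: add.assoc)
next
  case (CB m y)
  obtain w' where w': "gC (B.sw (subst bh w) m) + repA y = repA (actA y (B.sw (subst bh w) m)) + gC w'"
    using CB.IH by blast
  have "gC w + repB (CB m y) = gB (br (B.pw (subst bh w) m)) + (gC (B.sw (subst bh w) m) + repA y)"
    using gB_trans[of "subst bh w" m] by (simp add: add.assoc[symmetric])
  then show ?case unfolding w' by (auto simp: add.assoc)
qed (use gC_simps(1) in auto)

section \<open>The cosets of the common subgroup and the action of the whole group\<close>

type_synonym pt = "ya \<times> yb"

definition wfE :: "pt \<Rightarrow> bool" where
  "wfE e \<longleftrightarrow> wfA (fst e) \<and> wfB (snd e) \<and> (fst e = NA \<or> snd e = NB)"

text \<open>A coset seen from the first factor, as a power of \<open>a\<close> followed by a form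
  that starts in the second factor; the exponent is 0 if the form already starts there. With
  \<open>jnA\<close> this lets a whole factor act, whether or not its syllable is trivial.\<close>

definition spA :: "pt \<Rightarrow> int \<times> yb" where
  "spA e = (case fst e of NA \<Rightarrow> (0, snd e) | CA n y \<Rightarrow> (n, y))"

definition spB :: "pt \<Rightarrow> nat \<times> ya" where
  "spB e = (case snd e of NB \<Rightarrow> (0, fst e) | CB m y \<Rightarrow> (m, y))"

fun jnA :: "int \<times> yb \<Rightarrow> pt" where
  "jnA (n, y) = (if n = 0 then (NA, y) else (CA n y, NB))"

fun jnB :: "nat \<times> ya \<Rightarrow> pt" where
  "jnB (m, y) = (if m = 0 then (y, NB) else (NA, CB m y))"

definition aA :: "bool word \<Rightarrow> pt \<Rightarrow> pt" where
  "aA w e = (case spA e of (n, y) \<Rightarrow> jnA (A.pw w n, actB y (A.sw w n)))"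

definition aB :: "nat word \<Rightarrow> pt \<Rightarrow> pt" where
  "aB w e = (case spB e of (m, y) \<Rightarrow> jnB (B.pw w m, actA y (B.sw w m)))"

definition aC :: "nat word \<Rightarrow> pt \<Rightarrow> pt" where
  "aC w e = (actA (fst e) w, actB (snd e) w)"

definition pat :: "pt \<Rightarrow> int list" where
  "pat e = patA (fst e) @ patB (snd e)"

definition rep :: "pt \<Rightarrow> grp" where
  "rep e = repA (fst e) + repB (snd e)"

abbreviation e0 :: pt where "e0 \<equiv> (NA, NB)"

lemma sp_jn [simp]: "spA (jnA p) = p" "spB (jnB q) = q"
  by (cases p; simp add: spA_def) (cases q; simp add: spB_def)

lemma jn_sp: "wfE e \<Longrightarrow> jnA (spA e) = e" "wfE e \<Longrightarrow> jnB (spB e) = e"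
  by (cases e; auto simp: wfE_def spA_def spB_def split: ya.splits yb.splits)+

lemma wf_sp: "wfE e \<Longrightarrow> wfB (snd (spA e))" "wfE e \<Longrightarrow> wfA (snd (spB e))"
  by (cases e; auto simp: wfE_def spA_def spB_def split: ya.splits yb.splits)+

lemma wf_jn [simp]: "wfE (jnA (n, y)) \<longleftrightarrow> wfB y" "wfE (jnB (m, x)) \<longleftrightarrow> wfA x"
  by (auto simp: wfE_def)

lemma wf_aA: "wfE e \<Longrightarrow> wfE (aA w e)" and wf_aB: "wfE e \<Longrightarrow> wfE (aB w' e)"
  using wf_sp[of e] by (auto simp: aA_def aB_def simp del: jnA.simps jnB.simps split: prod.splits)

lemma aA_Nil: "wfE e \<Longrightarrow> aA [] e = e" and aB_Nil: "wfE e \<Longrightarrow> aB [] e = e"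
  using jn_sp[of e] by (auto simp: aA_def aB_def simp del: jnA.simps jnB.simps split: prod.splits)

lemma aA_append: "aA (u @ v) e = aA u (aA v e)" and aB_append: "aB (u' @ v') e = aB u' (aB v' e)"
  by (auto simp: aA_def aB_def simp del: jnA.simps jnB.simps split: prod.splits)

lemma aA_feq: "u \<doteq> v \<Longrightarrow> aA u e = aA v e" and aB_feq: "u' \<doteq> v' \<Longrightarrow> aB u' e = aB v' e"
  by (auto simp: aA_def aB_def A.pw_feq B.pw_feq act_feq[OF A.sw_feq] act_feq[OF B.sw_feq]
      simp del: jnA.simps jnB.simps split: prod.splits)

text \<open>Together with \<open>aB_aC\<close>: on elements of the common subgroup both factor
  actions reduce to \<open>aC\<close>. This agreement is what the relations of the amalgam demand of
  an action.\<close>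

lemma aA_aC: "wfE e \<Longrightarrow> A.pw w 0 = 0 \<Longrightarrow> aA w e = aC (A.sw w 0) e"
proof -
  assume e: "wfE e" and w: "A.pw w 0 = 0"
  have f: "subst ah (A.sw w 0) \<doteq> w" by (rule A.sw_stab[OF w])
  show ?thesis
  proof (cases "fst e")
    case NA
    then show ?thesis using w by (simp add: aA_def aC_def spA_def)
  next
    case (CA n y)
    then have "n \<noteq> 0" "snd e = NB" using e by (auto simp: wfE_def)
    then show ?thesis using CA A.pw_inj[of w n 0] w act_feq(2)[OF A.sw_feq[OF f]]
      by (auto simp: aA_def aC_def spA_def A.pw_feq[OF f])
  qed
qed

lemma aB_aC: "wfE e \<Longrightarrow> B.pw w 0 = 0 \<Longrightarrow> aB w e = aC (B.sw w 0) e"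
proof -
  assume e: "wfE e" and w: "B.pw w 0 = 0"
  have f: "subst bh (B.sw w 0) \<doteq> w" by (rule B.sw_stab[OF w])
  show ?thesis
  proof (cases "snd e")
    case NB
    then show ?thesis using w by (simp add: aB_def aC_def spB_def)
  next
    case (CB n y)
    then have "n \<noteq> 0" "fst e = NA" using e by (auto simp: wfE_def)
    then show ?thesis using CB B.pw_inj[of w n 0] w act_feq(1)[OF B.sw_feq[OF f]]
      by (auto simp: aB_def aC_def spB_def B.pw_feq[OF f])
  qed
qed

definition lact :: "nat \<times> bool \<Rightarrow> pt \<Rightarrow> pt" where
  "lact x e = (case x of (l, s) \<Rightarrow>
     if l = 0 then aA [(False, s)] e else aB [(l - 1, s)] e)"

definition wact :: "nat word \<Rightarrow> pt \<Rightarrow> pt" where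
  "wact w e = foldr lact w e"

lemma wact_simps [simp]: "wact [] e = e" "wact (x # w) e = lact x (wact w e)"
  "wact (u @ v) e = wact u (wact v e)"
  by (simp_all add: wact_def)

lemma wf_wact: "wfE e \<Longrightarrow> wfE (wact w e)"
  by (induction w) (auto simp: lact_def wf_aA wf_aB split: prod.splits)

lemma feq_pair: "[(l, s), (l, \<not> s)] \<doteq> []"
  using feq.cancel[of "[]" l s "[]"] by simp

lemma lact_inv: "wfE e \<Longrightarrow> lact (l, s) (lact (l, \<not> s) e) = e"
proof -
  assume e: "wfE e"
  show ?thesis using feq_pair[of False s] feq_pair[of "l - 1" s] aA_Nil[OF e] aB_Nil[OF e] aA_append[symmetric] aB_append[symmetric]
      aA_feq[of "[(False, s), (False, \<not> s)]" "[]"] aB_feq[of "[(l - 1, s), (l - 1, \<not> s)]" "[]"]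
    by (simp add: lact_def)
qed

lemma wact_feq: "u \<doteq> v \<Longrightarrow> wfE e \<Longrightarrow> wact u e = wact v e"
  by (induction arbitrary: e rule: feq.induct) (simp_all add: lact_inv wf_wact)

lemma wact_eB: "wfE e \<Longrightarrow> wact (eB w) e = aB w e"
proof (induction w)
  case (Cons x w)
  obtain l s where x: "x = (l, s)" by fastforce
  show ?case using Cons aB_append[of "[x]" w e] by (simp add: eB_def x lact_def)
qed (simp add: eB_def aB_Nil)

lemma aA_t: "wfE e \<Longrightarrow> aA [(True, False)] e = aB (replicate 6 (0, False)) e"
proof -
  assume e: "wfE e"
  have z: "prod_encode (0, 0) = 0" unfolding prod_encode_def by simp
  have z': "prod_decode 0 = (0, 0)" using prod_encode_inverse[of "(0, 0)"] unfolding z .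
  have "A.pw [(True, False)] 0 = 0" "A.sw [(True, False)] 0 = [(0, False)]"
    by (simp_all add: z z' A.sec'_def sigma_def sg_def cw_def)
  then have "aA [(True, False)] e = aC [(0, False)] e"
    using aA_aC[OF e, of "[(True, False)]"] by simp
  also have "\<dots> = aC (B.sw (bh 0) 0) e"
    using act_feq[OF B.sw_h[of 0]] by (simp add: aC_def)
  also have "\<dots> = aB (bh 0) e"
    using aB_aC[OF e, of "bh 0"] B.pw_h by simp
  finally show ?thesis by (simp add: bh_0)
qed

lemma wact_eA: "wfE e \<Longrightarrow> wact (eA w) e = aA w e"
proof (induction w)
  case (Cons x w)
  obtain l s where x: "x = (l, s)" by fastforce
  have wf: "wfE (aA w e)" using Cons.prems by (rule wf_aA)
  have t: "wact (replicate 6 (1, False)) e' = aA [(True, False)] e'" if "wfE e'" for e'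
    using wact_eB[OF that, of "replicate 6 (0, False)"] aA_t[OF that] by (simp add: eB_def subst_def eval_nat_numeral)
  have "wact (winv (replicate 6 (1, False))) e' = aA [(True, True)] e'" if e': "wfE e'" for e'
  proof -
    have "aA [(True, False)] (aA [(True, True)] e') = e'"
      using feq_pair[of True False] aA_feq aA_append[of "[(True, False)]" "[(True, True)]" e'] aA_Nil[OF e'] by simp
    then have "wact (winv (replicate 6 (1, False))) (wact (replicate 6 (1, False)) (aA [(True, True)] e')) =
      wact (winv (replicate 6 (1, False))) e'"
      using t[OF wf_aA[OF e']] by simp
    then show ?thesis
      using wact_feq[OF feq_winv_left wf_aA[OF e']] by (simp only: wact_simps(3)[symmetric] wact_simps(1))
  qed
  then show ?case using Cons t[OF wf] wf aA_append[of "[x]" w e]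
    by (cases l; cases s) (auto simp: eA_def x lact_def simp del: replicate.simps)
qed (simp add: eA_def aA_Nil)

lemma wact_geq: "u \<approx> v \<Longrightarrow> wfE e \<Longrightarrow> wact u e = wact v e"
proof (induction arbitrary: e rule: geq.induct)
  case (rel u k v)
  define e' where "e' = wact v e"
  have e': "wfE e'" using rel by (simp add: e'_def wf_wact)
  have t: "A.pw (tk k) 0 = 0" "A.sw (tk k) 0 = sigma k"
    by (simp_all add: tk_def pw_apow sw_apow pw_winv_apow sw_winv_apow A.sec'_def)
  have "aA (tk k) e' = aC (sigma k) e'" using aA_aC[OF e', of "tk k"] t by simp
  also have "\<dots> = aC (B.sw (subst bh (sigma k)) 0) e'"
    using act_feq[OF B.sw_subst[of "sigma k"]] by (simp add: aC_def)
  also have "\<dots> = aB (subst bh (sigma k)) e'"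
    using aB_aC[OF e', of "subst bh (sigma k)"] B.pw_subst by simp
  finally show ?case using wact_eA[OF e'] wact_eB[OF e'] by (simp add: e'_def)
qed (simp_all add: wact_feq)

definition act :: "grp \<Rightarrow> pt \<Rightarrow> pt" where
  "act g e = wact (rep_grp g) e"

lemma act_cls: "wfE e \<Longrightarrow> act (cls w) e = wact w e"
proof -
  have "rep_grp (cls w) \<approx> w"
    by (metis Quotient3_grp Quotient3_rep_abs cls.abs_eq geq.feq feq.refl)
  then show "wfE e \<Longrightarrow> act (cls w) e = wact w e" unfolding act_def by (rule wact_geq)
qed

lemma wf_act_grp [simp]: "wfE e \<Longrightarrow> wfE (act g e)"
  by (simp add: act_def wf_wact)

lemma wf_e0 [simp]: "wfE e0" by (simp add: wfE_def)

lemma act_plus [simp]: "wfE e \<Longrightarrow> act (g + h) e = act g (act h e)"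
proof -
  assume e: "wfE e"
  obtain u v where "g = cls u" "h = cls v" using cls_surj by metis
  then show ?thesis using e act_cls[of e "u @ v"] by (simp add: act_cls wf_wact)
qed

lemma act_0 [simp]: "wfE e \<Longrightarrow> act 0 e = e"
  using act_cls[of e "[]"] by simp

lemma act_gA [simp]: "wfE e \<Longrightarrow> act (gA w) e = aA w e"
  by (simp add: gA_def act_cls wact_eA)

lemma act_gB [simp]: "wfE e \<Longrightarrow> act (gB w) e = aB w e"
  by (simp add: gB_def act_cls wact_eB)

lemma act_gC: "wfE e \<Longrightarrow> act (gC w) e = aC w e"
proof -
  assume e: "wfE e"
  have "aC (B.sw (subst bh w) 0) e = aC w e"
    using act_feq[OF B.sw_subst[of w]] by (simp add: aC_def)
  then show ?thesis using aB_aC[OF e, of "subst bh w"] B.pw_subst e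
    by (simp only: gC_def act_gB)
qed

lemma rep_letter:
  assumes "wfE e"
  shows "\<exists>w'. cls [x] + rep e = rep (act (cls [x]) e) + gC w'"
proof -
  obtain l s where x: "x = (l, s)" by fastforce
  show ?thesis
  proof (cases l)
    case 0
    obtain n y where sp: "spA e = (n, y)" by fastforce
    then have r: "rep e = gA (apow n) + repB y"
      using assms by (auto simp: rep_def spA_def wfE_def split: ya.splits)
    let ?w = "[(False, s)]"
    obtain w' where w': "gC (A.sw ?w n) + repB y = repB (actB y (A.sw ?w n)) + gC w'"
      using rep_act(2) by blast
    have "cls [x] + rep e = (gA ?w + gA (apow n)) + repB y"
      by (simp add: x 0 cls_letter r add.assoc)
    also have "\<dots> = gA (apow (A.pw ?w n)) + repB (actB y (A.sw ?w n)) + gC w'"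
      unfolding gA_trans add.assoc w' ..
    also have "gA (apow (A.pw ?w n)) + repB (actB y (A.sw ?w n)) = rep (jnA (A.pw ?w n, actB y (A.sw ?w n)))"
      by (simp add: rep_def)
    also have "jnA (A.pw ?w n, actB y (A.sw ?w n)) = act (cls [x]) e"
      by (simp only: x 0 cls_letter act_gA[OF assms] aA_def sp prod.case)
    finally show ?thesis by blast
  next
    case (Suc l')
    obtain n y where sp: "spB e = (n, y)" by fastforce
    then have r: "rep e = gB (br n) + repA y"
      using assms by (auto simp: rep_def spB_def wfE_def br_def split: yb.splits)
    let ?w = "[(l', s)]"
    obtain w' where w': "gC (B.sw ?w n) + repA y = repA (actA y (B.sw ?w n)) + gC w'"
      using rep_act(1) by blast
    have "cls [x] + rep e = (gB ?w + gB (br n)) + repA y"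
      by (simp add: x Suc cls_letter r add.assoc)
    also have "\<dots> = gB (br (B.pw ?w n)) + repA (actA y (B.sw ?w n)) + gC w'"
      unfolding gB_trans add.assoc w' ..
    also have "gB (br (B.pw ?w n)) + repA (actA y (B.sw ?w n)) = rep (jnB (B.pw ?w n, actA y (B.sw ?w n)))"
      by (simp add: rep_def br_def)
    also have "jnB (B.pw ?w n, actA y (B.sw ?w n)) = act (cls [x]) e"
      by (simp only: x Suc cls_letter act_gB[OF assms] aB_def sp prod.case)
    finally show ?thesis by blast
  qed
qed

text \<open>Letter by letter, the form of the coset of g is a normal form of g up to a factor from
  the common subgroup on the right.\<close>

lemma rep_act_e0: "\<exists>w. g = rep (act g e0) + gC w"
proof -
  have "\<exists>w'. cls w = rep (act (cls w) e0) + gC w'" for w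
  proof (induction w)
    case Nil
    show ?case by (rule exI[of _ "[]"]) (simp add: rep_def)
  next
    case (Cons x w)
    then obtain w' where w': "cls w = rep (act (cls w) e0) + gC w'" by blast
    obtain w'' where w'': "cls [x] + rep (act (cls w) e0) = rep (act (cls [x]) (act (cls w) e0)) + gC w''"
      using rep_letter[of "act (cls w) e0" x] by auto
    have c: "cls (x # w) = cls [x] + cls w" using cls_simps(2)[of "[x]" w] by simp
    have "cls (x # w) = cls [x] + rep (act (cls w) e0) + gC w'"
      unfolding c by (subst w') (simp add: add.assoc)
    also have "\<dots> = rep (act (cls [x]) (act (cls w) e0)) + gC (w'' @ w')"
      unfolding w'' by (simp add: add.assoc)
    also have "act (cls [x]) (act (cls w) e0) = act (cls (x # w)) e0" by (simp add: c)
    finally show ?case by blast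
  qed
  moreover obtain w where "g = cls w" by (rule cls_surj)
  ultimately show ?thesis by blast
qed

section \<open>Patterns\<close>

definition rn :: "int list \<Rightarrow> int list" where
  "rn p = map uminus (rev p)"

lemma rn_simps [simp]: "rn [] = []" "rn (p @ q) = rn q @ rn p" "rn (x # p) = rn p @ [- x]" "rn (rn p) = p"
  "length (rn p) = length p" "rn p = [] \<longleftrightarrow> p = []"
  by (simp_all add: rn_def rev_map o_def)

text \<open>The sides of a triangle in a tree, up to one entry at each corner of the central triangle.\<close>

definition tri :: "int list \<Rightarrow> int list \<Rightarrow> int list \<Rightarrow> bool" where
  "tri p q r \<longleftrightarrow> (\<exists>\<alpha> \<beta> \<gamma> m1 m2 m3. p = \<alpha> @ m1 @ \<beta> \<and> q = rn \<beta> @ m2 @ \<gamma> \<and> r = \<alpha> @ m3 @ \<gamma> \<and>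
     length m1 \<le> 1 \<and> length m2 \<le> 1 \<and> length m3 \<le> 1 \<and> (m3 = [] \<longrightarrow> m1 = [] \<and> m2 = []))"

lemma triI:
  "p = \<alpha> @ m1 @ \<beta> \<Longrightarrow> q = rn \<beta> @ m2 @ \<gamma> \<Longrightarrow> r = \<alpha> @ m3 @ \<gamma> \<Longrightarrow>
     length m1 \<le> 1 \<Longrightarrow> length m2 \<le> 1 \<Longrightarrow> length m3 \<le> 1 \<Longrightarrow> (m3 = [] \<Longrightarrow> m1 = [] \<and> m2 = []) \<Longrightarrow> tri p q r"
  unfolding tri_def by blast

lemma tri_total: "q = rn p @ r \<Longrightarrow> tri p q r"
  by (rule triI[of _ "[]" "[]" p _ "[]" r _ "[]"]) simp_all

lemma tri_Cons: "tri p q r \<Longrightarrow> tri (x # p) q (x # r)"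
  unfolding tri_def by (metis append_Cons)

lemma wfE_cases:
  assumes "wfE e"
  obtains "e = e0" | n y where "e = (CA n y, NB)" "n \<noteq> 0" "wfB y" | m y where "e = (NA, CB m y)" "m \<noteq> 0" "wfA y"
  using assms by (cases e; cases "fst e"; cases "snd e") (auto simp: wfE_def)

text \<open>A normal form applied to a coset either keeps its front or is cancelled completely.\<close>

lemma act_rep:
  assumes "wfE e"
  shows "wfA x \<Longrightarrow> (fst (act (repA x) e) \<noteq> NA \<and> tri (patA x) (pat e) (pat (act (repA x) e))) \<or>
      (fst (act (repA x) e) = NA \<and> pat e = rn (patA x) @ pat (act (repA x) e))"
    and "wfB y \<Longrightarrow> (snd (act (repB y) e) \<noteq> NB \<and> tri (patB y) (pat e) (pat (act (repB y) e))) \<or>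
      (snd (act (repB y) e) = NB \<and> pat e = rn (patB y) @ pat (act (repB y) e))"
proof (induction x and y)
  case NA
  show ?case using assms by (auto intro: tri_total)
next
  case NB
  show ?case using assms by (auto intro: tri_total)
next
  case (CA n z)
  define e1 where "e1 = act (repB z) e"
  have e1: "wfE e1" using assms by (simp add: e1_def)
  have eq: "act (repA (CA n z)) e = aA (apow n) e1" using assms by (simp add: e1_def)
  have n: "n \<noteq> 0" "wfB z" using CA.prems by auto
  from CA.IH[OF n(2)] consider "snd e1 \<noteq> NB" "tri (patB z) (pat e) (pat e1)"
    | "snd e1 = NB" "pat e = rn (patB z) @ pat e1" by (auto simp: e1_def)
  then show ?case
  proof cases
    case 1
    then have "aA (apow n) e1 = (CA n (snd e1), NB)" "fst e1 = NA"
      using e1 n by (auto simp: wfE_def aA_def spA_def pw_apow sw_apow)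
    then show ?thesis using 1 unfolding eq by (simp add: pat_def)
  next
    case 2
    obtain n' y' where sp: "spA e1 = (n', y')" by fastforce
    have p: "pat e1 = patB y'" "n' = 0 \<Longrightarrow> y' = NB"
      using e1 by (cases rule: wfE_cases; use 2 sp in \<open>auto simp: spA_def pat_def\<close>)+
    have a: "aA (apow n) e1 = jnA (n + n', y')" by (simp add: aA_def sp pw_apow sw_apow)
    show ?thesis
    proof (cases "n + n' = 0")
      case True
      then show ?thesis unfolding eq a using p 2 by (simp add: pat_def)
    next
      case False
      then show ?thesis unfolding eq a using p 2 by (auto simp: pat_def intro: tri_total)
    qed
  qed
next
  case (CB m z)
  define e1 where "e1 = act (repA z) e"
  have e1: "wfE e1" using assms by (simp add: e1_def)
  have eq: "act (repB (CB m z)) e = aB (br m) e1" using assms by (simp add: e1_def)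
  have m: "m \<noteq> 0" "wfA z" using CB.prems by auto
  from CB.IH[OF m(2)] consider "fst e1 \<noteq> NA" "tri (patA z) (pat e) (pat e1)"
    | "fst e1 = NA" "pat e = rn (patA z) @ pat e1" by (auto simp: e1_def)
  then show ?case
  proof cases
    case 1
    then have "aB (br m) e1 = (NA, CB m (fst e1))" "snd e1 = NB"
      using e1 m by (auto simp: wfE_def aB_def spB_def pw_br sw_br)
    then show ?thesis using 1 tri_Cons unfolding eq by (simp add: pat_def)
  next
    case 2
    consider "e1 = e0" | m' y where "e1 = (NA, CB m' y)" "m' \<noteq> 0" using e1 2(1) by (cases rule: wfE_cases) auto
    then show ?thesis
    proof cases
      case e: 1
      have "aB (br m) e1 = (NA, CB m NA)" using m by (simp add: e aB_def spB_def pw_br)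
      moreover have "tri (chi m # patA z) (pat e) [chi m]"
        by (rule triI[of _ "[chi m]" "[]" "patA z" _ "[]" "[]" _ "[]"]) (use 2 e in \<open>simp_all add: pat_def\<close>)
      ultimately show ?thesis unfolding eq by (simp add: pat_def)
    next
      case e: 2
      let ?m = "B.pw (br m) m'"
      have a: "aB (br m) e1 = jnB (?m, actA y (B.sw (br m) m'))" by (simp add: e aB_def spB_def)
      show ?thesis
      proof (cases "?m = 0")
        case True
        \<comment> \<open>The syllables cancel completely, and by the symmetry under inversion so do
          their weights: the cancelled part of the pattern stays an exact negated reversal.\<close>
        then have "chi m = - chi m'" using chi_inv[of "br m" m'] by (simp add: pw_br)
        then show ?thesis unfolding eq a using True 2 e by (simp add: pat_def)
      next
        case False
        have "tri (chi m # patA z) (pat e) (chi ?m # patA y)"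
          by (rule triI[of _ "[]" "[chi m]" "patA z" _ "[chi m']" "patA y" _ "[chi ?m]"])
            (use 2 e in \<open>simp_all add: pat_def\<close>)
        then show ?thesis unfolding eq a using False by (simp add: pat_def)
      qed
    qed
  qed
qed

definition P :: "grp \<Rightarrow> int list" where
  "P g = pat (act g e0)"

lemma pat_aA [simp]: "wfE e \<Longrightarrow> pat (aA w e) = pat e"
  by (erule wfE_cases) (auto simp: aA_def spA_def pat_def chi_stab)

lemma pat_aC [simp]: "pat (aC w e) = pat e"
  by (simp add: aC_def pat_def)

lemma wf_aC [simp]: "wfE (aC w e) \<longleftrightarrow> wfE e"
  by (simp add: aC_def wfE_def)

text \<open>Write g as its normal form times an element of the common subgroup. The latter does not
  change patterns, so the comparison for normal forms applies to the moved coset.\<close>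

lemma tri_act:
  assumes "wfE e"
  shows "tri (P g) (pat e) (pat (act g e))"
proof -
  define r where "r = rep (act g e0)"
  obtain w where w: "g = r + gC w" unfolding r_def using rep_act_e0 by blast
  have "wfE (act g e0)" by simp
  then obtain x y where xy: "act g e0 = (x, y)" "wfA x" "wfB y" "x = NA \<or> y = NB"
    by (cases "act g e0") (auto simp: wfE_def)
  have "act g e = act r (aC w e)" unfolding w using assms by (simp add: act_gC)
  moreover have "tri (P g) (pat (aC w e)) (pat (act r (aC w e)))"
  proof -
    have wf: "wfE (aC w e)" using assms by simp
    from xy(4) show ?thesis
    proof
      assume "x = NA"
      then have "r = repB y" "P g = patB y" by (simp_all add: r_def P_def xy(1) rep_def pat_def)
      then show ?thesis using act_rep(2)[OF wf xy(3)] tri_total by metis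
    next
      assume "y = NB"
      then have "r = repA x" "P g = patA x" by (simp_all add: r_def P_def xy(1) rep_def pat_def)
      then show ?thesis using act_rep(1)[OF wf xy(2)] tri_total by metis
    qed
  qed
  ultimately show ?thesis by simp
qed

lemma tri_P: "tri (P g) (P h) (P (g + h))"
  using tri_act[of "act h e0" g] by (simp add: P_def)

lemma P_0 [simp]: "P 0 = []"
  by (simp add: P_def pat_def)

text \<open>In the triangle of g, \<open>- g\<close> and 0 the third side is empty. An empty corner
  \<open>m3\<close> forces the other two corners to be empty, so the first two sides match
  exactly.\<close>

lemma P_minus [simp]: "P (- g) = rn (P g)"
  using tri_P[of g "- g"] by (auto simp: tri_def)

lemma P_gA_left [simp]: "P (gA w + g) = P g"
  by (simp add: P_def)

text \<open>The coset of \<open>gA v\<close> has an empty pattern, so it cannot cancel the nonempty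
  part of \<open>h\<close> that starts in the second factor. The leading power of \<open>a\<close>
  therefore stays the same for every \<open>v\<close>.\<close>

lemma front_gA:
  assumes "\<nexists>w. h = gA w"
  obtains n where "\<And>v. fst (spA (act (h + gA v) e0)) = n"
proof -
  define r where "r = rep (act h e0)"
  obtain c where c: "h = r + gC c" unfolding r_def using rep_act_e0 by blast
  obtain n y where sp: "spA (act h e0) = (n, y)" by fastforce
  have "wfE (act h e0)" by simp
  then have y: "wfB y" and r: "r = gA (apow n) + repB y"
    by (cases rule: wfE_cases; use sp in \<open>auto simp: spA_def rep_def r_def\<close>)+
  have "y \<noteq> NB"
  proof
    assume "y = NB"
    then have "h = gA (apow n @ subst ah c)" using c r by simp
    then show False using assms by blast
  qed
  have "fst (spA (act (h + gA v) e0)) = n" for v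
  proof -
    define e where "e = aC c (aA v e0)"
    define e1 where "e1 = act (repB y) e"
    have e: "wfE e" "pat e = []" by (simp_all add: e_def wf_aA) (simp add: pat_def)
    have "snd e1 \<noteq> NB"
    proof
      assume "snd e1 = NB"
      then have "patB y = []" using act_rep(2)[OF e(1) y] e(2) by (auto simp: e1_def)
      then show False using \<open>y \<noteq> NB\<close> by (cases y) auto
    qed
    moreover have "wfE e1" using e by (simp add: e1_def)
    ultimately have "spA e1 = (0, snd e1)" by (auto elim!: wfE_cases simp: spA_def)
    moreover have "act (h + gA v) e0 = aA (apow n) e1"
      unfolding c using e(1) by (simp add: r act_gC e_def e1_def wf_aA)
    ultimately show ?thesis by (simp add: aA_def pw_apow del: jnA.simps)
  qed
  then show ?thesis by (rule that)
qed

section \<open>Conjugacy classes of the first factor\<close>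

primrec mul :: "nat \<Rightarrow> grp \<Rightarrow> grp" where
  "mul 0 g = 0"
| "mul (Suc n) g = g + mul n g"

definition cj :: "grp \<Rightarrow> grp \<Rightarrow> bool" where
  "cj g h \<longleftrightarrow> (\<exists>x. x + g = h + x)"

lemmas grp_simps = diff_conv_add_uminus minus_add add.assoc

lemma cj_refl [simp]: "cj g g"
  unfolding cj_def by (rule exI[of _ 0]) simp

lemma cj_sym: "cj g h \<Longrightarrow> cj h g"
proof -
  assume "cj g h"
  then obtain x where "x + g = h + x" unfolding cj_def by blast
  then have "- x + h = g + - x" by (metis add.assoc add.right_inverse add.right_neutral minus_add_cancel)
  then show ?thesis unfolding cj_def by blast
qed

lemma cj_trans [trans]: "cj g h \<Longrightarrow> cj h k \<Longrightarrow> cj g k"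
  unfolding cj_def by (metis add.assoc)

lemma cj_conj: "cj g (x + g - x)" "cj g (- x + g + x)"
proof -
  show "cj g (x + g - x)" unfolding cj_def by (rule exI[of _ x]) (simp add: add.assoc)
  show "cj g (- x + g + x)" unfolding cj_def by (rule exI[of _ "- x"]) (simp add: grp_simps del: add_uminus_conv_diff)
qed

lemma cj_rotate: "cj (g + h) (h + g)"
  unfolding cj_def by (rule exI[of _ h]) (simp add: add.assoc)

lemma cj_minus: "cj g h \<Longrightarrow> cj (- g) (- h)"
proof -
  assume "cj g h"
  then obtain x where x: "x + g = h + x" unfolding cj_def by blast
  have "h + (x + - g) = x + (g + - g)" by (simp only: add.assoc[symmetric] x)
  then have "x + - g = - h + x" by (metis add.right_inverse add.right_neutral minus_add_cancel)
  then show ?thesis unfolding cj_def by blast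
qed

lemma cj_mul: "cj g h \<Longrightarrow> cj (mul n g) (mul n h)"
proof -
  assume "cj g h"
  then obtain x where x: "x + g = h + x" unfolding cj_def by blast
  have "x + mul n g = mul n h + x"
  proof (induction n)
    case (Suc n)
    have "x + mul (Suc n) g = (x + g) + mul n g" by (simp add: add.assoc)
    also have "\<dots> = h + (x + mul n g)" by (simp add: x add.assoc)
    finally show ?case by (simp add: Suc add.assoc)
  qed simp
  then show ?thesis unfolding cj_def by blast
qed

lemma cj_0 [simp]: "cj g 0 \<longleftrightarrow> g = 0" "cj 0 g \<longleftrightarrow> g = 0"
  unfolding cj_def by (metis add.left_neutral add.right_neutral add_left_imp_eq add_right_imp_eq)+

lemma gC_loop:
  assumes "1 \<le> l" "bp l False (m + 3) = m + 3"
  shows "gC [(prod_encode (l, m), False)] = - gB (br (m + 3)) + gB [(l, False)] + gB (br (m + 3))"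
  using assms gB_Cons[of "(l, False)" "br (m + 3)"]
  by (simp add: gC_def bh_def edge_pt_def add.assoc del: gB_subst bp.simps)

lemma gb_powers: "gB (br 1) = gb + gb" "gB (br 2) = gb + gb + gb + gb" "gB (br 3) = gb" "gB (br 4) = gb + gb + gb"
  using gB_Cons[of "(0, False)" "[(0, False)]"] gB_Cons[of "(0, False)" "[(0, False), (0, False)]"]
    gB_Cons[of "(0, False)" "[(0, False), (0, False), (0, False)]"]
  by (simp_all add: br_def replicate_unroll numeral_2_eq_2 add.assoc)

lemma gC_cw_Nil: "cw s = [] \<Longrightarrow> 0 \<le> pos s \<Longrightarrow> gC [(s, False)] = - gA (apow (pos s)) + gt + gA (apow (pos s))"
  using gA_ah[of s] gA_Cons[of "(True, False)" "apow (pos s)"] by (simp add: ah.simps[of s] tk_def add.assoc)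

text \<open>The generators (l, 0) and (l, 1) are loops with the same label at the points 3 and 4,
  hence conjugate by \<open>b^2\<close>. The first is matched with the negative position
  \<open>v\<close>, the second with a filler, which is a conjugate of \<open>t\<close>.\<close>

lemma cj_sg_gt: "v < 0 \<Longrightarrow> cj (gC [(sg v, False)]) gt"
proof -
  assume v: "v < 0"
  define n where "n = nat (- 1 - v)"
  define l where "l = 2 + 2 * n"
  have l: "sg v = prod_encode (l, 0)" "l mod 2 = 0" "2 \<le> l"
    unfolding l_def using v by (simp add: sg_def n_def, presburger, simp)
  let ?s = "prod_encode (l, 1)"
  have "bp l False 3 = 3" "bp l False 4 = 4" using l(3) by (cases l; simp)+
  then have 0: "gC [(prod_encode (l, 0), False)] = - gb + gB [(l, False)] + gb"
    and 1: "gC [(?s, False)] = - (gb + gb + gb) + gB [(l, False)] + (gb + gb + gb)"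
    using gC_loop[of l 0] gC_loop[of l 1] l(3) by (simp_all add: gb_powers)
  have "(gb + gb) + gC [(?s, False)] = gC [(prod_encode (l, 0), False)] + (gb + gb)"
    unfolding 0 1 by (simp add: grp_simps del: add_uminus_conv_diff)
  then have "cj (gC [(?s, False)]) (gC [(sg v, False)])" unfolding cj_def l(1) by blast
  moreover have "cw ?s = []" "0 \<le> pos ?s" using l by (auto simp: cw_def pos_def fil_def)
  then have "cj gt (gC [(?s, False)])" unfolding gC_cw_Nil[OF \<open>cw ?s = []\<close> \<open>0 \<le> pos ?s\<close>] by (intro cj_conj)
  ultimately have "cj gt (gC [(sg v, False)])" by (rule cj_trans[rotated])
  then show ?thesis by (rule cj_sym)
qed

definition esw :: "edge list \<Rightarrow> nat word" where
  "esw es = concat (rev (map (\<lambda>(u, w, e). if e then winv (sigma w) else sigma u) es))"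

lemma path_sw:
  assumes "\<And>u w e. (u, w, e) \<in> set (path \<beta> n i p f) \<Longrightarrow> if e then tau w = u else tau u = w"
  shows "A.sw (rev f) p = esw (path \<beta> n i p f) \<and>
    (f \<noteq> [] \<longrightarrow> fst (last f) \<longrightarrow> i + length f = n \<longrightarrow> A.pw (rev f) p = pt \<beta> 0)"
  using assms
proof (induction f arbitrary: i p)
  case (Cons x f)
  obtain g e where x: "x = (g, e)" by fastforce
  show ?case
  proof (cases g)
    case True
    let ?q = "pt \<beta> (if Suc i = n then 0 else Suc i)"
    have es: "path \<beta> n i p (x # f) = (p, ?q, e) # path \<beta> n (Suc i) ?q f" by (simp add: x True Let_def)
    have "if e then tau ?q = p else tau p = ?q" by (rule Cons.prems) (simp only: es list.set_intros(1))
    then have q: "ap True e p = ?q" using tau_taui(2)[of ?q] by (cases e) auto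
    have IH: "A.sw (rev f) ?q = esw (path \<beta> n (Suc i) ?q f) \<and>
      (f \<noteq> [] \<longrightarrow> fst (last f) \<longrightarrow> Suc i + length f = n \<longrightarrow> A.pw (rev f) ?q = pt \<beta> 0)"
      by (rule Cons.IH, rule Cons.prems) (unfold es, rule list.set_intros(2))
    have "A.sec' True e p = (if e then winv (sigma ?q) else sigma p)"
      using q by (auto simp: A.sec'_def)
    then show ?thesis using IH q unfolding es by (auto simp: x True esw_def simp del: ap.simps(2))
  next
    case False
    let ?q = "if e then p - 1 else p + 1"
    have es: "path \<beta> n i p (x # f) = path \<beta> n (Suc i) ?q f" by (simp add: x False)
    have "A.sw (rev f) ?q = esw (path \<beta> n (Suc i) ?q f) \<and>
      (f \<noteq> [] \<longrightarrow> fst (last f) \<longrightarrow> Suc i + length f = n \<longrightarrow> A.pw (rev f) ?q = pt \<beta> 0)"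
      by (rule Cons.IH, rule Cons.prems) (simp only: es)
    then show ?thesis unfolding es using False by (cases e) (auto simp: x A.sec'_def)
  qed
qed (simp add: esw_def)

text \<open>The word labels a closed path in the Schreier graph and is thus conjugate to its section
  there. This section is \<open>sigma v\<close> followed by the sections of all edges but the last,
  that is by \<open>cE v\<close>; the correction inside \<open>sigma v\<close> cancels it and leaves
  the single generator \<open>sg v\<close>. The word is reversed because words act from the right
  end, whereas paths are read from the left.\<close>

lemma cj_adm: "adm f \<Longrightarrow> cj (gA (rev f)) gt"
proof -
  assume f: "adm f"
  define \<beta> where "\<beta> = 2 * enc f + 1"
  have \<beta>: "\<beta> mod 2 = 1" "\<beta> div 2 = enc f" by (simp_all add: \<beta>_def)
  have f': "adm (dec (\<beta> div 2))" using f \<beta> by simp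
  define es where "es = edges \<beta>"
  have e: "es = path \<beta> (length f) 0 (pt \<beta> 0) f" using \<beta> by (simp add: es_def edges_def)
  have ne: "es \<noteq> []" "snd (last es) = (pt \<beta> 0, False)" using edges_last[OF \<beta>(1) f'] by (simp_all add: es_def)
  define v where "v = fst (last es)"
  have l: "last es = (v, pt \<beta> 0, False)" using ne by (cases "last es") (simp add: v_def)
  then have "(v, pt \<beta> 0, False) \<in> set es" using ne(1) last_in_set by metis
  then have v: "blk v = \<beta>" "v < 0" using edges_blk by (auto simp: es_def)
  have cE: "cE v = rev (map (\<lambda>(u, w, e). (sg (if e then w else u), e)) (butlast es))"
    using f' \<beta>(1) by (simp add: cE_def Let_def v es_def[symmetric] l)
  have sig: "(if e then winv (sigma w) else sigma u) = [(sg (if e then w else u), e)]"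
    if "(u, w, e) \<in> set (butlast es)" for u w e
  proof -
    have "cE (if e then w else u) = []" using that cE_not_last[OF _ \<beta>(1) f'] by (simp add: es_def)
    moreover have "(if e then w else u) < 0" using in_set_butlastD[OF that] edges_blk by (auto simp: es_def)
    ultimately show ?thesis using cw_rk_sg_neg by (auto simp: sigma_def)
  qed
  have "esw (butlast es) = cE v"
  proof -
    have "concat (rev (map (\<lambda>(u, w, e). if e then winv (sigma w) else sigma u) xs)) =
      rev (map (\<lambda>(u, w, e). (sg (if e then w else u), e)) xs)" if "set xs \<subseteq> set (butlast es)" for xs
      using that by (induction xs) (auto simp: sig)
    then show ?thesis unfolding esw_def cE by blast
  qed
  moreover have "esw es = sigma v @ esw (butlast es)"
  proof -
    have "es = butlast es @ [(v, pt \<beta> 0, False)]" using append_butlast_last_id[OF ne(1)] l by simp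
    then have "esw es = esw (butlast es @ [(v, pt \<beta> 0, False)])" by (rule arg_cong)
    then show ?thesis by (simp add: esw_def)
  qed
  moreover have pw: "A.sw (rev f) (pt \<beta> 0) = esw es" "A.pw (rev f) (pt \<beta> 0) = pt \<beta> 0"
    using path_sw[of \<beta> "length f" 0 "pt \<beta> 0" f] edges_adm(3)[OF \<beta>(1) f'] f
    unfolding e[symmetric] es_def by (auto simp: adm_def)
  ultimately have "gC (A.sw (rev f) (pt \<beta> 0)) = gC [(sg v, False)]"
    using cw_rk_sg_neg[OF v(2)] gC_Cons[of "(sg v, False)" "winv (cE v) @ cE v"] by (simp add: sigma_def add.assoc)
  then have "gA (rev f) + gA (apow (pt \<beta> 0)) = gA (apow (pt \<beta> 0)) + gC [(sg v, False)]"
    using gA_trans[of "rev f" "pt \<beta> 0"] pw(2) by simp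
  then have "cj (gC [(sg v, False)]) (gA (rev f))"
    unfolding cj_def by (intro exI[of _ "gA (apow (pt \<beta> 0))"]) simp
  from cj_trans[OF cj_sym[OF this] cj_sg_gt[OF v(2)]] show ?thesis .
qed

lemma not_reduced: "\<not> reduced w \<Longrightarrow> \<exists>u g e v. w = u @ (g, e) # (g, \<not> e) # v"
proof (induction w)
  case (Cons x w)
  show ?case
  proof (cases "reduced w")
    case True
    then obtain y v where w: "w = y # v" "fst x = fst y" "snd x \<noteq> snd y"
      using Cons.prems by (cases w) (auto simp: reduced_def)
    then have "x # w = [] @ (fst x, snd x) # (fst x, \<not> snd x) # v" by (cases x; cases y) auto
    then show ?thesis by blast
  next
    case False
    then show ?thesis using Cons.IH by (metis append_Cons)
  qed
qed (simp add: reduced_def)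

lemma reduced_same:
  "reduced w \<Longrightarrow> \<forall>x\<in>set w. fst x = g \<Longrightarrow> \<exists>k e. w = replicate k (g, e)"
proof (induction w)
  case (Cons x w)
  then obtain k e where w: "w = replicate k (g, e)" by (auto simp: reduced_def successively_Cons)
  obtain s where x: "x = (g, s)" using Cons.prems(2) by (cases x) auto
  show ?case
  proof (cases k)
    case 0
    then show ?thesis using w x by (intro exI[of _ 1] exI[of _ s]) simp
  next
    case (Suc k')
    then have "s = e" using Cons.prems(1) w x by (simp add: reduced_def)
    then show ?thesis using w x by (intro exI[of _ "Suc k"] exI[of _ e]) simp
  qed
qed simp

lemma reduced_rev: "reduced (rev w) \<longleftrightarrow> reduced w"
  unfolding reduced_def successively_rev by (rule arg_cong2[of _ _ _ _ successively]) (auto simp: fun_eq_iff)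

lemma reduced_append: "reduced (u @ v) \<Longrightarrow> reduced u \<and> reduced v"
  by (auto simp: reduced_def successively_append_iff)

lemma mul_gA: "mul k (gA w) = gA (concat (replicate k w))"
  by (induction k) auto

abbreviation f0 :: "bool word" where
  "f0 \<equiv> [(False, False), (True, True), (False, False), (True, False)]"

text \<open>All positive powers of \<open>f0\<close> are admissible. So the word
  \<open>rev f0\<close> and its k-th power are both conjugate to \<open>t\<close>, and the first
  conjugacy may be raised to the k-th power.\<close>

lemma cj_mul_gt: "0 < k \<Longrightarrow> cj (mul k gt) gt"
proof -
  assume k: "0 < k"
  have f: "adm (concat (replicate (Suc j) f0))" for j
  proof (induction j)
    case (Suc j)
    then show ?case by (simp add: adm_def reduced_def)
  qed (simp add: adm_def reduced_def)
  have r: "rev (concat (replicate j f0)) = concat (replicate j (rev f0))" for j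
    by (simp add: rev_concat)
  have "cj (gA (concat (replicate k (rev f0)))) gt" using cj_adm[OF f[of "k - 1"]] k r[of k] by simp
  then have "cj (mul k (gA (rev f0))) gt" by (simp only: mul_gA)
  moreover have "cj (gA (rev f0)) gt" using cj_adm[OF f[of 0]] by simp
  then have "cj (mul k gt) (mul k (gA (rev f0)))" by (rule cj_mul[OF cj_sym])
  ultimately show ?thesis by (rule cj_trans[rotated])
qed

text \<open>The inverse of \<open>rev f0\<close> is, after a rotation, again the reversal of an
  admissible word.\<close>

lemma cj_minus_gt: "cj (- gt) gt"
proof -
  have "adm f0" by (simp add: adm_def reduced_def)
  then have "cj (gA (rev f0)) gt" by (rule cj_adm)
  then have "cj (- gt) (- gA (rev f0))" by (rule cj_minus[OF cj_sym])
  also have "- gA (rev f0) = gA [(False, True)] + gA [(True, False), (False, True), (True, True)]"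
    unfolding gA_simps[symmetric] by simp
  also have "cj \<dots> (gA [(True, False), (False, True), (True, True)] + gA [(False, True)])"
    by (rule cj_rotate)
  also have "\<dots> = gA (rev [(False, True), (True, True), (False, True), (True, False)])"
    unfolding gA_simps[symmetric] by simp
  also have "cj \<dots> gt" by (rule cj_adm) (simp add: adm_def reduced_def)
  finally show ?thesis .
qed

text \<open>Takes a shortest word of the first factor conjugate to the given one; a cancellation in
  one of its rotations would shorten it.\<close>

lemma cyc_min_word:
  obtains w' where "cj (gA w) (gA w')" "\<And>u v. w' = u @ v \<Longrightarrow> reduced (v @ u)"
proof -
  define Q where "Q n \<longleftrightarrow> (\<exists>w'. length w' = n \<and> cj (gA w) (gA w'))" for n
  have "Q (length w)" unfolding Q_def using cj_refl by blast
  then have "Q (LEAST n. Q n)" by (rule LeastI)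
  then obtain w' where w': "length w' = (LEAST n. Q n)" "cj (gA w) (gA w')" unfolding Q_def by blast
  have "reduced (v @ u)" if uv: "w' = u @ v" for u v
  proof (rule ccontr)
    assume "\<not> reduced (v @ u)"
    then obtain p g e q where vu: "v @ u = p @ (g, e) # (g, \<not> e) # q" using not_reduced by blast
    have "cj (gA w') (gA (v @ u))" using cj_rotate[of "gA u" "gA v"] uv by simp
    moreover have "gA (v @ u) = gA (p @ q)" unfolding vu by (rule gA_feq) (rule feq.cancel)
    ultimately have "cj (gA w) (gA (p @ q))" using cj_trans[OF w'(2)] by simp
    then have "Q (length (p @ q))" unfolding Q_def by blast
    then have "length w' \<le> length (p @ q)" unfolding w'(1) by (rule Least_le)
    moreover have "length w' = length (p @ q) + 2" using arg_cong[OF vu, of length] uv by simp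
    ultimately show False by simp
  qed
  with w'(2) show ?thesis by (rule that)
qed

text \<open>Rotate until the word ends in a letter \<open>a\<close> and starts with the run of
  \<open>t\<close>-letters that contains the given \<open>t\<close>. Reducedness gives this run a
  constant sign, so the first letter is \<open>t\<close> and the reversed word is
  admissible.\<close>

lemma cj_mixed:
  assumes r: "\<And>u v. w = u @ v \<Longrightarrow> reduced (v @ u)"
    and t: "(True, False) \<in> set w" and a: "\<exists>e. (False, e) \<in> set w"
  shows "cj (gA w) gt"
proof -
  obtain w1 w2 where w: "w = w1 @ (True, False) # w2" using split_list[OF t] by blast
  define v where "v = w2 @ w1"
  obtain e where "(False, e) \<in> set v" using a w by (auto simp: v_def)
  then have "\<exists>x\<in>set v. \<not> fst x" by force
  then obtain v1 x v2 where v: "v = v1 @ x # v2" "\<not> fst x" "\<forall>y\<in>set v2. fst y"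
    using split_list_last_prop[of v "\<lambda>x. \<not> fst x"] by blast
  have rot: "\<exists>p q. w = p @ q \<and> v2 @ (True, False) # v1 @ [x] = q @ p"
  proof -
    have "w2 @ w1 = v1 @ x # v2" using v(1) by (simp add: v_def)
    then obtain us where "w2 = v1 @ us \<and> us @ w1 = x # v2 \<or> w2 @ us = v1 \<and> w1 = us @ x # v2"
      unfolding append_eq_append_conv2 by blast
    then consider y where "w2 = v1 @ x # y" "v2 = y @ w1" | y where "v1 = w2 @ y" "w1 = y @ x # v2"
      by (cases us) auto
    then show ?thesis
    proof cases
      case (1 y)
      show ?thesis
        by (rule exI[of _ "w1 @ (True, False) # v1 @ [x]"], rule exI[of _ y]) (simp add: w 1)
    next
      case (2 y)
      show ?thesis
        by (rule exI[of _ "y @ [x]"], rule exI[of _ "v2 @ (True, False) # w2"]) (simp add: w 2)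
    qed
  qed
  then obtain p q where pq: "w = p @ q" "v2 @ (True, False) # v1 @ [x] = q @ p" by blast
  have red: "reduced (v2 @ (True, False) # v1 @ [x])" using r[OF pq(1)] pq(2) by simp
  have "reduced (v2 @ [(True, False)])" using reduced_append[of "v2 @ [(True, False)]"] red by simp
  moreover have "\<forall>y\<in>set (v2 @ [(True, False)]). fst y = True" using v(3) by simp
  ultimately have "\<exists>k e. v2 @ [(True, False)] = replicate k (True, e)" by (rule reduced_same)
  then obtain k e where k: "v2 @ [(True, False)] = replicate k (True, e)" by blast
  have eq: "y = (True, e)" if "y \<in> set (v2 @ [(True, False)])" for y
    using that in_set_replicate[of y k "(True, e)"] unfolding k by blast
  have "e = False" using eq[of "(True, False)"] by simp
  moreover have "v2 \<noteq> [] \<Longrightarrow> hd v2 = (True, e)" by (rule eq) simp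
  ultimately have "hd (v2 @ (True, False) # v1 @ [x]) = (True, False)" by (simp add: hd_append)
  then have "adm (rev (v2 @ (True, False) # v1 @ [x]))" unfolding adm_def reduced_rev
    using red v(2) by (simp add: last_rev hd_rev del: rev_append rev.simps)
  from cj_adm[OF this] have "cj (gA (v2 @ (True, False) # v1 @ [x])) gt" by (simp only: rev_rev_ident)
  moreover have "cj (gA w) (gA (v2 @ (True, False) # v1 @ [x]))"
    unfolding pq using cj_rotate[of "gA p" "gA q"] by simp
  ultimately show ?thesis by (rule cj_trans[rotated])
qed

lemma cj_gA: "gA w = 0 \<or> (\<exists>m. m \<noteq> 0 \<and> cj (gA w) (gA (apow m))) \<or> cj (gA w) gt"
proof -
  obtain w' where w': "cj (gA w) (gA w')" and r: "\<And>u v. w' = u @ v \<Longrightarrow> reduced (v @ u)"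
    by (rule cyc_min_word[of w]) blast
  have red: "reduced w'" using r[of "[]" w'] by simp
  have gt: "cj (gA w') gt \<Longrightarrow> ?thesis" using cj_trans[OF w'] by simp
  have B: "(\<exists>e. Q e) \<longleftrightarrow> Q True \<or> Q False" for Q by (metis (full_types))
  have F: "(\<forall>x\<in>set w'. fst x = g) \<or> (\<exists>e. ((\<not> g), e) \<in> set w')" for g
  proof (cases "\<forall>x\<in>set w'. fst x = g")
    case False
    then obtain x where x: "x \<in> set w'" "fst x \<noteq> g" by blast
    have "x = (\<not> g, snd x)" using x(2) by (auto simp: prod_eq_iff)
    with x(1) have "(\<not> g, snd x) \<in> set w'" by (simp only:)
    then show ?thesis by blast
  qed simp
  have "(\<forall>x\<in>set w'. fst x = False) \<or> (\<exists>e. (True, e) \<in> set w')"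
    "(\<forall>x\<in>set w'. fst x = True) \<or> (\<exists>e. (False, e) \<in> set w')" using F[of False] F[of True] by simp_all
  then consider "\<forall>x\<in>set w'. fst x = False" | "\<forall>x\<in>set w'. fst x = True"
    | "(True, False) \<in> set w'" "\<exists>e. (False, e) \<in> set w'"
    | "(True, True) \<in> set w'" "\<exists>e. (False, e) \<in> set w'"
    unfolding B[of "\<lambda>e. (True, e) \<in> set w'"] by argo
  then show ?thesis
  proof cases
    case 1
    from reduced_same[OF red this] obtain k e where k: "w' = replicate k (False, e)" by blast
    define m where "m = (if e then - int k else int k)"
    have "gA w' = gA (apow m)" unfolding k apow_def m_def by (cases "k = 0") auto
    then show ?thesis using w' by (cases "m = 0") auto
  next
    case 2
    from reduced_same[OF red this] obtain k e where k: "w' = replicate k (True, e)" by blast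
    show ?thesis
    proof (cases "k = 0")
      case False
      have m: "gA w' = mul k (gA [(True, e)])" unfolding k mul_gA by simp
      have "cj (gA w') gt"
      proof (cases e)
        case True
        have "cj (mul k (- gt)) (mul k gt)" using cj_minus_gt by (rule cj_mul)
        from cj_trans[OF this cj_mul_gt] show ?thesis using False m True by (simp add: gX_inv)
      qed (use cj_mul_gt False m in simp)
      then show ?thesis by (rule gt)
    qed (use w' k in simp)
  next
    case 3
    show ?thesis by (rule gt, rule cj_mixed[OF r 3]) simp
  next
    case 4
    have "reduced (v @ u)" if "winv w' = u @ v" for u v
    proof -
      have "w' = winv v @ winv u" using arg_cong[OF that, of winv] by simp
      then have "reduced (winv u @ winv v)" by (rule r)
      then have "reduced (rev (map (\<lambda>(g, e). (g, \<not> e)) (v @ u)))" by (simp add: winv_def)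
      then show ?thesis unfolding reduced_rev unfolding reduced_def successively_map
        by (rule successively_mono) auto
    qed
    moreover have "(True, False) \<in> set (winv w')" "\<exists>e. (False, e) \<in> set (winv w')"
      using 4 by (force simp: winv_def)+
    ultimately have "cj (gA (winv w')) gt" by (rule cj_mixed)
    from cj_minus[OF this] have "cj (gA w') (- gt)" by simp
    from cj_trans[OF this cj_minus_gt] show ?thesis by (rule gt)
  qed
qed

section \<open>Double cosets and cyclic words\<close>

text \<open>These words move 0 to 1, 2 and 6. They are chosen so that \<open>b\<close> times
  \<open>rw \<nu>\<close> is the transversal word of the point \<nu> + 3; this makes loops at 3 and
  at \<nu> + 3 differ by conjugation with \<open>rw \<nu>\<close>.\<close>

definition rw :: "nat \<Rightarrow> nat word" where
  "rw \<nu> = (if \<nu> = 1 then br 1 else if \<nu> = 2 then br 2 else [(0, True), (1, False)])"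

definition tt :: "int \<Rightarrow> grp" where
  "tt k = - gA (apow k) + gt + gA (apow k)"

lemma gA_tk_tt: "0 \<le> k \<Longrightarrow> gA (tk k) = tt k"
  using gA_Cons[of "(True, False)" "apow k"] by (simp add: tk_def tt_def add.assoc)

lemma pw_tk: "A.pw (tk k) n = tau (n + k) - tau k"
  by (simp add: tk_def pw_apow pw_winv_apow add.commute)

lemma bh_pt: "bh (prod_encode (l, m)) = winv (br (bp l False (edge_pt l m))) @ (l, False) # br (edge_pt l m)"
  by (simp add: bh_def)

text \<open>Transitivity of the common subgroup on the nonzero integers, by an element that in
  addition fixes the point 3 on the other side. The extra control lets such elements be moved across
  \<open>rw 3\<close> without leaving the common subgroup.\<close>

lemma C_move:
  assumes "n \<noteq> 0"
  obtains f where "A.pw (subst ah f) 1 = n" "B.pw (subst bh f) 3 = 3"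
proof (cases "n = 1")
  case True
  then show ?thesis using that[of "[]"] by simp
next
  case False
  obtain z where z: "tau z = z" "tau (z + 1) = z + n" "z < 0" "blk z mod 2 = 0" "\<bar>n\<bar> \<le> - z"
    using assms False by (rule tau_row)
  define k where "k = 1 + 2 * nat (- 1 - z)"
  have k: "sg z = prod_encode (Suc k, 0)" "1 \<le> k" "odd k" "\<bar>n\<bar> \<le> int k + 1"
    using z by (simp_all add: sg_def k_def)
  define s1 s2 where "s1 = prod_encode (Suc k, 1)" and "s2 = prod_encode (Suc k, 2)"
  have pos: "pos s1 = fil (Suc k) 0" "pos s2 = fil (Suc k) 1" "cw s1 = []" "cw s2 = []"
    using k by (auto simp: s1_def s2_def pos_def cw_def)
  have fil: "\<bar>n\<bar> \<le> fil (Suc k) y" for y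
    using k(4) le_prod_encode_1[of "Suc k" y] by (simp add: fil_def)
  have "cE z = []" using z(4) by (simp add: cE_def)
  then have "cw (sg z) = []" by (simp add: cw_rk_sg_neg z(3))
  then have A0: "A.pw (ah (sg z)) 1 = n"
    using z by (simp add: ah.simps[of "sg z"] pw_tk add.commute)
  have An: "A.pw (ah s1) n = n" "A.pw (ah s2) n = n"
    using fil[of 0] fil[of 1] by (simp_all add: ah.simps[of s1] ah.simps[of s2] pos pw_tk abs_le_iff)
  then have Ai: "A.pw (winv (ah s1)) n = n" using A.pw_winv(1)[of "ah s1" n] by simp
  \<comment> \<open>The generator \<open>sg z\<close> does the work on the integers;
    \<open>s1\<close> and \<open>s2\<close> fix \<open>n\<close>. On the other side they bring the
    point 3 back: from right to left it runs through 7 + 3k, 5, 8 + 3k and 3.\<close>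
  let ?f = "[(s1, True), (s2, False), (s1, True), (sg z, False)]"
  have "A.pw (subst ah ?f) 1 = n" using A0 An Ai by simp
  moreover have "B.pw (subst bh ?f) 3 = 3"
    using k(2) by (simp add: k(1) s1_def s2_def bh_pt edge_pt_def br_def replicate_unroll)
  ultimately show ?thesis by (rule that)
qed

lemma A_coset:
  assumes "A.pw x 0 \<noteq> 0"
  obtains f g where "gA x = gC f + ga + gC g"
proof -
  obtain f where f: "A.pw (subst ah f) 1 = A.pw x 0" using C_move[OF assms] by blast
  let ?v = "[(False, True)] @ winv (subst ah f) @ x"
  have "A.pw ?v 0 = 0" using A.pw_winv(1)[of "subst ah f" 1] f by simp
  then have "gA ?v = gC (A.sw ?v 0)" by (rule gA_stab)
  moreover have "gA ?v = - ga + (- gC f + gA x)"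
    using gA_Cons[of "(False, True)" "winv (subst ah f) @ x"] by (simp add: gX_inv)
  ultimately have "gC f + ga + gC (A.sw ?v 0) = gA x" by (simp add: add.assoc)
  from that[OF this[symmetric]] show ?thesis .
qed

lemma C_trans_6: "3 \<le> m \<Longrightarrow> \<exists>w. B.pw w 0 = 0 \<and> B.pw w 6 = m"
proof -
  have *: "B.pw ([(1, False)] @ br m @ [(1, False)]) 0 = 0 \<and> B.pw ([(1, False)] @ br m @ [(1, False)]) 6 = m"
    if "m = 3 \<or> m = 4 \<or> m = 5" for m
    using that by (elim disjE) (simp_all add: br_def replicate_unroll)
  assume m: "3 \<le> m"
  show ?thesis
  proof (cases "m < 6")
    case True
    then have "m = 3 \<or> m = 4 \<or> m = 5" using m by linarith
    from *[OF this] show ?thesis by blast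
  next
    case False
    define n j where "n = (m - 6) div 3" and "j = m mod 3"
    have j: "j < 3" by (simp add: j_def)
    have m: "m = 6 + 3 * n + j" using False unfolding n_def j_def by presburger
    let ?w = "[(Suc n, False), (0, True), (Suc n, False)]"
    have w: "B.pw ?w 0 = 0" "B.pw ?w (3 + j) = m" using j by (auto simp: m)
    have "3 + j = 3 \<or> 3 + j = 4 \<or> 3 + j = 5" using j by linarith
    from *[OF this] w show ?thesis
      by (intro exI[of _ "?w @ [(1, False)] @ br (3 + j) @ [(1, False)]"]) (simp only: B.pw_simps(3))
  qed
qed

lemma C_fix_12: "B.pw w 0 = 0 \<Longrightarrow> B.pw w 1 = 1 \<and> B.pw w 2 = 2"
  using pw_rot[of w 0] pw_rot[of w 1] by (simp add: rot_less_6)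

text \<open>The orbits of the common subgroup on the points 1, 2, and those from 3 on give the three
  representatives. The right factor is then corrected by an element \<open>f\<close> from
  \<open>C_move\<close>. It fixes the point that \<open>rw \<nu>\<close> sends to 0, namely 2, 1 or
  3, so it can be moved to the left of \<open>rw \<nu>\<close>. What stays on the right fixes 1 on
  the integers and can later pass an \<open>a\<close>.\<close>

lemma B_coset:
  assumes "B.pw y 0 \<noteq> 0"
  obtains \<nu> c d where "\<nu> \<in> {1, 2, 3}" "gB y = gC c + gB (rw \<nu>) + gC d" "A.pw (subst ah d) 1 = 1"
proof -
  define m where "m = B.pw y 0"
  have "\<exists>\<nu> w. \<nu> \<in> {1, 2, 3} \<and> B.pw w 0 = 0 \<and> B.pw w (B.pw (rw \<nu>) 0) = m"
  proof -
    consider "m = 1" | "m = 2" | "3 \<le> m" using assms unfolding m_def by linarith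
    then show ?thesis
    proof cases
      case 1
      then show ?thesis by (intro exI[of _ 1] exI[of _ "[]"]) (simp add: rw_def pw_br[of "Suc 0", simplified])
    next
      case 2
      then show ?thesis by (intro exI[of _ 2] exI[of _ "[]"]) (simp add: rw_def pw_br)
    next
      case 3
      then show ?thesis using C_trans_6[of m] by (intro exI[of _ 3]) (auto simp: rw_def)
    qed
  qed
  then obtain \<nu> w where \<nu>: "\<nu> \<in> {1, 2, 3}" and w: "B.pw w 0 = 0" "B.pw w (B.pw (rw \<nu>) 0) = m" by blast
  define c where "c = B.sw w 0"
  have c: "gB w = gC c" unfolding c_def by (rule gB_stab[OF w(1)])
  define d where "d = B.sw (winv (rw \<nu>) @ winv w @ y) 0"
  have "B.pw (winv w) m = B.pw (rw \<nu>) 0" using B.pw_winv(1)[of w] w(2) by metis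
  then have "B.pw (winv (rw \<nu>) @ winv w @ y) 0 = 0"
    using B.pw_winv(1)[of "rw \<nu>" 0] by (simp add: m_def)
  then have "gB (winv (rw \<nu>) @ winv w @ y) = gC d" unfolding d_def by (rule gB_stab)
  then have "- gB (rw \<nu>) + (- gC c + gB y) = gC d" using c by simp
  then have y: "gB y = gC c + (gB (rw \<nu>) + gC d)" by (metis add_minus_cancel)
  define n where "n = A.pw (subst ah d) 1"
  have "n \<noteq> 0" unfolding n_def using pw_subst_0(1)[of d 1] by simp
  then obtain f where f: "A.pw (subst ah f) 1 = n" "B.pw (subst bh f) 3 = 3" by (rule C_move)
  have d: "A.pw (subst ah (winv f @ d)) 1 = 1"
    using A.pw_winv(1)[of "subst ah f" 1] f(1) by (simp add: n_def)
  define p where "p = B.pw (winv (rw \<nu>)) 0"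
  have "B.pw (winv (rw 1)) 0 = 2" "B.pw (winv (rw 2)) 0 = 1" "B.pw (winv (rw 3)) 0 = 3"
    by (simp_all add: rw_def br_def replicate_unroll numeral_2_eq_2)
  then have "p \<in> {1, 2, 3}" using \<nu> unfolding p_def by (elim insertE emptyE) simp_all
  then have "B.pw (subst bh f) p = p" using f(2) C_fix_12[of "subst bh f"] B.pw_subst by auto
  then have "B.pw (rw \<nu> @ subst bh f @ winv (rw \<nu>)) 0 = 0"
    using B.pw_winv(2)[of "rw \<nu>" 0] by (simp add: p_def)
  from gB_stab[OF this] obtain c' where "gB (rw \<nu> @ subst bh f @ winv (rw \<nu>)) = gC c'" by blast
  then have c': "gC c' = gB (rw \<nu>) + (gC f + - gB (rw \<nu>))" by simp
  have "gB (rw \<nu>) + gC f = gC c' + gB (rw \<nu>)" unfolding c' by (simp add: add.assoc)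
  moreover have "gB y = gC c + ((gB (rw \<nu>) + gC f) + gC (winv f @ d))"
    unfolding y by (simp add: add.assoc)
  ultimately have "gB y = gC (c @ c') + gB (rw \<nu>) + gC (winv f @ d)"
    by (simp only: gC_simps add.assoc)
  with \<nu> show ?thesis using d by (rule that)
qed

lemma C_shift:
  assumes "A.pw (subst ah d) 1 = 1"
  obtains d' where "gC d + ga = ga + gC d'"
proof -
  let ?v = "[(False, True)] @ subst ah d @ [(False, False)]"
  have "A.pw ?v 0 = 0" using assms by simp
  then have "gA ?v = gC (A.sw ?v 0)" by (rule gA_stab)
  then have "- ga + (gC d + ga) = gC (A.sw ?v 0)"
    using gA_Cons[of "(False, True)" "subst ah d @ [(False, False)]"] by (simp add: gX_inv)
  then have "gC d + ga = ga + gC (A.sw ?v 0)" by (metis add_minus_cancel)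
  then show ?thesis by (rule that)
qed

text \<open>Only finitely many letters occur in \<open>y\<close>. The sum of their indices bounds
  each of them, and the first point of the block assigned to the next letter is fixed by
  \<open>y\<close>.\<close>

lemma gB_conj_gC: "\<exists>m c. - gB (br m) + gB y + gB (br m) = gC c"
proof -
  define N where "N = sum_list (map fst y)"
  have "bp l e (6 + 3 * N) = 6 + 3 * N" if "l \<le> N" for l e
    using that by (cases l) auto
  moreover have "\<forall>x\<in>set y. fst x \<le> N"
    unfolding N_def by (force intro!: member_le_sum_list)
  ultimately have "B.pw y (6 + 3 * N) = 6 + 3 * N" by (induction y) auto
  then have "B.pw (winv (br (6 + 3 * N)) @ y @ br (6 + 3 * N)) 0 = 0"
    using B.pw_winv(1)[of "br (6 + 3 * N)" 0] pw_br[of "6 + 3 * N"] by simp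
  from gB_stab[OF this] obtain c where "gB (winv (br (6 + 3 * N)) @ y @ br (6 + 3 * N)) = gC c" by blast
  then have "- gB (br (6 + 3 * N)) + gB y + gB (br (6 + 3 * N)) = gC c" by (simp add: add.assoc)
  then show ?thesis by blast
qed

lemma gB_conj: "\<exists>x. cj (gB y) (gA x)"
proof -
  obtain m c where "- gB (br m) + gB y + gB (br m) = gC c" using gB_conj_gC by blast
  then have "cj (gB y) (gA (subst ah c))" using cj_conj(2)[of "gB y" "gB (br m)"] by simp
  then show ?thesis by blast
qed

section \<open>Normalization of cyclic alternating products\<close>

definition plist :: "(bool word \<times> nat word) list \<Rightarrow> grp" where
  "plist ps = foldr (\<lambda>(x, y) g. gA x + (gB y + g)) ps 0"

lemma plist_simps [simp]:
  "plist [] = 0" "plist ((x, y) # ps) = gA x + (gB y + plist ps)" "plist (ps @ qs) = plist ps + plist qs"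
proof -
  show "plist [] = 0" "plist ((x, y) # ps) = gA x + (gB y + plist ps)" for x y ps by (simp_all add: plist_def)
  then show "plist (ps @ qs) = plist ps + plist qs" by (induction ps) (auto simp: add.assoc)
qed

lemma plist_surj: "\<exists>ps. g = plist ps"
proof -
  have "\<exists>ps. cls w = plist ps" for w
  proof (induction w)
    case Nil
    show ?case by (rule exI[of _ "[]"]) simp
  next
    case (Cons x w)
    then obtain ps where ps: "cls w = plist ps" by blast
    obtain l e where x: "x = (l, e)" by fastforce
    have "cls (x # w) = cls [x] + plist ps" using cls_simps(2)[of "[x]" w] ps by simp
    then have "cls (x # w) = plist ((if l = 0 then ([(False, e)], []) else ([], [(l - 1, e)])) # ps)"
      by (cases l) (simp_all add: x cls_letter)
    then show ?case by blast
  qed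
  then show ?thesis by (metis cls_surj)
qed

definition yl :: "nat word list \<Rightarrow> grp" where
  "yl ys = foldr (\<lambda>y g. ga + (gB y + g)) ys 0"

lemma yl_simps [simp]: "yl [] = 0" "yl (y # ys) = ga + (gB y + yl ys)" "yl (ys @ zs) = yl ys + yl zs"
proof -
  show "yl [] = 0" "yl (y # ys) = ga + (gB y + yl ys)" for y ys by (simp_all add: yl_def)
  then show "yl (ys @ zs) = yl ys + yl zs" by (induction ys) (auto simp: add.assoc)
qed

definition cl :: "(nat \<times> nat word) list \<Rightarrow> grp" where
  "cl cs = foldr (\<lambda>(\<nu>, c) g. ga + (gC c + (gB (rw \<nu>) + g))) cs 0"

lemma cl_simps [simp]: "cl [] = 0" "cl ((\<nu>, c) # cs) = ga + (gC c + (gB (rw \<nu>) + cl cs))"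
    "cl (cs @ ds) = cl cs + cl ds"
proof -
  show "cl [] = 0" "cl ((\<nu>, c) # cs) = ga + (gC c + (gB (rw \<nu>) + cl cs))" for \<nu> c cs by (simp_all add: cl_def)
  then show "cl (cs @ ds) = cl cs + cl ds" by (induction cs) (auto simp: add.assoc)
qed

definition g0 :: "nat list \<Rightarrow> grp" where
  "g0 \<nu>s = foldr (\<lambda>\<nu> g. ga + (gB (rw \<nu>) + g)) \<nu>s 0"

lemma g0_simps [simp]: "g0 [] = 0" "g0 (\<nu> # \<nu>s) = ga + (gB (rw \<nu>) + g0 \<nu>s)" "g0 (\<nu>s @ \<mu>s) = g0 \<nu>s + g0 \<mu>s"
proof -
  show "g0 [] = 0" "g0 (\<nu> # \<nu>s) = ga + (gB (rw \<nu>) + g0 \<nu>s)" for \<nu> \<nu>s by (simp_all add: g0_def)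
  then show "g0 (\<nu>s @ \<mu>s) = g0 \<nu>s + g0 \<mu>s" by (induction \<nu>s) (auto simp: add.assoc)
qed

text \<open>Takes a representation with as few pairs as possible, up to conjugacy. A syllable lying
  in the common subgroup can be rotated to the front and absorbed by its neighbours, which removes a
  pair or ends inside the first factor.\<close>

lemma min_pairs:
  "(\<exists>x. cj g (gA x)) \<or> (\<exists>ps. ps \<noteq> [] \<and> cj g (plist ps) \<and> (\<forall>(x, y)\<in>set ps. A.pw x 0 \<noteq> 0 \<and> B.pw y 0 \<noteq> 0))"
proof -
  define R where "R n \<longleftrightarrow> (n = 0 \<and> (\<exists>x. cj g (gA x))) \<or> (\<exists>ps. ps \<noteq> [] \<and> length ps = n \<and> cj g (plist ps))" for n
  obtain ps0 where "g = plist ps0" using plist_surj by blast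
  then have "R (length ps0)"
    unfolding R_def using cj_refl gA_simps(1) by (cases "ps0 = []") (simp, metis cj_refl gA_simps(1), metis cj_refl)
  then have RL: "R (LEAST n. R n)" by (rule LeastI)
  show ?thesis
  proof (cases "\<exists>x. cj g (gA x)")
    case False
    then obtain ps where ps: "ps \<noteq> []" "length ps = (LEAST n. R n)" "cj g (plist ps)"
      using RL unfolding R_def by blast
    have less: False if "cj g (plist qs)" "qs \<noteq> []" "length qs < length ps" for qs
    proof -
      have "R (length qs)" unfolding R_def using that by blast
      then show False using Least_le[of R "length qs"] ps(2) that(3) by simp
    qed
    have "A.pw x 0 \<noteq> 0 \<and> B.pw y 0 \<noteq> 0" if xy: "(x, y) \<in> set ps" for x y
    proof (rule ccontr)
      assume a: "\<not> ?thesis"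
      obtain ps1 ps2 where ps12: "ps = ps1 @ (x, y) # ps2" using split_list[OF xy] by blast
      define qs where "qs = ps2 @ ps1"
      have len: "length ps = Suc (length qs)" by (simp add: qs_def ps12)
      have e: "plist ps = plist ps1 + (gA x + (gB y + plist ps2))" by (simp add: ps12)
      have "cj (plist ps) ((gA x + (gB y + plist ps2)) + plist ps1)" unfolding e by (rule cj_rotate)
      also have "(gA x + (gB y + plist ps2)) + plist ps1 = gA x + (gB y + plist qs)"
        by (simp add: qs_def add.assoc)
      finally have g: "cj g (gA x + (gB y + plist qs))" by (rule cj_trans[OF ps(3)])
      show False
      proof (cases "A.pw x 0 = 0")
        case True
        obtain c where c: "gA x = gC c" using gA_stab[OF True] by blast
        show False
        proof (cases qs rule: rev_cases)
          case Nil
          then have "cj g (gB (subst bh c @ y))" using g c by simp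
          moreover obtain x' where "cj (gB (subst bh c @ y)) (gA x')" using gB_conj by blast
          ultimately have "cj g (gA x')" by (rule cj_trans)
          then show False using False by blast
        next
          case (snoc qs' z)
          obtain x' y' where z: "z = (x', y')" by fastforce
          have "cj g ((gC c + gB y + plist qs') + (gA x' + gB y'))"
            using g by (simp add: snoc z c add.assoc)
          from cj_trans[OF this cj_rotate] have "cj g ((gA x' + gB y') + (gC c + gB y + plist qs'))" .
          also have "(gA x' + gB y') + (gC c + gB y + plist qs') = plist ((x', y' @ subst bh c @ y) # qs')"
            by (simp add: add.assoc)
          finally show False by (rule less) (simp_all add: len snoc)
        qed
      next
        case nx: False
        then have "B.pw y 0 = 0" using a by blast
        from gB_stab[OF this] obtain c where c: "gB y = gC c" by blast
        show False
        proof (cases qs)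
          case Nil
          then have "cj g (gA (x @ subst ah c))" using g c by simp
          then show False using False by blast
        next
          case (Cons z qs')
          obtain x' y' where z: "z = (x', y')" by fastforce
          have "gA x + (gB y + plist qs) = plist ((x @ subst ah c @ x', y') # qs')"
            by (simp add: Cons z c add.assoc)
          then show False using g by (intro less[of "(x @ subst ah c @ x', y') # qs'"]) (simp_all add: len Cons)
        qed
      qed
    qed
    then show ?thesis using ps by blast
  qed simp
qed

lemma plist_yl:
  "\<forall>(x, y)\<in>set ps. A.pw x 0 \<noteq> 0 \<and> B.pw y 0 \<noteq> 0 \<Longrightarrow>
    \<exists>f ys. plist ps = gC f + yl ys \<and> length ys = length ps \<and> (\<forall>y\<in>set ys. B.pw y 0 \<noteq> 0)"
proof (induction ps)
  case Nil
  show ?case by (rule exI[of _ "[]"], rule exI[of _ "[]"]) simp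
next
  case (Cons p ps)
  obtain x y where p: "p = (x, y)" by fastforce
  obtain f ys where IH: "plist ps = gC f + yl ys" "length ys = length ps" "\<forall>y\<in>set ys. B.pw y 0 \<noteq> 0"
    using Cons by auto
  have x: "A.pw x 0 \<noteq> 0" and y: "B.pw y 0 \<noteq> 0" using Cons.prems by (auto simp: p)
  obtain f' g where fg: "gA x = gC f' + ga + gC g" using x by (rule A_coset)
  define y' where "y' = subst bh g @ y @ subst bh f"
  have "B.pw y' 0 \<noteq> 0"
    using y B.pw_subst by (simp add: y'_def pw_subst_0)
  moreover have "plist (p # ps) = gC f' + yl (y' # ys)" by (simp add: p fg IH(1) y'_def add.assoc)
  ultimately show ?case using IH by (intro exI[of _ f'] exI[of _ "y' # ys"]) simp
qed

text \<open>Factors from the common subgroup are pushed to the right. The remainder \<open>d\<close>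
  always fixes 1 on the integers, so it passes the next \<open>a\<close> by \<open>C_shift\<close>
  and is absorbed into the following syllable.\<close>

lemma yl_cl:
  "\<forall>y\<in>set ys. B.pw y 0 \<noteq> 0 \<Longrightarrow>
    \<exists>cs d. yl ys = cl cs + gC d \<and> length cs = length ys \<and> fst ` set cs \<subseteq> {1, 2, 3} \<and> A.pw (subst ah d) 1 = 1"
proof (induction ys rule: rev_induct)
  case Nil
  show ?case by (rule exI[of _ "[]"], rule exI[of _ "[]"]) simp
next
  case (snoc y ys)
  then obtain cs d where IH: "yl ys = cl cs + gC d" "length cs = length ys" "fst ` set cs \<subseteq> {1, 2, 3}"
    "A.pw (subst ah d) 1 = 1" by auto
  obtain d' where d': "gC d + ga = ga + gC d'" using IH(4) by (rule C_shift)
  have "B.pw (subst bh d' @ y) 0 \<noteq> 0" using snoc.prems by (simp add: pw_subst_0)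
  then obtain \<nu> c e where \<nu>: "\<nu> \<in> {1, 2, 3}" and y: "gB (subst bh d' @ y) = gC c + gB (rw \<nu>) + gC e"
    and e: "A.pw (subst ah e) 1 = 1" by (rule B_coset)
  have "yl (ys @ [y]) = cl cs + ((gC d + ga) + gB y)" by (simp add: IH(1) add.assoc)
  also have "\<dots> = cl cs + (ga + gB (subst bh d' @ y))" by (simp add: d' add.assoc)
  also have "\<dots> = cl (cs @ [(\<nu>, c)]) + gC e" unfolding y by (simp add: add.assoc)
  finally show ?case using IH \<nu> e by (intro exI[of _ "cs @ [(\<nu>, c)]"] exI[of _ e]) simp
qed

lemma rw_loop:
  assumes "\<nu> \<in> {1, 2, 3}"
  shows "gB (br (\<nu> + 3)) = gb + gB (rw \<nu>)"
proof -
  have "gB (br (1 + 3)) = gb + gB (rw 1)" "gB (br (2 + 3)) = gb + gB (rw 2)" "gB (br (3 + 3)) = gb + gB (rw 3)"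
    using gB_Cons[of "(0, False)" "br 1"] gB_Cons[of "(0, False)" "br 2"] gB_Cons[of "(0, True)" "[(1, False)]"]
    by (simp_all add: rw_def br_def replicate_unroll gX_inv numeral_2_eq_2)
  then show ?thesis using assms by (elim insertE emptyE) simp_all
qed

lemma nu_123: "nu i \<in> {1, 2, 3}"
proof -
  have "fst (item i) mod 3 < 3" by simp
  then show ?thesis unfolding nu_def by (simp; linarith)
qed

text \<open>Two generators with the odd label 3 + 2i, the loops at 3 and at \<open>nu i\<close> + 3,
  are conjugate by \<open>rw (nu i)\<close>. The matching makes the first equal to
  \<open>tt (3i + 2)\<close> times the word stored in \<open>item i\<close>, and the second equal to
  \<open>tt\<close> at position 3 \<open>nxt i\<close> + 1. Passing an \<open>a\<close> shifts the
  position 3i + 2 to 3i + 1.\<close>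

lemma tt_step:
  "tt (int (3 * i + 1)) + (ga + (gC (snd (item i)) + gB (rw (nu i)))) =
    ga + (gB (rw (nu i)) + tt (int (3 * nxt i + 1)))"
proof -
  define l where "l = 3 + 2 * i"
  define \<nu> where "\<nu> = nu i"
  have l: "l mod 2 = 1" "(l - 3) div 2 = i" "3 \<le> l" unfolding l_def by presburger+
  have \<nu>: "\<nu> \<in> {1, 2, 3}" "\<nu> \<noteq> 0" unfolding \<nu>_def using nu_123[of i] by auto
  have "bp l False 3 = 3" "bp l False (\<nu> + 3) = \<nu> + 3" using l(3) \<nu>(1) by (cases l; auto)+
  then have 0: "gC [(prod_encode (l, 0), False)] = - gb + gB [(l, False)] + gb"
    and 1: "gC [(prod_encode (l, \<nu>), False)] = - (gb + gB (rw \<nu>)) + gB [(l, False)] + (gb + gB (rw \<nu>))"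
    using gC_loop[of l 0] gC_loop[of l \<nu>] l(3) rw_loop[OF \<nu>(1)] by (simp_all add: gb_powers)
  have "swp \<nu> \<nu> = 1" by (simp add: swp_def)
  then have p: "pos (prod_encode (l, 0)) = int (3 * i + 2)" "pos (prod_encode (l, \<nu>)) = int (3 * nxt i + 1)"
    using l \<nu> by (simp_all add: pos_def Let_def \<nu>_def)
  have c: "cw (prod_encode (l, 0)) = snd (item i)" "cw (prod_encode (l, \<nu>)) = []"
    using l \<nu> by (simp_all add: cw_def)
  have 2: "gC [(prod_encode (l, 0), False)] = tt (int (3 * i + 2)) + gC (snd (item i))"
    using gA_ah[of "prod_encode (l, 0)"] gA_tk_tt[of "int (3 * i + 2)"]
    by (simp add: ah.simps[of "prod_encode (l, 0)"] p c)
  have 3: "gC [(prod_encode (l, \<nu>), False)] = tt (int (3 * nxt i + 1))"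
    using gA_ah[of "prod_encode (l, \<nu>)"] gA_tk_tt[of "int (3 * nxt i + 1)"]
    by (simp add: ah.simps[of "prod_encode (l, \<nu>)"] p c)
  have "gA (apow (int (3 * i + 2))) = gA (apow (int (3 * i + 1))) + ga"
  proof -
    have "nat \<bar>int (3 * i + 2)\<bar> = nat \<bar>int (3 * i + 1)\<bar> + 1" by simp
    then have "apow (int (3 * i + 2)) = apow (int (3 * i + 1)) @ [(False, False)]"
      unfolding apow_def by (simp only: replicate_add) simp
    then show ?thesis by simp
  qed
  then have 4: "ga + tt (int (3 * i + 2)) = tt (int (3 * i + 1)) + ga"
    by (simp add: tt_def grp_simps del: add_uminus_conv_diff)
  have "gB (rw \<nu>) + tt (int (3 * nxt i + 1)) = (- gb + gB [(l, False)] + gb) + gB (rw \<nu>)"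
    unfolding 3[symmetric] 1 by (simp add: grp_simps del: add_uminus_conv_diff)
  also have "\<dots> = tt (int (3 * i + 2)) + (gC (snd (item i)) + gB (rw \<nu>))"
    unfolding 0[symmetric] 2 by (simp add: add.assoc)
  finally show ?thesis using 4 unfolding \<nu>_def by (metis add.assoc)
qed

text \<open>The steps \<open>tt_step\<close> telescope around the cycle: each one erases the word
  \<open>c\<close> of its syllable and hands a conjugate of \<open>t\<close> to the next syllable.
  After a full turn that conjugate is the one at the start, which therefore conjugates one product
  into the other.\<close>

lemma cl_g0:
  assumes "fst ` set cs \<subseteq> {1, 2, 3}" "cs \<noteq> []"
  shows "cj (cl cs) (g0 (map fst cs))"
proof -
  define r where "r = enc (map (\<lambda>(\<nu>, c). (\<nu> - 1, c)) cs)"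
  have dat: "dat r = map (\<lambda>(\<nu>, c). (\<nu> - 1, c)) cs" by (simp add: dat_def r_def)
  define i where "i j = prod_encode (r, j)" for j
  define T where "T j = tt (int (3 * i (if j = length cs then 0 else j) + 1))" for j
  have st: "T j + (ga + (gC (snd (cs ! j)) + gB (rw (fst (cs ! j))))) = ga + (gB (rw (fst (cs ! j))) + T (Suc j))"
    if j: "j < length cs" for j
  proof -
    have "j < length (dat r)" using j by (simp add: dat)
    then have "item (i j) = dat r ! j" by (simp add: item_def i_def Cons_nth_drop_Suc[symmetric])
    then have it: "item (i j) = (fst (cs ! j) - 1, snd (cs ! j))"
      using j by (simp add: dat case_prod_unfold)
    have "fst (cs ! j) \<in> {1, 2, 3}" using assms(1) j by (meson image_subset_iff nth_mem)
    then have "nu (i j) = fst (cs ! j)" unfolding nu_def it by auto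
    moreover have "nxt (i j) = i (if Suc j = length cs then 0 else Suc j)"
      using j by (simp add: nxt_def i_def dat)
    moreover have "T j = tt (int (3 * i j + 1))" using j by (simp add: T_def)
    ultimately show ?thesis using tt_step[of "i j"] it by (simp add: T_def)
  qed
  have "j \<le> length cs \<Longrightarrow> T j + cl (drop j cs) = g0 (map fst (drop j cs)) + T (length cs)" for j
  proof (induction j rule: inc_induct)
    case (step j)
    have d: "drop j cs = cs ! j # drop (Suc j) cs" using step(2) by (simp add: Cons_nth_drop_Suc)
    obtain \<nu> c where nc: "cs ! j = (\<nu>, c)" by fastforce
    have "T j + cl (drop j cs) = (T j + (ga + (gC c + gB (rw \<nu>)))) + cl (drop (Suc j) cs)"
      unfolding d nc by (simp add: add.assoc)
    also have "\<dots> = ga + (gB (rw \<nu>) + (T (Suc j) + cl (drop (Suc j) cs)))"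
      using st[of j] step nc by (simp add: add.assoc)
    also have "\<dots> = g0 (map fst (drop j cs)) + T (length cs)"
      unfolding step.IH d nc by (simp add: add.assoc)
    finally show ?case .
  qed simp
  from this[of 0] have "T 0 + cl cs = g0 (map fst cs) + T (length cs)" by simp
  moreover have "T (length cs) = T 0" using assms(2) by (simp add: T_def)
  ultimately show ?thesis unfolding cj_def by (intro exI[of _ "T 0"]) simp
qed

text \<open>After normalization a single factor from the common subgroup is left at the end. It is
  rotated to the front, passes the first \<open>a\<close> and joins the first syllable, so that
  \<open>cl_g0\<close> applies.\<close>

lemma cj_cases:
  obtains "g = 0" | m where "m \<noteq> 0" "cj g (gA (apow m))" | "cj g gt"
    | \<nu>s where "\<nu>s \<noteq> []" "set \<nu>s \<subseteq> {1, 2, 3}" "cj g (g0 \<nu>s)"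
proof -
  from min_pairs[of g] show ?thesis
  proof (elim disjE exE conjE)
    fix x assume x: "cj g (gA x)"
    from cj_gA[of x] show ?thesis
    proof (elim disjE exE conjE)
      assume "gA x = 0"
      then show ?thesis using x that(1) by simp
    qed (use x cj_trans that in metis)+
  next
    fix ps assume ps: "ps \<noteq> []" "cj g (plist ps)" "\<forall>(x, y)\<in>set ps. A.pw x 0 \<noteq> 0 \<and> B.pw y 0 \<noteq> 0"
    obtain f ys where ys: "plist ps = gC f + yl ys" "length ys = length ps" "\<forall>y\<in>set ys. B.pw y 0 \<noteq> 0"
      using plist_yl[OF ps(3)] by blast
    have "ys \<noteq> []" using ys(2) ps(1) by auto
    then obtain zs z where z: "ys = zs @ [z]" by (metis rev_exhaust)
    have "cj g (yl ys + gC f)" using cj_trans[OF ps(2)] cj_rotate[of "gC f" "yl ys"] by (simp add: ys(1))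
    also have "yl ys + gC f = yl (zs @ [z @ subst bh f])" by (simp add: z add.assoc)
    finally have g: "cj g (yl (zs @ [z @ subst bh f]))" .
    have "\<forall>y\<in>set (zs @ [z @ subst bh f]). B.pw y 0 \<noteq> 0" using ys(3) B.pw_subst by (simp add: z)
    from yl_cl[OF this] obtain cs d where cs: "yl (zs @ [z @ subst bh f]) = cl cs + gC d"
      "length cs = Suc (length zs)" "fst ` set cs \<subseteq> {1, 2, 3}" "A.pw (subst ah d) 1 = 1" by auto
    obtain d' where d': "gC d + ga = ga + gC d'" using cs(4) by (rule C_shift)
    obtain \<nu> c cs' where c: "cs = (\<nu>, c) # cs'" using cs(2) by (cases cs) auto
    have "cj g (gC d + cl cs)" using cj_trans[OF g] cj_rotate[of "cl cs" "gC d"] by (simp only: cs(1))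
    also have "gC d + cl cs = (gC d + ga) + (gC c + (gB (rw \<nu>) + cl cs'))" by (simp add: c add.assoc)
    also have "\<dots> = cl ((\<nu>, d' @ c) # cs')" unfolding d' by (simp add: add.assoc)
    also have "cj \<dots> (g0 (map fst ((\<nu>, d' @ c) # cs')))" by (rule cl_g0) (use cs(3) c in auto)
    also have "map fst ((\<nu>, d' @ c) # cs') = map fst cs" by (simp add: c)
    finally show ?thesis using that(4)[of "map fst cs"] cs(3) c by auto
  qed
qed

section \<open>Separating the conjugacy classes\<close>

lemma aA_e0: "aA w e0 = jnA (A.pw w 0, NB)"
  by (simp add: aA_def spA_def)

lemma gA_apow_nz: "m \<noteq> 0 \<Longrightarrow> gA (apow m) \<noteq> 0"
proof
  assume m: "m \<noteq> 0" and "gA (apow m) = 0"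
  then have "act (gA (apow m)) e0 = act 0 e0" by simp
  then show False using m by (simp add: aA_e0 pw_apow)
qed

lemma gt_nz: "gt \<noteq> 0"
proof
  assume "gt = 0"
  obtain z where z: "tau z = z" "tau (z + 1) = z + 2" "z < 0" "\<bar>2\<bar> \<le> - z"
    using tau_row[of 2] by auto
  define e :: pt where "e = (CA (z + 1) NB, NB)"
  have "act gt e = act 0 e" using \<open>gt = 0\<close> by simp
  moreover have "wfE e" using z by (simp add: e_def wfE_def)
  ultimately show False using z by (simp add: e_def aA_def spA_def split: if_splits)
qed

text \<open>\<open>t\<close> fixes a coset, while a nontrivial power of \<open>a\<close> fixes none,
  as it shifts the first coordinate of every coset.\<close>

lemma not_cj_gt_apow: "m \<noteq> 0 \<Longrightarrow> \<not> cj gt (gA (apow m))"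
proof
  assume m: "m \<noteq> 0" and "cj gt (gA (apow m))"
  then obtain x where x: "x + gt = gA (apow m) + x" unfolding cj_def by blast
  define e where "e = act x e0"
  have "act (x + gt) e0 = act (gA (apow m) + x) e0" by (simp only: x)
  then have "spA e = spA (aA (apow m) e)" by (simp add: e_def aA_e0)
  then show False using m by (simp add: aA_def pw_apow del: jnA.simps split: prod.splits)
qed

lemma tau_far: "\<exists>N K. \<forall>n\<ge>N. A.pw w n = n + K"
proof (induction w)
  case Nil
  show ?case by (rule exI[of _ 0], rule exI[of _ 0]) simp
next
  case (Cons x w)
  then obtain N K where NK: "\<forall>n\<ge>N. A.pw w n = n + K" by blast
  obtain g e where x: "x = (g, e)" by fastforce
  have taui: "taui v = v" if "0 \<le> v" for v using tau_taui(2)[of v] that by simp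
  define K' where "K' = (if g then K else if e then K - 1 else K + 1)"
  have "A.pw (x # w) n = n + K'" if "n \<ge> max N (- K)" for n
    using NK that taui[of "n + K"] by (cases g; cases e) (auto simp: x K'_def)
  then show ?case by blast
qed

text \<open>A conjugating element of the first factor acts on large integers as a translation and so
  commutes with shifts there. Any other one sends the cosets of the first factor to cosets with a
  common front exponent, which no nonzero shift preserves.\<close>

lemma cj_apow: "cj (gA (apow m)) (gA (apow m')) \<Longrightarrow> m = m'"
proof -
  assume "cj (gA (apow m)) (gA (apow m'))"
  then obtain x where x: "x + gA (apow m) = gA (apow m') + x" unfolding cj_def by blast
  show ?thesis
  proof (cases "\<exists>w. x = gA w")
    case True
    then obtain w where w: "x = gA w" by blast
    obtain N K where NK: "\<forall>n\<ge>N. A.pw w n = n + K" using tau_far by blast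
    define n where "n = max N (N - m)"
    have e: "spA (aA v (jnA (k, NB))) = (A.pw v k, NB)" for v k
      by (simp add: aA_def del: jnA.simps)
    have wf: "wfE (jnA (n, NB))" by (simp del: jnA.simps)
    have "act (gA w + gA (apow m)) (jnA (n, NB)) = act (gA (apow m') + gA w) (jnA (n, NB))"
      using x w by simp
    then have "spA (aA (w @ apow m) (jnA (n, NB))) = spA (aA (apow m' @ w) (jnA (n, NB)))"
      using wf by (simp only: aA_append act_plus act_gA wf_aA)
    then have "A.pw w (m + n) = m' + A.pw w n" by (simp only: e A.pw_simps pw_apow prod.inject)
    moreover have "m + n \<ge> N" "n \<ge> N" by (auto simp: n_def)
    ultimately show ?thesis using NK by simp
  next
    case False
    obtain n where n: "\<And>v. fst (spA (act (x + gA v) e0)) = n" using front_gA[OF False] by blast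
    have "n = fst (spA (act (x + gA (apow m)) e0))" using n by simp
    also have "\<dots> = fst (spA (aA (apow m') (act (x + gA []) e0)))" by (simp add: x)
    also have "\<dots> = m' + n" using n[of "[]"] by (simp add: aA_def pw_apow case_prod_unfold del: jnA.simps)
    finally have "m' = 0" by simp
    then have "gA (apow m) = 0" using x add_left_imp_eq[of x "gA (apow m)" 0] by simp
    then show ?thesis using gA_apow_nz[of m] \<open>m' = 0\<close> by (cases "m = 0") simp_all
  qed
qed

definition ch :: "nat \<Rightarrow> int" where
  "ch \<nu> = (if \<nu> = 1 then 1 else if \<nu> = 2 then - 1 else 0)"

lemma rw_pt: "B.pw (rw \<nu>) 0 \<noteq> 0" "chi (B.pw (rw \<nu>) 0) = ch \<nu>"
  using pw_br[of 1] pw_br[of 2] by (auto simp: rw_def chi_def ch_def)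

lemma act_rw:
  assumes "wfE e" "snd e = NB"
  shows "pat (act (gB (rw \<nu>)) e) = ch \<nu> # pat e \<and> fst (act (gB (rw \<nu>)) e) = NA"
  using assms rw_pt[of \<nu>] by (simp add: aB_def spB_def pat_def)

lemma act_apow_front:
  assumes "wfE e" "fst e = NA" "m \<noteq> 0"
  shows "pat (act (gA (apow m)) e) = pat e \<and> snd (act (gA (apow m)) e) = NB"
  using assms by (simp add: aA_def spA_def pat_def pw_apow)

lemma apow_1: "apow 1 = [(False, False)]"
  by (simp add: apow_def)

lemma act_g0:
  "wfE e \<Longrightarrow> snd e = NB \<Longrightarrow> pat (act (g0 \<nu>s) e) = map ch \<nu>s @ pat e \<and> snd (act (g0 \<nu>s) e) = NB"
proof (induction \<nu>s)
  case (Cons \<nu> \<nu>s)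
  define e1 where "e1 = act (g0 \<nu>s) e"
  define e2 where "e2 = act (gB (rw \<nu>)) e1"
  have "wfE e1" "wfE e2" using Cons.prems by (simp_all add: e1_def e2_def wf_aB)
  moreover have "act (g0 (\<nu> # \<nu>s)) e = act (gA (apow 1)) e2"
    using Cons.prems by (simp add: e1_def e2_def apow_1 wf_aB)
  ultimately show ?case
    using Cons.IH[OF Cons.prems] act_rw[of e1 \<nu>] act_apow_front[of e2 1]
    by (simp add: e1_def[symmetric] e2_def[symmetric] del: act_gB act_gA)
qed simp

lemma P_g0: "P (g0 \<nu>s) = map ch \<nu>s"
  using act_g0[of e0 \<nu>s] by (simp add: P_def) (simp add: pat_def)

lemma mul_g0: "mul n (g0 \<nu>s) = g0 (concat (replicate n \<nu>s))"
  by (induction n) auto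

lemma tri_length: "tri p q r \<Longrightarrow> length r \<le> length p + length q + 1"
  "tri p q r \<Longrightarrow> length p \<le> length r + length q + 1" "tri p q r \<Longrightarrow> length q \<le> length r + length p + 1"
  by (auto simp: tri_def)

lemma length_concat_replicate: "length (concat (replicate n xs)) = n * length xs"
  by (induction n) auto

lemma nth_concat_replicate: "i < n * length xs \<Longrightarrow> concat (replicate n xs) ! i = xs ! (i mod length xs)"
proof (induction n arbitrary: i)
  case (Suc n)
  then show ?case
    by (cases "i < length xs") (auto simp: nth_append le_mod_geq)
qed simp

text \<open>Under conjugation, powers of an element of the first factor keep patterns of bounded
  length, whereas the patterns of the powers of \<open>g0 \<nu>s\<close> grow linearly.\<close>

lemma not_cj_g0_gA: "\<nu>s \<noteq> [] \<Longrightarrow> \<not> cj (g0 \<nu>s) (gA w)"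
proof
  assume \<nu>s: "\<nu>s \<noteq> []" and "cj (g0 \<nu>s) (gA w)"
  then obtain x where x: "cj (g0 \<nu>s) (gA w)" by blast
  obtain x where x: "x + g0 \<nu>s = gA w + x" using x unfolding cj_def by blast
  have x: "x + mul n (g0 \<nu>s) = mul n (gA w) + x" for n
  proof (induction n)
    case (Suc n)
    have "x + mul (Suc n) (g0 \<nu>s) = (x + g0 \<nu>s) + mul n (g0 \<nu>s)" by (simp add: add.assoc)
    also have "\<dots> = gA w + (x + mul n (g0 \<nu>s))" by (simp add: x add.assoc)
    finally show ?case by (simp add: Suc add.assoc)
  qed simp
  define n where "n = 2 * length (P x) + 2"
  have "P (x + mul n (g0 \<nu>s)) = P x" unfolding x by (simp add: mul_gA)
  then have "length (P (mul n (g0 \<nu>s))) \<le> 2 * length (P x) + 1"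
    using tri_length(3)[OF tri_P[of x "mul n (g0 \<nu>s)"]] by simp
  moreover have "length (P (mul n (g0 \<nu>s))) = n * length \<nu>s"
    by (simp add: mul_g0 P_g0 length_concat_replicate)
  moreover have "n * 1 \<le> n * length \<nu>s" using \<nu>s by (intro mult_le_mono) (auto simp: Suc_le_eq)
  ultimately show False by (simp add: n_def)
qed

text \<open>Away from bounded pieces at the ends, \<open>R\<close> reads both a power of
  \<open>q\<close> and a shifted power of \<open>p\<close>. Comparing lengths for large n gives
  equal periods, and a window of one period then exhibits the rotation.\<close>

lemma rotation_of_tri:
  assumes tri: "\<And>n. \<exists>R. tri u (concat (replicate n p)) R \<and> tri (concat (replicate n q)) u R"
    and ne: "p \<noteq> []" "q \<noteq> []"
  shows "\<exists>k. q = rotate k p"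
proof -
  define L where "L = length u"
  have len: "n * length p \<le> n * length q + 2 * L + 2 \<and> n * length q \<le> n * length p + 2 * L + 2" for n
  proof -
    obtain R where "tri u (concat (replicate n p)) R" "tri (concat (replicate n q)) u R" using tri by blast
    then show ?thesis
      using tri_length[of u "concat (replicate n p)" R] tri_length[of "concat (replicate n q)" u R]
      by (simp add: length_concat_replicate L_def)
  qed
  have "length p = length q"
  proof (rule ccontr)
    assume "length p \<noteq> length q"
    then consider "length p + 1 \<le> length q" | "length q + 1 \<le> length p" by linarith
    then show False
    proof cases
      case 1
      then have "(2 * L + 3) * (length p + 1) \<le> (2 * L + 3) * length q" by (intro mult_le_mono) auto
      then show False using len[of "2 * L + 3"] by (simp add: algebra_simps)
    next
      case 2
      then have "(2 * L + 3) * (length q + 1) \<le> (2 * L + 3) * length p" by (intro mult_le_mono) auto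
      then show False using len[of "2 * L + 3"] by (simp add: algebra_simps)
    qed
  qed
  define l where "l = length p"
  have l: "length p = l" "length q = l" "0 < l" using \<open>length p = length q\<close> ne by (auto simp: l_def)
  \<comment> \<open>Large enough for the window below, a full period with L + 1 entries to spare at
    both ends, where the triangles may disturb the periods.\<close>
  define n where "n = 2 * L + 5"
  obtain R where R: "tri u (concat (replicate n p)) R" "tri (concat (replicate n q)) u R" using tri by blast
  obtain \<alpha> \<beta> \<gamma> m1 m2 m3 where 1: "u = \<alpha> @ m1 @ \<beta>" "concat (replicate n p) = rn \<beta> @ m2 @ \<gamma>" "R = \<alpha> @ m3 @ \<gamma>"
    "length m2 \<le> 1" "length m3 \<le> 1" using R(1) unfolding tri_def by blast
  obtain \<alpha>' \<beta>' \<gamma>' m1' m2' m3' where 2: "concat (replicate n q) = \<alpha>' @ m1' @ \<beta>'" "u = rn \<beta>' @ m2' @ \<gamma>'"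
    "R = \<alpha>' @ m3' @ \<gamma>'" "length m1' \<le> 1" using R(2) unfolding tri_def by blast
  define c where "c = length \<beta> + length m2" 
  define d where "d = length \<alpha> + length m3"
  have d: "d \<le> L + 1" and c: "c \<le> L + 1" using 1 by (simp_all add: d_def c_def L_def)
  have \<beta>': "length \<beta>' \<le> L" using 2 by (simp add: L_def)
  have \<alpha>': "n * l = length \<alpha>' + length m1' + length \<beta>'"
    using arg_cong[OF 2(1), of length] by (simp add: length_concat_replicate l)
  have \<gamma>: "n * l = c + length \<gamma>"
    using arg_cong[OF 1(2), of length] by (simp add: length_concat_replicate l c_def)
  have nl: "(L + 1) * l + l + (L + 1) \<le> n * l"
  proof -
    have "(2 * L + 3) * l \<le> n * l" by (simp add: n_def)
    moreover have "(L + 1) * 1 \<le> (L + 1) * l" using l(3) by (intro mult_le_mono) auto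
    ultimately show ?thesis by (simp add: algebra_simps)
  qed
  have eq: "q ! (i mod l) = p ! ((i - d + c) mod l)" if i: "L + 1 \<le> i" "i < (L + 1) * l + l" for i
  proof -
    have "i < length \<alpha>'" using i nl \<alpha>' 2(4) \<beta>' by simp
    then have "R ! i = concat (replicate n q) ! i" by (simp add: 2 nth_append)
    also have "\<dots> = q ! (i mod l)" using i nl nth_concat_replicate[of i n q] l by simp
    finally have 3: "R ! i = q ! (i mod l)" .
    have "\<not> i < length (\<alpha> @ m3)" using i(1) d by (simp add: d_def)
    then have "R ! i = \<gamma> ! (i - d)" using nth_append[of "\<alpha> @ m3" \<gamma> i] by (simp add: 1(3) d_def)
    also have "\<dots> = concat (replicate n p) ! (i - d + c)"
      using nth_append[of "rn \<beta> @ m2" \<gamma> "i - d + c"] by (simp add: 1(2) c_def)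
    also have "\<dots> = p ! ((i - d + c) mod l)"
    proof -
      have "i - d < length \<gamma>"
      proof -
        have "i < length R" using \<open>i < length \<alpha>'\<close> 2(3) by simp
        then show ?thesis using i d by (simp add: 1(3) d_def)
      qed
      then show ?thesis using \<gamma> nth_concat_replicate[of "i - d + c" n p] l by simp
    qed
    finally show ?thesis using 3 by simp
  qed
  define k where "k = (L + 1) * l - d + c"
  have dl: "d \<le> (L + 1) * l"
  proof -
    have "(L + 1) * 1 \<le> (L + 1) * l" using l(3) by (intro mult_le_mono) auto
    then show ?thesis using d by simp
  qed
  have "q = rotate k p"
  proof (rule nth_equalityI)
    fix j assume j: "j < length q"
    \<comment> \<open>Starting the window at a multiple of the period makes entry i of the power of
      \<open>q\<close> equal to \<open>q ! j\<close>.\<close>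
    define i where "i = (L + 1) * l + j"
    have "(L + 1) * 1 \<le> (L + 1) * l" using l(3) by (intro mult_le_mono) auto
    then have "L + 1 \<le> i" "i < (L + 1) * l + l" using j l by (simp_all add: i_def)
    from eq[OF this] have "q ! (i mod l) = p ! ((i - d + c) mod l)" .
    moreover have "i mod l = j" unfolding i_def mod_mult_self3 using j l by simp
    moreover have "i - d + c = k + j" unfolding i_def k_def using dl by simp
    ultimately show "q ! j = rotate k p ! j" using j l by (simp add: nth_rotate)
  qed (simp add: l)
  then show ?thesis by blast
qed

lemma mul_intertwine: "x + g = h + x \<Longrightarrow> x + mul n g = mul n h + x"
proof (induction n)
  case (Suc n)
  have "x + mul (Suc n) g = (x + g) + mul n g" by (simp add: add.assoc)
  also have "\<dots> = h + (x + mul n g)" by (simp add: Suc.prems add.assoc)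
  finally show ?case by (simp add: Suc add.assoc)
qed simp

lemma cj_g0_iff:
  assumes "set \<nu>s \<subseteq> {1, 2, 3}" "set \<mu>s \<subseteq> {1, 2, 3}" "\<nu>s \<noteq> []" "\<mu>s \<noteq> []"
  shows "cj (g0 \<nu>s) (g0 \<mu>s) \<longleftrightarrow> (\<exists>k. \<mu>s = rotate k \<nu>s)"
proof
  assume "cj (g0 \<nu>s) (g0 \<mu>s)"
  then obtain x where x: "x + g0 \<nu>s = g0 \<mu>s + x" unfolding cj_def by blast
  have "\<exists>k. map ch \<mu>s = rotate k (map ch \<nu>s)"
  proof (rule rotation_of_tri)
    fix n
    have e: "P (mul n (g0 \<nu>s)) = concat (replicate n (map ch \<nu>s))" for \<nu>s
      by (simp add: mul_g0 P_g0 map_concat map_replicate)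
    have "x + mul n (g0 \<nu>s) = mul n (g0 \<mu>s) + x" using x by (rule mul_intertwine)
    then show "\<exists>R. tri (P x) (concat (replicate n (map ch \<nu>s))) R \<and> tri (concat (replicate n (map ch \<mu>s))) (P x) R"
      using tri_P[of x "mul n (g0 \<nu>s)"] tri_P[of "mul n (g0 \<mu>s)" x] by (auto simp: e)
  qed (use assms in simp_all)
  then obtain k where k: "map ch \<mu>s = map ch (rotate k \<nu>s)" by (auto simp: rotate_map)
  have "inj_on ch {1, 2, 3}" by (auto simp: inj_on_def ch_def)
  then have "inj_on ch (set \<mu>s \<union> set (rotate k \<nu>s))" by (rule inj_on_subset) (use assms in auto)
  then have "\<mu>s = rotate k \<nu>s" using k by (simp add: inj_on_map_eq_map)
  then show "\<exists>k. \<mu>s = rotate k \<nu>s" by blast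
next
  assume "\<exists>k. \<mu>s = rotate k \<nu>s"
  then obtain k where "\<mu>s = rotate k \<nu>s" by blast
  then have "\<mu>s = drop (k mod length \<nu>s) \<nu>s @ take (k mod length \<nu>s) \<nu>s" by (simp add: rotate_drop_take)
  moreover have "\<nu>s = take (k mod length \<nu>s) \<nu>s @ drop (k mod length \<nu>s) \<nu>s" by simp
  ultimately show "cj (g0 \<nu>s) (g0 \<mu>s)" using cj_rotate g0_simps(3) by metis
qed

section \<open>Simplicity, torsion and generators\<close>

text \<open>Torsion passes to conjugates, so the listed representatives suffice: powers of
  \<open>a\<close> move the base coset, powers of \<open>t\<close> are conjugate to
  \<open>t\<close>, and powers of alternating words have longer patterns.\<close>

lemma mul_nz:
  assumes "g \<noteq> 0" "0 < n"
  shows "mul n g \<noteq> 0"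
proof -
  have *: "mul n g \<noteq> 0" if "cj g h" "mul n h \<noteq> 0" for h
    using cj_mul[OF that(1), of n] that(2) by auto
  show ?thesis
  proof (cases g rule: cj_cases)
    case 1
    then show ?thesis using assms by simp
  next
    case (2 m)
    have "act (mul k (gA (apow m))) e0 = jnA (int k * m, NB)" for k
    proof (induction k)
      case (Suc k)
      have "aA (apow m) (jnA (k', NB)) = jnA (m + k', NB)" for k'
        by (simp add: aA_def pw_apow del: jnA.simps)
      then show ?case using Suc by (simp add: algebra_simps del: jnA.simps)
    qed simp
    then have "mul n (gA (apow m)) \<noteq> 0" using 2(1) assms(2) act_0[OF wf_e0] by (metis jnA.simps mult_eq_0_iff of_nat_eq_0_iff prod.inject ya.distinct(1) not_gr_zero)
    then show ?thesis by (rule *[OF 2(2)])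
  next
    case 3
    have "mul n gt \<noteq> 0" using cj_mul_gt[OF assms(2)] gt_nz by auto
    then show ?thesis by (rule *[OF 3])
  next
    case (4 \<nu>s)
    have "length (P (mul n (g0 \<nu>s))) \<noteq> 0"
      using 4(1) assms(2) by (simp add: mul_g0 P_g0 length_concat_replicate del: length_0_conv)
    then have "mul n (g0 \<nu>s) \<noteq> 0" by auto
    then show ?thesis by (rule *[OF 4(3)])
  qed
qed

text \<open>\<open>t\<close> is \<open>b^6\<close>, so \<open>a\<close> and \<open>b\<close> give
  the first factor and with it the common subgroup. The latter contains a conjugate by
  \<open>b\<close> of every other letter.\<close>

lemma generators:
  assumes S: "0 \<in> S" "\<And>g h. g \<in> S \<Longrightarrow> h \<in> S \<Longrightarrow> g + h \<in> S" "\<And>g. g \<in> S \<Longrightarrow> - g \<in> S"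
    and ab: "ga \<in> S" "gb \<in> S"
  shows "g \<in> S"
proof -
  have "gt = gb + gb + gb + gb + gb + gb"
  proof -
    have "gB (replicate (Suc n) (0, False)) = gb + gB (replicate n (0, False))" for n
      using gB_Cons[of "(0, False)" "replicate n (0, False)"] by simp
    then show ?thesis unfolding gt_b6 by (simp add: eval_nat_numeral add.assoc del: replicate.simps) simp
  qed
  then have t: "gt \<in> S" using S(2) ab(2) by simp
  have A: "gA w \<in> S" for w
  proof (induction w)
    case (Cons x w)
    obtain l e where x: "x = (l, e)" by fastforce
    have "gA [x] \<in> S" using ab(1) t S(3) by (cases l; cases e) (simp_all add: x gX_inv)
    then show ?case using Cons S(2) by (simp add: gA_Cons[of x w])
  qed (use S(1) in simp)
  have B: "gB [(l, False)] \<in> S" for l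
  proof (cases l)
    case (Suc n)
    have "bp l False 3 = 3" by (simp add: Suc)
    then have "gC [(prod_encode (l, 0), False)] = - gb + gB [(l, False)] + gb"
      using gC_loop[of l 0] Suc by (simp add: gb_powers)
    moreover have "gC [(prod_encode (l, 0), False)] \<in> S" using A[of "subst ah [(prod_encode (l, 0), False)]"] by (simp only: gA_subst)
    ultimately have x: "- gb + gB [(l, False)] + gb \<in> S" by simp
    have "gb + (- gb + gB [(l, False)] + gb) + - gb \<in> S" by (intro S(2) S(3) ab(2) x)
    then show ?thesis by (simp add: grp_simps del: add_uminus_conv_diff)
  qed (use ab(2) in simp)
  have "cls w \<in> S" for w
  proof (induction w)
    case (Cons x w)
    obtain l e where x: "x = (l, e)" by fastforce
    have "cls [x] \<in> S"
    proof (cases l)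
      case 0
      then show ?thesis using A by (simp add: x cls_letter)
    next
      case (Suc l')
      then show ?thesis using B[of l'] S(3) by (cases e) (simp_all add: x cls_letter gX_inv)
    qed
    then show ?case using Cons S(2) cls_simps(2)[of "[x]" w] by simp
  qed (use S(1) in simp)
  moreover obtain w where "g = cls w" by (rule cls_surj)
  ultimately show ?thesis by simp
qed

lemma successively_replicate: "Q x x \<Longrightarrow> successively Q (replicate n x)"
proof (induction n)
  case (Suc n)
  then show ?case by (cases n) simp_all
qed simp

lemma normal_UNIV:
  fixes N :: "grp set"
  assumes N: "0 \<in> N" "\<And>g h. g \<in> N \<Longrightarrow> h \<in> N \<Longrightarrow> g + h \<in> N" "\<And>g. g \<in> N \<Longrightarrow> - g \<in> N"
    "\<And>x g. g \<in> N \<Longrightarrow> x + g + - x \<in> N"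
    and g: "g \<in> N" "g \<noteq> 0"
  shows "h \<in> N"
proof -
  have cjN: "h \<in> N" if c: "cj g h" and m: "g \<in> N" for g h
  proof -
    obtain x where "x + g = h + x" using c unfolding cj_def by blast
    then have "h = x + g + - x" by simp
    then show ?thesis using N(4)[OF m, of x] by simp
  qed
  have t_all: "h \<in> N" if t: "gt \<in> N"
  proof -
    have "adm [(False, False), (True, False)]" by (simp add: adm_def reduced_def)
    from cj_adm[OF this] have "cj (gt + ga) gt" using gA_Cons[of "(True, False)" "[(False, False)]"] by simp
    from cjN[OF cj_sym[OF this] t] have "- gt + (gt + ga) \<in> N" by (rule N(2)[OF N(3)[OF t]])
    then have a: "ga \<in> N" by simp
    have A: "gA w \<in> N" for w
    proof (induction w)
      case (Cons x w)
      obtain l e where x: "x = (l, e)" by fastforce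
      have "gA [x] \<in> N" using a t N(3) by (cases l; cases e) (simp_all add: x gX_inv)
      then show ?case using Cons N(2) by (simp add: gA_Cons[of x w])
    qed (use N(1) in simp)
    obtain m c where mc: "- gB (br m) + gB [(0, False)] + gB (br m) = gC c" using gB_conj_gC by blast
    have "cj gb (gC c)" using cj_conj(2)[of gb "gB (br m)"] mc by simp
    from cj_sym[OF this] have "gb \<in> N" by (rule cjN) (use A[of "subst ah c"] in simp)
    from generators[OF N(1-3) a this] show ?thesis .
  qed
  show ?thesis
  proof (cases g rule: cj_cases)
    case 1
    then show ?thesis using g by simp
  next
    case (2 m)
    have m: "gA (apow m) \<in> N" by (rule cjN[OF 2(2) g(1)])
    obtain k e where k: "apow m = replicate k (False, e)" "0 < k" using 2(1) by (auto simp: apow_def)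
    have w: "winv (replicate k (False, e)) = replicate k (False, \<not> e)" by (simp add: winv_def)
    \<comment> \<open>The commutator of \<open>t\<close> with the given power of \<open>a\<close>
      lies in \<open>N\<close>; its reversal is admissible, so it is conjugate to
      \<open>t\<close>.\<close>
    define w where "w = (True, False) # replicate k (False, e) @ (True, True) # replicate k (False, \<not> e)"
    have "reduced w" unfolding w_def reduced_def using k(2)
      by (auto simp: successively_Cons successively_append_iff successively_replicate)
    then have "adm (rev w)" using k(2) unfolding adm_def reduced_rev by (simp add: w_def hd_rev)
    from cj_adm[OF this] have "cj (gA w) gt" by simp
    moreover have "- gA (apow m) = gA (replicate k (False, \<not> e))" using gA_simps(3)[of "apow m"] by (simp add: k(1) w)
    then have "gA w = (gt + gA (apow m) + - gt) + - gA (apow m)"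
      unfolding w_def k(1) using gA_Cons[of "(True, False)" "replicate k (False, e) @ (True, True) # replicate k (False, \<not> e)"]
        gA_Cons[of "(True, True)" "replicate k (False, \<not> e)"]
      by (simp add: gX_inv grp_simps del: add_uminus_conv_diff)
    then have "gA w \<in> N" using N(2)[OF N(4)[OF m] N(3)[OF m]] by simp
    ultimately show ?thesis by (intro t_all) (rule cjN)
  next
    case 3
    from t_all[OF cjN[OF 3 g(1)]] show ?thesis .
  next
    case (4 \<nu>s)
    obtain \<nu> \<mu>s where \<nu>: "\<nu>s = \<nu> # \<mu>s" using 4(1) by (cases \<nu>s) auto
    have g0: "g0 \<nu>s \<in> N" by (rule cjN[OF 4(3) g(1)])
    \<comment> \<open>The product with one extra factor \<open>t\<close> after the first
      \<open>a\<close> is conjugate to the product without it, so both lie in \<open>N\<close>.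
      Their quotient is a conjugate of \<open>t\<close>.\<close>
    let ?cs = "(\<nu>, [(0 :: nat, False)]) # map (\<lambda>\<nu>. (\<nu>, [])) \<mu>s"
    have "fst ` set ?cs \<subseteq> {1, 2, 3}" "?cs \<noteq> []" using 4(2) \<nu> by auto
    then have "cj (cl ?cs) (g0 (map fst ?cs))" by (rule cl_g0)
    moreover have "map fst ?cs = \<nu>s" by (simp add: \<nu> o_def)
    ultimately have "cj (cl ?cs) (g0 \<nu>s)" by (simp only:)
    from cjN[OF cj_sym[OF this] g0] have cl: "cl ?cs \<in> N" .
    have e: "cl (map (\<lambda>\<nu>. (\<nu>, [])) \<mu>s) = g0 \<mu>s" by (induction \<mu>s) auto
    have "cl ?cs + - g0 \<nu>s \<in> N" using N(2)[OF cl N(3)[OF g0]] .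
    also have "cl ?cs + - g0 \<nu>s = ga + gt + - ga"
      using gt_C by (simp add: \<nu> e grp_simps del: add_uminus_conv_diff)
    finally have "ga + gt + - ga \<in> N" .
    from N(4)[OF this, of "- ga"] have "gt \<in> N" by (simp add: grp_simps del: add_uminus_conv_diff)
    then show ?thesis by (rule t_all)
  qed
qed

section \<open>A free subgroup with unbounded commutator length\<close>

text \<open>The patterns are 0, 1, 1, 0 and 0, 1, 1, 1, 0: zeros delimit the blocks, the length of
  the run names the generator and its sign the exponent. The outer exponents of \<open>a\<close>, 1
  or 2 in front and 3 or 4 at the end, cancel at a junction only between a generator and its own
  inverse, so reduced words concatenate their patterns.\<close>

definition hel :: "bool \<Rightarrow> grp" where
  "hel i = gA (apow (if i then 2 else 1)) + (gB (rw 3) + (g0 (if i then [1, 1, 1, 3] else [1, 1, 3]) +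
     gA (apow (if i then 4 else 3))))"

primrec hw :: "bool word \<Rightarrow> grp" where
  "hw [] = 0"
| "hw (x # w) = (if snd x then - hel (fst x) else hel (fst x)) + hw w"

definition bk :: "bool \<times> bool \<Rightarrow> int list" where
  "bk x = (let s = (if snd x then - 1 else 1) in if fst x then [0, s, s, s, 0] else [0, s, s, 0])"

lemma hw_append [simp]: "hw (u @ v) = hw u + hw v"
  by (induction u) (auto simp: add.assoc)

lemma hw_winv [simp]: "hw (winv w) = - hw w"
  by (induction w) (auto simp: minus_add)

lemma act_minus_rw:
  assumes "wfE e" "snd e = NB"
  shows "pat (act (- gB (rw \<nu>)) e) = - ch \<nu> # pat e \<and> fst (act (- gB (rw \<nu>)) e) = NA"
proof -
  define m where "m = B.pw (winv (rw \<nu>)) 0"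
  have "B.pw (rw \<nu>) m = 0" unfolding m_def by (rule B.pw_winv(2))
  then have "chi m = - ch \<nu>" using chi_inv[of "rw \<nu>" m] rw_pt(2)[of \<nu>] by simp
  moreover have "m \<noteq> 0" using \<open>B.pw (rw \<nu>) m = 0\<close> rw_pt(1)[of \<nu>] by (intro notI) simp
  ultimately show ?thesis using assms act_gB[OF assms(1), of "winv (rw \<nu>)"]
    by (simp add: aB_def spB_def pat_def m_def)
qed

lemma act_minus_g0:
  "wfE e \<Longrightarrow> fst e = NA \<Longrightarrow> pat (act (- g0 \<nu>s) e) = rn (map ch \<nu>s) @ pat e \<and> fst (act (- g0 \<nu>s) e) = NA"
proof (induction \<nu>s arbitrary: e)
  case (Cons \<nu> \<nu>s)
  define e1 where "e1 = act (gA (apow (- 1))) e"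
  define e2 where "e2 = act (- gB (rw \<nu>)) e1"
  have "- ga = gA (apow (- 1))" using gX_inv(1)[of False] by (simp add: apow_def)
  then have m: "- g0 (\<nu> # \<nu>s) = - g0 \<nu>s + (- gB (rw \<nu>) + gA (apow (- 1)))"
    by (simp add: minus_add add.assoc del: add_uminus_conv_diff)
  have e1: "pat e1 = pat e" "snd e1 = NB" "wfE e1"
    using act_apow_front[OF Cons.prems, of "- 1"] Cons.prems by (simp_all add: e1_def del: act_gA)
  have e2: "pat e2 = - ch \<nu> # pat e" "fst e2 = NA" "wfE e2"
    using act_minus_rw[OF e1(3,2), of \<nu>] e1 by (simp_all add: e2_def)
  have "act (- g0 (\<nu> # \<nu>s)) e = act (- g0 \<nu>s) e2"
    unfolding m using Cons.prems e1(3) by (simp add: e1_def e2_def del: act_gA)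
  then show ?case using Cons.IH[OF e2(3,2)] e2(1) by simp
qed simp

definition front :: "int \<Rightarrow> pt \<Rightarrow> bool" where
  "front n e \<longleftrightarrow> (\<exists>y. e = (CA n y, NB))"

lemma act_hel:
  assumes e: "wfE e" "e = e0 \<or> front n e" "e = e0 \<Longrightarrow> n = 0"
    and i: "n + (if i then 4 else 3) \<noteq> 0"
  shows "pat (act (hel i) e) = bk (i, False) @ pat e \<and> front (if i then 2 else 1) (act (hel i) e)"
proof -
  let ?\<nu>s = "if i then [1, 1, 1, 3] else [1, 1, 3] :: nat list"
  define e1 where "e1 = act (gA (apow (if i then 4 else 3))) e"
  define e2 where "e2 = act (g0 ?\<nu>s) e1"
  define e3 where "e3 = act (gB (rw 3)) e2"
  have "pat e1 = pat e" "snd e1 = NB"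
    using e i by (auto simp: e1_def aA_def spA_def front_def pat_def pw_apow sw_apow wfE_def)
  moreover have "wfE e1" using e by (simp add: e1_def wf_aA)
  ultimately have e2: "pat e2 = map ch ?\<nu>s @ pat e" "snd e2 = NB" "wfE e2"
    using act_g0[of e1 ?\<nu>s] by (simp_all add: e2_def)
  then have e3: "pat e3 = ch 3 # pat e2" "fst e3 = NA" "wfE e3"
    using act_rw[of e2 3] by (simp_all add: e3_def del: act_gB)
  have a: "act (hel i) e = act (gA (apow (if i then 2 else 1))) e3"
    using e(1) \<open>wfE e1\<close> e2(3) by (simp add: hel_def e1_def e2_def e3_def wf_aA wf_aB del: act_gA act_gB)
  have "front (if i then 2 else 1) (act (hel i) e)"
    unfolding a using e3 by (simp add: aA_def spA_def front_def pw_apow)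
  moreover have "pat (act (hel i) e) = pat e3"
    unfolding a using act_apow_front[OF e3(3,2), of "if i then 2 else 1"] by (simp del: act_gA)
  ultimately show ?thesis using e3(1) e2(1) by (simp add: bk_def ch_def Let_def)
qed

lemma act_minus_hel:
  assumes e: "wfE e" "e = e0 \<or> front n e" "e = e0 \<Longrightarrow> n = 0"
    and i: "n - (if i then 2 else 1) \<noteq> 0"
  shows "pat (act (- hel i) e) = bk (i, True) @ pat e \<and> front (if i then - 4 else - 3) (act (- hel i) e)"
proof -
  let ?\<nu>s = "if i then [1, 1, 1, 3] else [1, 1, 3] :: nat list"
  have inv: "- gA (apow k) = gA (apow (- k))" for k
  proof -
    have "winv (apow k) = apow (- k)" by (cases "k = 0") (auto simp: apow_def winv_def)
    then show ?thesis using gA_simps(3)[of "apow k"] by simp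
  qed
  define e1 where "e1 = act (gA (apow (if i then - 2 else - 1))) e"
  define e2 where "e2 = act (- gB (rw 3)) e1"
  define e3 where "e3 = act (- g0 ?\<nu>s) e2"
  have e1: "pat e1 = pat e" "snd e1 = NB"
    using e i by (auto simp: e1_def aA_def spA_def front_def pat_def pw_apow sw_apow wfE_def)
  moreover have "wfE e1" using e by (simp add: e1_def wf_aA)
  ultimately have e2: "pat e2 = - ch 3 # pat e" "fst e2 = NA" "wfE e2"
    using act_minus_rw[of e1 3] by (simp_all add: e2_def)
  then have e3: "pat e3 = rn (map ch ?\<nu>s) @ pat e2" "fst e3 = NA" "wfE e3"
    using act_minus_g0[of e2 ?\<nu>s] by (simp_all add: e3_def)
  have m: "- hel i = gA (apow (if i then - 4 else - 3)) +
      (- g0 ?\<nu>s + (- gB (rw 3) + gA (apow (if i then - 2 else - 1))))"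
    by (cases i) (simp_all only: hel_def minus_add inv add.assoc if_True if_False)
  have a: "act (- hel i) e = act (gA (apow (if i then - 4 else - 3))) e3"
    unfolding m using e(1) \<open>wfE e1\<close> e2(3) by (simp add: e1_def e2_def e3_def wf_aA del: act_gA)
  have "front (if i then - 4 else - 3) (act (- hel i) e)"
    unfolding a using e3 by (simp add: aA_def spA_def front_def pw_apow)
  moreover have "pat (act (- hel i) e) = pat e3"
    unfolding a using act_apow_front[OF e3(3,2), of "if i then - 4 else - 3"] by (simp del: act_gA)
  ultimately show ?thesis using e3(1) e2(1) by (simp add: bk_def ch_def Let_def)
qed

lemma P_hw: "reduced w \<Longrightarrow> P (hw w) = concat (map bk w)"
proof -
  have "reduced w \<Longrightarrow> pat (act (hw w) e0) = concat (map bk w) \<and>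
    (w = [] \<and> act (hw w) e0 = e0 \<or> w \<noteq> [] \<and>
      front (if snd (hd w) then (if fst (hd w) then - 4 else - 3) else (if fst (hd w) then 2 else 1)) (act (hw w) e0))"
  proof (induction w)
    case Nil
    show ?case by (simp add: pat_def)
  next
    case (Cons x w)
    obtain i e where x: "x = (i, e)" by fastforce
    define n :: int where "n = (if w = [] then 0 else
      if snd (hd w) then (if fst (hd w) then - 4 else - 3) else (if fst (hd w) then 2 else 1))"
    define z where "z = act (hw w) e0"
    have red: "reduced w" "w \<noteq> [] \<Longrightarrow> fst (hd w) = i \<Longrightarrow> snd (hd w) = e"
      using Cons.prems by (auto simp: x reduced_def successively_Cons)
    have z: "pat z = concat (map bk w)" "z = e0 \<or> front n z" "w = [] \<longleftrightarrow> z = e0" "wfE z"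
      using Cons.IH[OF red(1)] by (auto simp: z_def n_def front_def)
    have n0: "z = e0 \<Longrightarrow> n = 0" using z(3) by (simp add: n_def)
    show ?case
    proof (cases e)
      case True
      have "n - (if i then 2 else 1) \<noteq> 0" using red(2) True by (auto simp: n_def split: if_splits)
      from act_minus_hel[OF z(4,2) n0 this] show ?thesis using z(1) True by (simp add: x z_def)
    next
      case False
      have "n + (if i then 4 else 3) \<noteq> 0" using red(2) False by (auto simp: n_def split: if_splits)
      from act_hel[OF z(4,2) n0 this] show ?thesis using z(1) False by (simp add: x z_def)
    qed
  qed
  then show "reduced w \<Longrightarrow> P (hw w) = concat (map bk w)" by (simp add: P_def)
qed

lemma hw_nz: "reduced w \<Longrightarrow> w \<noteq> [] \<Longrightarrow> hw w \<noteq> 0"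
proof
  assume "reduced w" "w \<noteq> []" "hw w = 0"
  then have "concat (map bk w) = []" using P_hw[of w] by simp
  then show False using \<open>w \<noteq> []\<close> by (cases w) (auto simp: bk_def Let_def split: if_splits)
qed

subsection \<open>Patterns of the subgroup have no symmetry centre\<close>

lemma bk_cases:
  obtains s where "s \<noteq> 0" "bk x = [0, s, s, 0]" "\<not> fst x" "s = (if snd x then - 1 else 1)"
  | s where "s \<noteq> 0" "bk x = [0, s, s, s, 0]" "fst x" "s = (if snd x then - 1 else 1)"
proof (cases "fst x")
  case True
  then show ?thesis by (intro that(2)[of "if snd x then - 1 else 1"]) (simp_all add: bk_def Let_def)
next
  case False
  then show ?thesis by (intro that(1)[of "if snd x then - 1 else 1"]) (simp_all add: bk_def Let_def)
qed

text \<open>An inner zero lies at a block boundary: one neighbour is the zero of the adjacent block,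
  the other belongs to a run and is nonzero.\<close>

lemma no_centre_entry:
  "0 < k \<Longrightarrow> Suc k < length (concat (map bk w)) \<Longrightarrow> concat (map bk w) ! k = 0 \<Longrightarrow>
    concat (map bk w) ! Suc k \<noteq> - concat (map bk w) ! (k - 1)"
proof (induction w arbitrary: k)
  case (Cons x w)
  define t where "t = concat (map bk w)"
  have e: "concat (map bk (x # w)) = bk x @ t" by (simp add: t_def)
  note prems = Cons.prems[unfolded e]
  have tl: "\<exists>r u. t = 0 # r # u \<and> r \<noteq> 0" if ne: "t \<noteq> []"
  proof -
    obtain y v where "w = y # v" using ne by (cases w) (auto simp: t_def)
    then show ?thesis by (cases y rule: bk_cases) (auto simp: t_def)
  qed
  show ?case unfolding e
  proof (cases "length (bk x) < k")
    case True
    then obtain j where j: "k = length (bk x) + Suc j" using less_imp_Suc_add by fastforce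
    have "t ! Suc (Suc j) \<noteq> - t ! (Suc j - 1)"
      unfolding t_def by (rule Cons.IH) (use prems in \<open>simp_all add: j nth_append t_def\<close>)
    then show "(bk x @ t) ! Suc k \<noteq> - (bk x @ t) ! (k - 1)" by (simp add: j nth_append)
  next
    case False
    have ne: "length (bk x) \<le> Suc k \<Longrightarrow> t \<noteq> []" using prems(2) by auto
    show "(bk x @ t) ! Suc k \<noteq> - (bk x @ t) ! (k - 1)"
    proof (cases x rule: bk_cases)
      case (1 s)
      have "k = 1 \<or> k = 2 \<or> k = 3 \<or> k = 4" using False prems(1) 1 by auto
      then show ?thesis using 1 prems tl[OF ne] by (elim disjE) (auto simp: nth_Cons' numeral_eq_Suc)
    next
      case (2 s)
      have "k = 1 \<or> k = 2 \<or> k = 3 \<or> k = 4 \<or> k = 5" using False prems(1) 2 by auto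
      then show ?thesis using 2 prems tl[OF ne] by (elim disjE) (auto simp: nth_Cons' numeral_eq_Suc)
    qed
  qed
qed simp

text \<open>Inside a block, two adjacent entries are never opposite. A gap between two blocks would
  be symmetric only if the runs had opposite signs and equal lengths, that is if a letter met its
  inverse.\<close>

lemma no_centre_gap:
  "reduced w \<Longrightarrow> Suc k < length (concat (map bk w)) \<Longrightarrow>
    \<exists>d\<le>3. d \<le> k \<and> Suc k + d < length (concat (map bk w)) \<and>
      concat (map bk w) ! (Suc k + d) \<noteq> - concat (map bk w) ! (k - d)"
proof (induction w arbitrary: k)
  case (Cons x w)
  let ?s = "concat (map bk w)"
  have red: "reduced w" "w \<noteq> [] \<Longrightarrow> fst (hd w) = fst x \<Longrightarrow> snd (hd w) = snd x"
    using Cons.prems(1) by (auto simp: reduced_def successively_Cons)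
  show ?case
  proof (cases "length (bk x) \<le> k")
    case True
    then obtain j where j: "k = length (bk x) + j" using le_Suc_ex by blast
    obtain d where d: "d \<le> 3" "d \<le> j" "Suc j + d < length ?s" "?s ! (Suc j + d) \<noteq> - ?s ! (j - d)"
      using Cons.IH[OF red(1), of j] Cons.prems(2) by (auto simp: j)
    moreover have "concat (map bk (x # w)) ! (Suc k + d) = ?s ! (Suc j + d)"
      by (simp add: j nth_append)
    moreover have "concat (map bk (x # w)) ! (k - d) = ?s ! (j - d)"
    proof -
      have "k - d = length (bk x) + (j - d)" using d(2) j by simp
      then show ?thesis by (simp add: nth_append)
    qed
    ultimately show ?thesis by (intro exI[of _ d]) (simp add: j)
  next
    case F: False
    show ?thesis
    proof (cases "Suc k < length (bk x)")
      case True
      have "concat (map bk (x # w)) ! Suc k \<noteq> - concat (map bk (x # w)) ! k"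
      proof (cases x rule: bk_cases)
        case (1 s)
        then have "k = 0 \<or> k = 1 \<or> k = 2" using True by auto
        then show ?thesis using 1 by (elim disjE) (auto simp: nth_Cons' numeral_eq_Suc)
      next
        case (2 s)
        then have "k = 0 \<or> k = 1 \<or> k = 2 \<or> k = 3" using True by auto
        then show ?thesis using 2 by (elim disjE) (auto simp: nth_Cons' numeral_eq_Suc)
      qed
      then show ?thesis using Cons.prems(2) by (intro exI[of _ 0]) simp
    next
      case False
      then have k: "Suc k = length (bk x)" using F by simp
      obtain y v where w: "w = y # v" using Cons.prems(2) k by (cases w) auto
      have yx: "fst y = fst x \<Longrightarrow> snd y = snd x" using red(2) by (simp add: w)
      have len: "4 \<le> length (bk x)" "4 \<le> length (bk y)"
        by (cases x rule: bk_cases; simp) (cases y rule: bk_cases; simp)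
      have s: "concat (map bk (x # w)) ! (Suc k + d) = bk y ! d"
        "concat (map bk (x # w)) ! (k - d) = bk x ! (length (bk x) - Suc d)" if "d \<le> 3" for d
      proof -
        show "concat (map bk (x # w)) ! (Suc k + d) = bk y ! d" using k len that by (simp add: w nth_append)
        have "k - d = length (bk x) - Suc d" "length (bk x) - Suc d < length (bk x)" using k by linarith+
        then show "concat (map bk (x # w)) ! (k - d) = bk x ! (length (bk x) - Suc d)"
          by (simp add: nth_append)
      qed
      \<comment> \<open>Distance 1 compares the signs of the runs. If these are opposite, the two
        generators differ, and at distance 3 a delimiting zero faces an entry of the longer
        run.\<close>
      have "bk y ! 1 \<noteq> - bk x ! (length (bk x) - Suc 1) \<or> bk y ! 3 \<noteq> - bk x ! (length (bk x) - Suc 3)"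
        using yx by (cases x rule: bk_cases; cases y rule: bk_cases) (auto simp: numeral_eq_Suc split: if_splits)
      then obtain d where "d = 1 \<or> d = 3" "bk y ! d \<noteq> - bk x ! (length (bk x) - Suc d)" by blast
      then have d: "d \<le> 3" "bk y ! d \<noteq> - bk x ! (length (bk x) - Suc d)" by auto
      have "d \<le> k" "Suc k + d < length (concat (map bk (x # w)))" using k len d(1) by (simp_all add: w)
      then show ?thesis using d s[OF d(1)] by (intro exI[of _ d]) simp
    qed
  qed
qed simp

subsection \<open>Counting quasimorphisms\<close>

definition occ :: "int list \<Rightarrow> int list \<Rightarrow> (int list \<times> int list) set" where
  "occ W l = {(u, v). l = u @ W @ v}"

definition cnt :: "int list \<Rightarrow> int list \<Rightarrow> nat" where
  "cnt W l = card (occ W l)"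

lemma finite_occ: "finite (occ W l)"
proof -
  have "occ W l \<subseteq> (\<lambda>(i, j). (take i l, drop j l)) ` ({..length l} \<times> {..length l})"
  proof
    fix p assume "p \<in> occ W l"
    then obtain u v where p: "p = (u, v)" "l = u @ W @ v" by (auto simp: occ_def)
    then have "p = (\<lambda>(i, j). (take i l, drop j l)) (length u, length u + length W)" by simp
    moreover have "(length u, length u + length W) \<in> {..length l} \<times> {..length l}" using p by simp
    ultimately show "p \<in> (\<lambda>(i, j). (take i l, drop j l)) ` ({..length l} \<times> {..length l})" by blast
  qed
  then show ?thesis by (rule finite_subset) simp
qed

lemma cnt_rn: "cnt (rn W) (rn l) = cnt W l"
proof -
  have "occ (rn W) (rn l) = (\<lambda>(u, v). (rn v, rn u)) ` occ W l"
  proof (intro equalityI subsetI)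
    fix p assume "p \<in> occ (rn W) (rn l)"
    then obtain u v where p: "p = (u, v)" "rn l = u @ rn W @ v" by (auto simp: occ_def)
    from arg_cong[OF p(2), of rn] have "l = rn v @ W @ rn u" by simp
    then have "(rn v, rn u) \<in> occ W l" by (simp add: occ_def)
    then show "p \<in> (\<lambda>(u, v). (rn v, rn u)) ` occ W l" by (force simp: p(1))
  qed (auto simp: occ_def)
  moreover have "inj_on (\<lambda>(u, v). (rn v, rn u)) (occ W l)"
    by (rule inj_on_inverseI[of _ "\<lambda>(u, v). (rn v, rn u)"]) auto
  ultimately show ?thesis by (simp add: cnt_def card_image)
qed

text \<open>The occurrences that lie in neither part start in a window of bounded length around the
  cut, so they are determined by their starting position and bounded in number.\<close>

lemma cnt_split:
  assumes "length m \<le> 1" "W \<noteq> []"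
  shows "cnt W \<alpha> + cnt W \<beta> \<le> cnt W (\<alpha> @ m @ \<beta>)"
    "cnt W (\<alpha> @ m @ \<beta>) \<le> cnt W \<alpha> + cnt W \<beta> + length W + 1"
proof -
  let ?l = "\<alpha> @ m @ \<beta>"
  let ?A = "(\<lambda>(u, v). (u, v @ m @ \<beta>)) ` occ W \<alpha>"
  let ?B = "(\<lambda>(u, v). (\<alpha> @ m @ u, v)) ` occ W \<beta>"
  let ?M = "{(u, v). ?l = u @ W @ v \<and> length \<alpha> < length u + length W \<and> length u < length \<alpha> + length m}"
  have cA: "card ?A = cnt W \<alpha>" and cB: "card ?B = cnt W \<beta>"
    unfolding cnt_def by (rule card_image; force simp: inj_on_def)+
  have sub: "?A \<subseteq> occ W ?l" "?B \<subseteq> occ W ?l" by (auto simp: occ_def)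
  have "occ W ?l \<subseteq> ?A \<union> ?B \<union> ?M"
  proof
    fix p assume "p \<in> occ W ?l"
    then obtain u v where p: "p = (u, v)" "?l = u @ W @ v" by (auto simp: occ_def)
    consider "length u + length W \<le> length \<alpha>" | "length \<alpha> + length m \<le> length u"
      | "length \<alpha> < length u + length W" "length u < length \<alpha> + length m" by linarith
    then show "p \<in> ?A \<union> ?B \<union> ?M"
    proof cases
      case 1
      then have "take (length (u @ W)) \<alpha> = u @ W"
        using arg_cong[OF p(2), of "take (length (u @ W))"] by simp
      then have a: "\<alpha> = (u @ W) @ drop (length (u @ W)) \<alpha>" by (metis append_take_drop_id)
      then have "(u @ W) @ drop (length (u @ W)) \<alpha> @ m @ \<beta> = (u @ W) @ v" using p(2)
        by (metis append.assoc)
      then have "v = drop (length (u @ W)) \<alpha> @ m @ \<beta>" by (simp only: same_append_eq)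
      moreover have "(u, drop (length (u @ W)) \<alpha>) \<in> occ W \<alpha>" using a by (simp add: occ_def)
      ultimately show ?thesis by (force simp: p(1))
    next
      case 2
      then have "take (length (\<alpha> @ m)) u = \<alpha> @ m"
        using arg_cong[OF p(2), of "take (length (\<alpha> @ m))"] by simp
      then have a: "u = (\<alpha> @ m) @ drop (length (\<alpha> @ m)) u" by (metis append_take_drop_id)
      then have "(\<alpha> @ m) @ \<beta> = (\<alpha> @ m) @ drop (length (\<alpha> @ m)) u @ W @ v" using p(2)
        by (metis append.assoc)
      then have "\<beta> = drop (length (\<alpha> @ m)) u @ W @ v" by (simp only: same_append_eq)
      then have "(drop (length (\<alpha> @ m)) u, v) \<in> occ W \<beta>" by (simp add: occ_def)
      then show ?thesis using a by (force simp: p(1))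
    next
      case 3
      then show ?thesis using p by auto
    qed
  qed
  then have "cnt W ?l \<le> card (?A \<union> ?B \<union> ?M)"
    unfolding cnt_def by (rule card_mono[rotated]) (auto intro: finite_subset[OF _ finite_occ[of W ?l]] simp: occ_def)
  also have "\<dots> \<le> card ?A + card ?B + card ?M"
    by (meson card_Un_le le_trans add_le_mono1)
  also have "card ?M \<le> length W + 1"
  proof -
    have "card ?M \<le> card ((\<lambda>(u, v). length u) ` ?M)"
      by (rule eq_imp_le, rule card_image[symmetric]) (auto simp: inj_on_def append_eq_append_conv)
    also have "\<dots> \<le> card {length \<alpha> + 1 - length W..<length \<alpha> + length m}"
      by (rule card_mono) auto
    also have "\<dots> \<le> length W + 1" using assms by simp
    finally show ?thesis .
  qed
  finally show "cnt W ?l \<le> cnt W \<alpha> + cnt W \<beta> + length W + 1" using cA cB by simp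
  have "?A \<inter> ?B = {}"
  proof (rule ccontr)
    assume "?A \<inter> ?B \<noteq> {}"
    then obtain u v u' v' where "\<alpha> = u @ W @ v" "u = \<alpha> @ m @ u'" by (auto simp: occ_def)
    then have "length \<alpha> = length \<alpha> + length m + length u' + length W + length v"
      by (metis length_append add.assoc)
    then show False using assms(2) by simp
  qed
  then have "cnt W \<alpha> + cnt W \<beta> = card (?A \<union> ?B)"
    using cA cB finite_occ by (simp add: card_Un_disjoint)
  also have "\<dots> \<le> cnt W ?l" unfolding cnt_def by (rule card_mono) (use sub finite_occ in auto)
  finally show "cnt W \<alpha> + cnt W \<beta> \<le> cnt W ?l" .
qed

text \<open>A counting quasimorphism in the manner of Brooks, applied to patterns instead of reduced
  words of a free group.\<close>

definition qm :: "int list \<Rightarrow> grp \<Rightarrow> int" where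
  "qm W g = int (cnt W (P g)) - int (cnt (rn W) (P g))"

lemma qm_0: "W \<noteq> [] \<Longrightarrow> qm W 0 = 0"
  by (simp add: qm_def cnt_def occ_def)

lemma qm_minus [simp]: "qm W (- g) = - qm W g"
  using cnt_rn[of W "P g"] cnt_rn[of "rn W" "P g"] by (simp add: qm_def)

text \<open>The counts in \<open>\<alpha>\<close> and \<open>\<gamma>\<close> cancel outright, those
  in \<open>\<beta>\<close> and \<open>rn \<beta>\<close> because the reversed word is subtracted.
  Each of the three cuts costs at most \<open>length W + 1\<close>.\<close>

lemma qm_plus:
  assumes "W \<noteq> []"
  shows "\<bar>qm W (g + h) - qm W g - qm W h\<bar> \<le> 3 * (int (length W) + 1)"
proof -
  obtain \<alpha> \<beta> \<gamma> m1 m2 m3 where t: "P g = \<alpha> @ m1 @ \<beta>" "P h = rn \<beta> @ m2 @ \<gamma>" "P (g + h) = \<alpha> @ m3 @ \<gamma>"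
    and m: "length m1 \<le> 1" "length m2 \<le> 1" "length m3 \<le> 1"
    using tri_P[of g h] unfolding tri_def by blast
  have W': "rn W \<noteq> []" using assms by simp
  show ?thesis unfolding qm_def t
    using cnt_split[OF m(1) assms, of \<alpha> \<beta>] cnt_split[OF m(2) assms, of "rn \<beta>" \<gamma>] cnt_split[OF m(3) assms, of \<alpha> \<gamma>]
      cnt_split[OF m(1) W', of \<alpha> \<beta>] cnt_split[OF m(2) W', of "rn \<beta>" \<gamma>] cnt_split[OF m(3) W', of \<alpha> \<gamma>]
      cnt_rn[of W \<beta>] cnt_rn[of "rn W" \<beta>] by simp
qed

definition gcomm :: "grp \<Rightarrow> grp \<Rightarrow> grp" where
  "gcomm x y = x + y + - x + - y"

lemma qm_gcomm:
  assumes "W \<noteq> []"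
  shows "\<bar>qm W (gcomm x y)\<bar> \<le> 9 * (int (length W) + 1)"
  using qm_plus[OF assms, of x y] qm_plus[OF assms, of "x + y" "- x"] qm_plus[OF assms, of "x + y + - x" "- y"]
  unfolding gcomm_def by (simp del: add_uminus_conv_diff)

lemma qm_gcomms:
  assumes "W \<noteq> []" "\<forall>c\<in>set cs. \<exists>x y. c = gcomm x y"
  shows "\<bar>qm W (foldr (+) cs 0)\<bar> \<le> 12 * (int (length W) + 1) * int (length cs)"
  using assms(2)
proof (induction cs)
  case Nil
  show ?case using qm_0[OF assms(1)] by simp
next
  case (Cons c cs)
  then have "\<bar>qm W c\<bar> \<le> 9 * (int (length W) + 1)" using qm_gcomm[OF assms(1)] by auto
  then show ?case using Cons qm_plus[OF assms(1), of c "foldr (+) cs 0"] by (simp add: algebra_simps)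
qed

lemma reduced_replicate: "reduced (w @ w) \<Longrightarrow> reduced (concat (replicate n w))"
proof (induction n)
  case (Suc n)
  show ?case
  proof (cases n)
    case (Suc j)
    then show ?thesis using Suc.IH Suc.prems
      by (cases "w = []") (auto simp: reduced_def successively_append_iff)
  qed (use Suc.prems reduced_append in auto)
qed (simp add: reduced_def)

lemma bk_power: "concat (map bk (concat (replicate n w))) = concat (replicate n (concat (map bk w)))"
  by (induction n) auto

text \<open>Such an occurrence would give the periodic continuation of \<open>p\<close> a point
  reflection with change of sign. A suitable power of \<open>w\<close> would then have a symmetry
  centre: an entry equal to its own negative, or a gap. Both are excluded by the preceding
  lemmas.\<close>

lemma rn_not_occ:
  assumes w: "reduced (w @ w)" "w \<noteq> []"
  defines "p \<equiv> concat (map bk w)"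
  shows "cnt (rn (p @ p)) (concat (replicate n p)) = 0"
proof (rule ccontr)
  assume "cnt (rn (p @ p)) (concat (replicate n p)) \<noteq> 0"
  then have "occ (rn (p @ p)) (concat (replicate n p)) \<noteq> {}" unfolding cnt_def using card.empty by metis
  then obtain \<alpha> \<beta> where o: "concat (replicate n p) = \<alpha> @ rn (p @ p) @ \<beta>" by (auto simp: occ_def)
  define L where "L = length p"
  define q where "q j = p ! (j mod L)" for j
  define c where "c = length \<alpha> + 2 * L - 1"
  have L: "4 \<le> L"
  proof -
    obtain y v where "w = y # v" using w(2) by (cases w) auto
    then show ?thesis by (cases y rule: bk_cases) (auto simp: L_def p_def)
  qed
  have modcan: "y mod L = z mod L" if "(x + y) mod L = (x + z) mod L" for x y z :: nat
  proof -
    have "w mod L = ((x + w) mod L + (L * x - x)) mod L" for w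
    proof -
      have "x \<le> L * x" using L by simp
      then have e: "x + w + (L * x - x) = w + L * x" by linarith
      show ?thesis by (simp only: mod_add_left_eq e mod_mult_self2)
    qed
    from this[of y] this[of z] that show ?thesis by simp
  qed
  have refl: "q a = - q b" if ab: "(a + b) mod L = c mod L" for a b
  proof -
    define k where "k = (a + L * length \<alpha> - length \<alpha>) mod L"
    have La: "length \<alpha> \<le> L * length \<alpha>" using L by simp
    have k: "k < L" using L by (simp add: k_def)
    have "(length \<alpha> + k) mod L = (length \<alpha> + (a + L * length \<alpha> - length \<alpha>)) mod L"
      unfolding k_def by (simp add: mod_add_right_eq)
    also have "length \<alpha> + (a + L * length \<alpha> - length \<alpha>) = a + L * length \<alpha>" using La by linarith
    also have "\<dots> mod L = a mod L" by simp
    finally have ka: "(length \<alpha> + k) mod L = a mod L" .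
    have kb: "(2 * L - 1 - k) mod L = b mod L"
    proof -
      have "(length \<alpha> + k + (2 * L - 1 - k)) mod L = (a + b) mod L"
      proof -
        have "length \<alpha> + k + (2 * L - 1 - k) = c" using k L unfolding c_def by linarith
        then show ?thesis using ab by simp
      qed
      moreover have "(length \<alpha> + k + (2 * L - 1 - k)) mod L = (a + (2 * L - 1 - k)) mod L"
        by (rule mod_add_cong[OF ka HOL.refl])
      ultimately have "(a + (2 * L - 1 - k)) mod L = (a + b) mod L" by (simp only:)
      then show ?thesis by (rule modcan)
    qed
    have len: "length \<alpha> + k < n * L"
      using arg_cong[OF o, of length] k by (simp add: length_concat_replicate L_def)
    have "q (length \<alpha> + k) = concat (replicate n p) ! (length \<alpha> + k)"
      using len nth_concat_replicate[of "length \<alpha> + k" n p] by (simp add: q_def L_def)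
    also have "\<dots> = rn (p @ p) ! k" unfolding o using k by (simp add: nth_append L_def)
    also have "\<dots> = - (p @ p) ! (2 * L - 1 - k)"
      using k unfolding rn_def by (simp add: L_def rev_nth nth_append)
    also have "(p @ p) ! (2 * L - 1 - k) = q (2 * L - 1 - k)"
      using nth_concat_replicate[of "2 * L - 1 - k" 2 p] L k
      by (simp add: q_def L_def numeral_2_eq_2)
    finally show ?thesis using ka kb by (simp add: q_def)
  qed
  define w' where "w' = concat (replicate 8 w)"
  have w': "reduced w'" unfolding w'_def by (rule reduced_replicate[OF w(1)])
  have s: "concat (map bk w') = concat (replicate 8 p)"
    unfolding w'_def p_def by (rule bk_power)
  have len: "length (concat (map bk w')) = 8 * L" by (simp add: s length_concat_replicate L_def)
  have nth: "concat (map bk w') ! j = q j" if "j < 8 * L" for j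
    using that nth_concat_replicate[of j 8 p] by (simp add: s q_def L_def)
  \<comment> \<open>A shift by multiples of the period keeps the reflection and moves its centre,
    half of \<open>c'\<close>, well inside the 8 periods of \<open>w'\<close>.\<close>
  define c' where "c' = c mod L + 6 * L"
  have c': "c' mod L = c mod L" "6 * L \<le> c'" "c' < 7 * L" using L by (simp_all add: c'_def)
  show False
  proof (cases "even c'")
    case True
    then obtain k where k: "c' = 2 * k" by blast
    then have kL: "0 < k" "Suc k < 8 * L" using c' L by linarith+
    have "q k = - q k" by (rule refl) (use k c'(1) in \<open>simp add: mult_2\<close>)
    moreover have e: "Suc k + (k - 1) = c'" using k kL by simp
    have "q (Suc k) = - q (k - 1)" by (rule refl) (simp only: e c'(1))
    ultimately show False using no_centre_entry[of k w'] kL by (simp add: len nth)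
  next
    case False
    then obtain k where k: "c' = 2 * k + 1" by (rule oddE)
    then have kL: "3 \<le> k" "Suc k + 3 < 8 * L" using c' L by linarith+
    obtain d where d: "d \<le> 3" "concat (map bk w') ! (Suc k + d) \<noteq> - concat (map bk w') ! (k - d)"
      using no_centre_gap[OF w', of k] kL len by auto
    have e: "Suc k + d + (k - d) = c'" using k kL d(1) by linarith
    have "q (Suc k + d) = - q (k - d)" by (rule refl) (simp only: e c'(1))
    moreover have "Suc k + d < 8 * L" "k - d < 8 * L" using kL d(1) by auto
    ultimately show False using d(2) nth[of "Suc k + d"] nth[of "k - d"] by simp
  qed
qed

text \<open>Every pair of consecutive periods in the n-th power is an occurrence of
  \<open>p @ p\<close>, and nothing is subtracted because the negated reversal never occurs.\<close>

lemma qm_power: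
  assumes w: "reduced (w @ w)" "w \<noteq> []"
  defines "p \<equiv> concat (map bk w)"
  shows "int n - 1 \<le> qm (p @ p) (mul n (hw w))"
proof -
  have "mul n (hw w) = hw (concat (replicate n w))" by (induction n) auto
  then have P: "P (mul n (hw w)) = concat (replicate n p)"
    using P_hw[OF reduced_replicate[OF w(1), of n]] by (simp only: bk_power p_def)
  have p: "p \<noteq> []"
  proof -
    obtain y v where "w = y # v" using w(2) by (cases w) auto
    then show ?thesis by (cases y rule: bk_cases) (auto simp: p_def)
  qed
  have "n - 1 \<le> cnt (p @ p) (concat (replicate n p))"
  proof -
    let ?f = "\<lambda>i. (concat (replicate i p), concat (replicate (n - 2 - i) p))"
    have "inj_on ?f {..<n - 1}"
    proof (rule inj_onI)
      fix i j assume "?f i = ?f j"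
      then have "length (concat (replicate i p)) = length (concat (replicate j p))" by simp
      then show "i = j" using p by (simp add: length_concat_replicate)
    qed
    then have "n - 1 = card (?f ` {..<n - 1})" by (simp add: card_image)
    also have "\<dots> \<le> cnt (p @ p) (concat (replicate n p))"
      unfolding cnt_def
    proof (rule card_mono[OF finite_occ], safe)
      fix i assume i: "i < n - 1"
      then have "Suc i < n" by simp
      then obtain m where n: "n = Suc (Suc i + m)" using less_imp_Suc_add by blast
      have "replicate n p = replicate i p @ p # p # replicate m p"
        using replicate_add[of i "Suc (Suc m)" p] by (simp add: n)
      then show "?f i \<in> occ (p @ p) (concat (replicate n p))" by (simp add: occ_def n)
    qed
    finally show ?thesis .
  qed
  moreover have "cnt (rn (p @ p)) (concat (replicate n p)) = 0"
    unfolding p_def by (rule rn_not_occ[OF w])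
  ultimately show ?thesis unfolding qm_def P by simp
qed

lemma cyclic_core:
  "reduced w \<Longrightarrow> w \<noteq> [] \<Longrightarrow> \<exists>u v. w = u @ v @ winv u \<and> v \<noteq> [] \<and> reduced (v @ v)"
proof (induction w rule: length_induct)
  case (1 w)
  show ?case
  proof (cases "reduced (w @ w)")
    case True
    then show ?thesis using 1 by (intro exI[of _ "[]"] exI[of _ w]) simp
  next
    case False
    then have lh: "fst (last w) = fst (hd w)" "snd (last w) \<noteq> snd (hd w)"
      using 1 by (auto simp: reduced_def successively_append_iff)
    obtain x v where x: "w = x # v" using 1 by (cases w) auto
    then obtain y w' where y: "v = w' @ [y]" using lh by (cases v rule: rev_cases) auto
    have w: "w = x # w' @ [y]" by (simp add: x y)
    obtain i e where ie: "x = (i, e)" by fastforce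
    then have y': "y = (i, \<not> e)" using lh by (cases y) (auto simp: w)
    have "w' \<noteq> []" using 1(2) by (auto simp: w ie y' reduced_def)
    moreover have "reduced w'" using 1(2) reduced_append[of "[x] @ w'" "[y]"] reduced_append[of "[x]" w'] by (simp add: w)
    ultimately obtain u v' where "w' = u @ v' @ winv u" "v' \<noteq> []" "reduced (v' @ v')"
      using 1(1)[rule_format, of w'] by (auto simp: w)
    then show ?thesis by (intro exI[of _ "x # u"] exI[of _ v']) (simp add: w ie y')
  qed
qed

lemma mul_conj: "mul n (x + g + - x) = x + mul n g + - x"
proof (induction n)
  case (Suc n)
  then show ?case by (simp add: grp_simps del: add_uminus_conv_diff)
qed simp

text \<open>Conjugation to a cyclically reduced core changes the quasimorphism by a bounded amount.
  On the powers of the core it grows linearly, while each commutator contributes at most a constant,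
  so the number of commutators grows at least linearly in \<open>n\<close>.\<close>

lemma hw_commutators:
  assumes "reduced w" "w \<noteq> []"
  shows "\<exists>D. \<forall>n cs. (\<forall>c\<in>set cs. \<exists>x y. c = gcomm x y) \<longrightarrow> mul n (hw w) = foldr (+) cs 0 \<longrightarrow>
    int n \<le> D * (int (length cs) + 1)"
proof -
  obtain u v where uv: "w = u @ v @ winv u" "v \<noteq> []" "reduced (v @ v)"
    using cyclic_core[OF assms] by (elim exE conjE) (rule that)
  define p where "p = concat (map bk v)"
  define W where "W = p @ p"
  have "p \<noteq> []"
  proof -
    obtain y v' where "v = y # v'" using uv(2) by (cases v) auto
    then show ?thesis by (cases y rule: bk_cases) (auto simp: p_def)
  qed
  then have W: "W \<noteq> []" by (simp add: W_def)
  define D where "D = 12 * (int (length W) + 1)"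
  show ?thesis
  proof (intro exI allI impI)
    fix n cs assume cs: "\<forall>c\<in>set cs. \<exists>x y. c = gcomm x y" "mul n (hw w) = foldr (+) cs 0"
    have "mul n (hw w) = hw u + mul n (hw v) + - hw u"
      using mul_conj[of n "hw u" "hw v"] by (simp add: uv(1) add.assoc del: add_uminus_conv_diff)
    then have "\<bar>qm W (mul n (hw w)) - qm W (mul n (hw v))\<bar> \<le> 6 * (int (length W) + 1)"
      using qm_plus[OF W, of "hw u" "mul n (hw v)"] qm_plus[OF W, of "hw u + mul n (hw v)" "- hw u"]
      by (simp del: add_uminus_conv_diff)
    moreover have "int n - 1 \<le> qm W (mul n (hw v))"
      unfolding W_def p_def by (rule qm_power) (use uv in auto)
    moreover have "\<bar>qm W (mul n (hw w))\<bar> \<le> D * int (length cs)"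
      unfolding cs(2) D_def by (rule qm_gcomms[OF W cs(1)])
    ultimately show "int n \<le> D * (int (length cs) + 1)" unfolding D_def by (simp add: algebra_simps)
  qed
qed

section \<open>Decision procedures\<close>

lemma cmp_prod_decode [cmp_intros]: "cmp f \<Longrightarrow> cmp (\<lambda>x. prod_decode (f x))"
proof -
  have "prod_decode = (dec :: nat \<Rightarrow> nat \<times> nat)" by (auto simp: dec_prod_def dec_nat_def fun_eq_iff)
  then show "cmp f \<Longrightarrow> cmp (\<lambda>x. prod_decode (f x))" using cmp_dec[of f] by simp
qed

lemma cmp_ctr [cmp_intros]: "cmp f \<Longrightarrow> cmp (\<lambda>x. ctr (f x))"
  unfolding ctr_def by (intro cmp_intros)

lemma cmp_row [cmp_intros]:
  assumes "cmp f" shows "cmp (\<lambda>x. row (f x))"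
proof -
  have "cmp (\<lambda>v. LEAST m. \<bar>v - ctr m\<bar> \<le> int m \<or> nat \<bar>v\<bar> < m)"
    by (intro cmp_intros) (metis lessI)
  then have "cmp row" unfolding row_def .
  from cmp_comp[OF this assms] show ?thesis .
qed

lemma cmp_blk [cmp_intros]: "cmp f \<Longrightarrow> cmp (\<lambda>x. blk (f x))"
  unfolding blk_def by (intro cmp_intros)

lemma cmp_pt [cmp_intros]: "cmp f \<Longrightarrow> cmp g \<Longrightarrow> cmp (\<lambda>x. pt (f x) (g x))"
  unfolding pt_def by (intro cmp_intros)

definition pstep :: "nat \<Rightarrow> nat \<Rightarrow> bool \<times> bool \<Rightarrow> nat \<times> int \<times> edge list \<Rightarrow> nat \<times> int \<times> edge list" where
  "pstep \<beta> n x st = (if fst x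
     then (Suc (fst st), pt \<beta> (if Suc (fst st) = n then 0 else Suc (fst st)),
       (fst (snd st), pt \<beta> (if Suc (fst st) = n then 0 else Suc (fst st)), snd x) # snd (snd st))
     else (Suc (fst st), if snd x then fst (snd st) - 1 else fst (snd st) + 1, snd (snd st)))"

lemma path_fold: "path \<beta> n i p f = rev (snd (snd (fold (pstep \<beta> n) f (i, p, []))))"
proof -
  have "rev (snd (snd (fold (pstep \<beta> n) f (i, p, es)))) = rev es @ path \<beta> n i p f" for es
    by (induction f arbitrary: i p es) (simp_all add: pstep_def Let_def)
  from this[of "[]"] show ?thesis by simp
qed

lemma cmp_path [cmp_intros]:
  assumes "cmp b" "cmp n" "cmp i" "cmp p" "cmp f"
  shows "cmp (\<lambda>x. path (b x) (n x) (i x) (p x) (f x))"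
  unfolding path_fold pstep_def
  by (intro cmp_intros assms cmp_comp[OF assms(1)] cmp_comp[OF assms(2)])

lemma cmp_edges [cmp_intros]:
  assumes "cmp b" shows "cmp (\<lambda>x. edges (b x))"
  unfolding edges_def Let_def by (intro cmp_intros assms) simp_all

lemma cmp_transpose [cmp_intros]: "cmp u \<Longrightarrow> cmp w \<Longrightarrow> cmp v \<Longrightarrow> cmp (\<lambda>x. transpose (u x) (w x) (v x))"
  unfolding transpose_def by (intro cmp_intros)

text \<open>\<open>ev\<close> applies reversed edges on the way down its list and unreversed ones on
  the way back; the latter are stacked, so that two folds compute it.\<close>

definition estep :: "edge \<Rightarrow> int \<times> (int \<times> int) list \<Rightarrow> int \<times> (int \<times> int) list" where
  "estep x st = (if snd (snd x) then (transpose (fst x) (fst (snd x)) (fst st), snd st)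
     else (fst st, (fst x, fst (snd x)) # snd st))"

lemma ev_fold: "ev es v = (let st = fold estep es (v, []) in fold (\<lambda>x. transpose (fst x) (snd x)) (snd st) (fst st))"
proof -
  have "fold (\<lambda>x. transpose (fst x) (snd x)) (snd (fold estep es (v, us))) (fst (fold estep es (v, us))) =
    fold (\<lambda>x. transpose (fst x) (snd x)) us (ev es v)" for us
    by (induction es v arbitrary: us rule: ev.induct) (simp_all add: estep_def)
  from this[of "[]"] show ?thesis by (simp add: Let_def)
qed

lemma cmp_ev [cmp_intros]: "cmp f \<Longrightarrow> cmp g \<Longrightarrow> cmp (\<lambda>x. ev (f x) (g x))"
  unfolding ev_fold Let_def estep_def by (intro cmp_intros)

lemma cmp_tau [cmp_intros]: "cmp f \<Longrightarrow> cmp (\<lambda>x. tau (f x))"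
  unfolding tau_def by (intro cmp_intros)

lemma cmp_winv [cmp_intros]: "cmp f \<Longrightarrow> cmp (\<lambda>x. winv (f x))"
  unfolding winv_def by (intro cmp_intros)

lemma cmp_apow [cmp_intros]: "cmp f \<Longrightarrow> cmp (\<lambda>x. apow (f x))"
  unfolding apow_def by (intro cmp_intros)

lemma cmp_tk [cmp_intros]: "cmp f \<Longrightarrow> cmp (\<lambda>x. tk (f x))"
  unfolding tk_def by (intro cmp_intros)

definition rd1 :: "'a \<times> bool \<Rightarrow> 'a word \<Rightarrow> 'a word" where
  "rd1 x w = (case w of [] \<Rightarrow> [x] | y # v \<Rightarrow> if fst x = fst y \<and> snd x \<noteq> snd y then v else x # w)"

definition rd :: "'a word \<Rightarrow> 'a word" where
  "rd w = foldr rd1 w []"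

lemma cmp_rd [cmp_intros]: "cmp f \<Longrightarrow> cmp (\<lambda>x. rd (f x))"
  unfolding rd_def rd1_def by (intro cmp_intros)

lemma reduced_rd1: "reduced w \<Longrightarrow> reduced (rd1 x w)"
  by (cases w) (auto simp: rd1_def reduced_def successively_Cons split: if_splits)

lemma reduced_rd: "reduced (rd w)"
  by (induction w) (simp_all add: rd_def reduced_rd1, simp add: reduced_def)

lemma rd_reduced: "reduced w \<Longrightarrow> rd w = w"
proof (induction w)
  case (Cons x w)
  then have "rd w = w" by (auto simp: reduced_def successively_Cons)
  then show ?case using Cons.prems by (cases w) (auto simp: rd_def rd1_def reduced_def)
qed (simp add: rd_def)

lemma reduced_iff_rd: "reduced w \<longleftrightarrow> rd w = w"
  using rd_reduced reduced_rd by metis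

lemma rd1_inverse: "reduced w \<Longrightarrow> rd1 (g, e) (rd1 (g, \<not> e) w) = w"
  by (cases w) (auto simp: rd1_def reduced_def successively_Cons split: list.splits if_splits)

lemma rd_feq: "u \<doteq> v \<Longrightarrow> rd u = rd v"
proof -
  have red: "reduced (foldr rd1 u w)" if "reduced w" for u w :: "'a word"
    using that by (induction u) (simp_all add: reduced_rd1)
  have "u \<doteq> v \<Longrightarrow> reduced w \<Longrightarrow> foldr rd1 u w = foldr rd1 v w" for w
  proof (induction arbitrary: w rule: feq.induct)
    case (cancel u g e v)
    have "reduced (foldr rd1 v w)" using cancel by (rule red)
    then show ?case by (simp add: rd1_inverse)
  qed simp_all
  then show "u \<doteq> v \<Longrightarrow> rd u = rd v" by (simp add: rd_def reduced_def)
qed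

lemma feq_rd: "rd w \<doteq> w"
proof (induction w)
  case (Cons x w)
  have "rd1 x v \<doteq> x # v" for v
  proof (cases v)
    case (Cons y u)
    show ?thesis
    proof (cases "fst x = fst y \<and> snd x \<noteq> snd y")
      case True
      then have "y = (fst x, \<not> snd x)" by (auto simp: prod_eq_iff)
      then have "x # v = [] @ (fst x, snd x) # (fst x, \<not> snd x) # u" by (simp add: Cons)
      then show ?thesis using True feq.sym[OF feq.cancel[of "[]" "fst x" "snd x" u]] by (simp add: rd1_def Cons)
    next
      case False
      then show ?thesis by (auto simp: rd1_def Cons)
    qed
  qed (simp add: rd1_def)
  then have "rd (x # w) \<doteq> x # rd w" by (simp add: rd_def)
  also have "\<dots> \<doteq> x # w" using feq_append_left[OF Cons.IH, of "[x]"] by simp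
  finally show ?case .
qed (simp add: rd_def)

lemma feq_iff_rd: "u \<doteq> v \<longleftrightarrow> rd u = rd v"
  using rd_feq feq_rd feq.sym feq.trans by metis

lemma cmp_hd_test:
  assumes "cmp f" "cmp (\<lambda>p. Q (fst p) (snd p))"
  shows "cmp (\<lambda>x. f x \<noteq> [] \<and> Q x (hd (f x)))"
proof -
  have "cmp (\<lambda>x. case f x of [] \<Rightarrow> False | y # ys \<Rightarrow> Q x y)"
    by (intro cmp_intros assms(1) cmp_comp2[OF assms(2)])
  moreover have "(\<lambda>x. case f x of [] \<Rightarrow> False | y # ys \<Rightarrow> Q x y) = (\<lambda>x. f x \<noteq> [] \<and> Q x (hd (f x)))"
    by (auto split: list.splits simp: fun_eq_iff)
  ultimately show ?thesis by simp
qed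

lemma cmp_adm [cmp_intros]:
  assumes f: "cmp f" shows "cmp (\<lambda>x. adm (f x))"
proof -
  have "adm = (\<lambda>f. (f \<noteq> [] \<and> \<not> fst (hd f)) \<and> (rev f \<noteq> [] \<and> hd (rev f) = (True, False)) \<and> rd f = f)"
    by (auto simp: adm_def hd_rev reduced_iff_rd fun_eq_iff)
  moreover have "cmp (\<lambda>f :: bool word. (f \<noteq> [] \<and> \<not> fst (hd f)) \<and> (rev f \<noteq> [] \<and> hd (rev f) = (True, False)) \<and> rd f = f)"
    by (intro cmp_intros cmp_hd_test)
  ultimately have "cmp adm" by simp
  from cmp_comp[OF this f] show ?thesis .
qed

lemma cmp_dat [cmp_intros]: "cmp f \<Longrightarrow> cmp (\<lambda>x. dat (f x))"
  unfolding dat_def by (intro cmp_intros)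

lemma cmp_item [cmp_intros]: "cmp f \<Longrightarrow> cmp (\<lambda>x. item (f x))"
  unfolding item_def by (intro cmp_intros)

lemma cmp_nu [cmp_intros]: "cmp f \<Longrightarrow> cmp (\<lambda>x. nu (f x))"
  unfolding nu_def by (intro cmp_intros) simp_all

lemma cmp_prv [cmp_intros]: "cmp f \<Longrightarrow> cmp (\<lambda>x. prv (f x))"
  unfolding prv_def by (intro cmp_intros)

lemma cmp_swp [cmp_intros]: "cmp f \<Longrightarrow> cmp g \<Longrightarrow> cmp (\<lambda>x. swp (f x) (g x))"
  unfolding swp_def by (intro cmp_intros)

lemma cmp_sg [cmp_intros]: "cmp f \<Longrightarrow> cmp (\<lambda>x. sg (f x))"
  unfolding sg_def Let_def by (intro cmp_intros) simp_all

lemma cmp_cE [cmp_intros]: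
  assumes f: "cmp f" shows "cmp (\<lambda>x. cE (f x))"
proof -
  have eq: "cE v = (if blk v mod 2 = 1 \<and> adm (dec (blk v div 2)) \<and>
      (rev (edges (blk v)) \<noteq> [] \<and> v = fst (hd (rev (edges (blk v)))))
      then rev (map (\<lambda>(u, w, e). (sg (if e then w else u), e)) (butlast (edges (blk v)))) else [])" for v
  proof (cases "blk v mod 2 = 1 \<and> adm (dec (blk v div 2))")
    case True
    then have "edges (blk v) \<noteq> []" using edges_last(1) by blast
    then show ?thesis using True by (simp add: cE_def Let_def hd_rev)
  next
    case False
    then show ?thesis by (auto simp: cE_def Let_def)
  qed
  have "cmp cE"
    unfolding eq[abs_def] by (intro cmp_intros cmp_hd_test[where Q = "\<lambda>v x. v = fst x"]) simp_all
  from cmp_comp[OF this f] show ?thesis .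
qed

lemma cmp_cw [cmp_intros]: "cmp f \<Longrightarrow> cmp (\<lambda>x. cw (f x))"
  unfolding cw_def by (intro cmp_intros) simp_all

lemma cmp_sigma [cmp_intros]: "cmp f \<Longrightarrow> cmp (\<lambda>x. sigma (f x))"
  unfolding sigma_def by (intro cmp_intros)

lemma cmp_br [cmp_intros]: "cmp f \<Longrightarrow> cmp (\<lambda>x. br (f x))"
  unfolding br_def by (intro cmp_intros) simp_all

lemma cmp_edge_pt [cmp_intros]: "cmp f \<Longrightarrow> cmp g \<Longrightarrow> cmp (\<lambda>x. edge_pt (f x) (g x))"
  unfolding edge_pt_def by (intro cmp_intros)

lemma cmp_bp_False [cmp_intros]: "cmp f \<Longrightarrow> cmp g \<Longrightarrow> cmp (\<lambda>x. bp (f x) False (g x))"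
proof -
  have eq: "bp l False m = (if l = 0 then (if m < 3 then 3 + m else if m < 6 then (m - 2) mod 3 else m)
    else if m < 3 then 6 + 3 * (l - 1) + m
    else if 6 + 3 * (l - 1) \<le> m \<and> m < 9 + 3 * (l - 1) then m - (6 + 3 * (l - 1)) else m)" for l m
    by (cases l) simp_all
  show "cmp f \<Longrightarrow> cmp g \<Longrightarrow> cmp (\<lambda>x. bp (f x) False (g x))"
    unfolding eq by (intro cmp_intros) simp_all
qed

lemma cmp_bh [cmp_intros]: "cmp f \<Longrightarrow> cmp (\<lambda>x. bh (f x))"
  unfolding bh_def by (intro cmp_intros)

lemma cmp_subst [cmp_intros]:
  assumes "cmp f" "cmp h" shows "cmp (\<lambda>x. subst h (f x))"
  unfolding subst_def by (intro cmp_intros assms cmp_comp[OF assms(2)])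

lemma cmp_eA [cmp_intros]: "cmp f \<Longrightarrow> cmp (\<lambda>x. eA (f x))"
  unfolding eA_def by (intro cmp_intros)

lemma cmp_eB [cmp_intros]: "cmp f \<Longrightarrow> cmp (\<lambda>x. eB (f x))"
  unfolding eB_def by (intro cmp_intros)

section \<open>Derivations as products of conjugates of relators\<close>

definition relator :: "int \<Rightarrow> bool \<Rightarrow> nat word" where
  "relator k e = (let r = eA (tk k) @ winv (eB (subst bh (sigma k))) in if e then winv r else r)"

lemma cmp_relator [cmp_intros]: "cmp f \<Longrightarrow> cmp g \<Longrightarrow> cmp (\<lambda>x. relator (f x) (g x))"
  unfolding relator_def Let_def by (intro cmp_intros)

definition conjs :: "(nat word \<times> int \<times> bool) list \<Rightarrow> nat word" where
  "conjs js = concat (map (\<lambda>(u, k, e). u @ relator k e @ winv u) js)"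

lemma cmp_conjs [cmp_intros]: "cmp f \<Longrightarrow> cmp (\<lambda>x. conjs (f x))"
  unfolding conjs_def by (intro cmp_intros)

lemma conjs_append: "conjs (js @ ks) = conjs js @ conjs ks"
  by (simp add: conjs_def)

lemma winv_conjs: "\<exists>ks. winv (conjs js) = conjs ks"
proof (induction js)
  case (Cons x js)
  obtain u k e where x: "x = (u, k, e)" by (cases x)
  obtain ks where ks: "winv (conjs js) = conjs ks" using Cons by blast
  have "winv (relator k e) = relator k (\<not> e)" by (simp add: relator_def Let_def)
  then have "winv (conjs (x # js)) = conjs (ks @ [(u, k, \<not> e)])"
    using ks by (simp add: conjs_append) (simp add: conjs_def x)
  then show ?case by blast
qed (rule exI[of _ "[]"], simp add: conjs_def)

text \<open>Turns equality in the group into the existence of a finite object that can be coded and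
  checked by free reduction.\<close>

lemma geq_conjs: "w \<approx> v \<longleftrightarrow> (\<exists>js. w \<doteq> conjs js @ v)"
proof
  assume "w \<approx> v"
  then show "\<exists>js. w \<doteq> conjs js @ v"
  proof (induction rule: geq.induct)
    case (feq u v)
    then show ?case by (intro exI[of _ "[]"]) (simp add: conjs_def)
  next
    case (rel u k v)
    let ?l = "eA (tk k)" and ?r = "eB (subst bh (sigma k))"
    have "conjs [(u, k, False)] @ u @ ?r @ v = (u @ ?l @ winv ?r) @ winv u @ u @ (?r @ v)"
      by (simp add: conjs_def relator_def)
    also have "\<dots> \<doteq> (u @ ?l @ winv ?r) @ ?r @ v" by (rule feq_cancel_mid(2))
    also have "(u @ ?l @ winv ?r) @ ?r @ v = (u @ ?l) @ winv ?r @ ?r @ v" by simp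
    also have "\<dots> \<doteq> (u @ ?l) @ v" by (rule feq_cancel_mid(2))
    finally show ?case using feq.sym by (intro exI[of _ "[(u, k, False)]"]) simp
  next
    case (sym u v)
    then obtain js where js: "u \<doteq> conjs js @ v" by blast
    obtain ks where ks: "winv (conjs js) = conjs ks" using winv_conjs by blast
    have "conjs ks @ u \<doteq> winv (conjs js) @ conjs js @ v" unfolding ks[symmetric] by (rule feq_append_left[OF js])
    also have "\<dots> \<doteq> v" using feq_cancel_mid(2)[of "[]" "conjs js" v] by simp
    finally show ?case using feq.sym by blast
  next
    case (trans u v w)
    then obtain js ks where j: "u \<doteq> conjs js @ v" "v \<doteq> conjs ks @ w" by blast
    have "u \<doteq> conjs js @ conjs ks @ w" using feq.trans[OF j(1) feq_append_left[OF j(2)]] .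
    then show ?case by (intro exI[of _ "js @ ks"]) (simp add: conjs_append)
  qed
next
  assume "\<exists>js. w \<doteq> conjs js @ v"
  then obtain js where js: "w \<doteq> conjs js @ v" by blast
  have "cls (relator k e) = 0" for k e
    using gA_tk[of k] by (simp add: relator_def Let_def gC_def gA_def gB_def)
  then have "cls (conjs js) = 0" by (induction js) (auto simp: conjs_def)
  then have "cls w = cls v" using cls_feq[OF js] by simp
  then show "w \<approx> v" by (simp only: cls_eq)
qed

text \<open>A class is coded by a triple: \<open>0\<close> for the trivial one, \<open>1\<close> for \<open>t\<close>, \<open>2\<close> for a power of \<open>a\<close>,
  and \<open>3\<close> for an alternating word.\<close>

type_synonym cform = "nat \<times> int \<times> nat list"

definition cword :: "cform \<Rightarrow> nat word" where
  "cword c = (if fst c = 0 then [] else if fst c = 1 then eA [(True, False)]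
     else if fst c = 2 then eA (apow (fst (snd c)))
     else concat (map (\<lambda>\<nu>. (0, False) # eB (rw \<nu>)) (snd (snd c))))"

definition cvalid :: "cform \<Rightarrow> bool" where
  "cvalid c \<longleftrightarrow> fst c = 0 \<or> fst c = 1 \<or> (fst c = 2 \<and> fst (snd c) \<noteq> 0) \<or>
     (fst c = 3 \<and> snd (snd c) \<noteq> [] \<and> list_all (\<lambda>\<nu>. 1 \<le> \<nu> \<and> \<nu> \<le> 3) (snd (snd c)))"

definition csame :: "cform \<Rightarrow> cform \<Rightarrow> bool" where
  "csame c d \<longleftrightarrow> fst c = fst d \<and> (fst c = 2 \<longrightarrow> fst (snd c) = fst (snd d)) \<and>
     (fst c = 3 \<longrightarrow> (\<exists>i<length (snd (snd c)). snd (snd d) = drop i (snd (snd c)) @ take i (snd (snd c))))"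

lemma list_all_123: "list_all (\<lambda>\<nu>. 1 \<le> \<nu> \<and> \<nu> \<le> 3) \<nu>s \<longleftrightarrow> set \<nu>s \<subseteq> {1, 2, 3 :: nat}"
proof -
  have "(1 \<le> \<nu> \<and> \<nu> \<le> 3) = (\<nu> \<in> {1, 2, 3})" for \<nu> :: nat by (simp; linarith)
  then show ?thesis by (simp only: list_all_iff) blast
qed

lemma cls_cword: "cls (cword c) = (if fst c = 0 then 0 else if fst c = 1 then gt
    else if fst c = 2 then gA (apow (fst (snd c))) else g0 (snd (snd c)))"
proof -
  have "cls (concat (map (\<lambda>\<nu>. (0, False) # eB (rw \<nu>)) \<nu>s)) = g0 \<nu>s" for \<nu>s
  proof (induction \<nu>s)
    case (Cons \<nu> \<nu>s)
    have "cls ((0, False) # eB (rw \<nu>)) = ga + gB (rw \<nu>)"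
      using cls_simps(2)[of "[(0, False)]" "eB (rw \<nu>)"] by (simp add: cls_letter gB_def)
    moreover have "cls (((0, False) # eB (rw \<nu>)) @ concat (map (\<lambda>\<nu>. (0, False) # eB (rw \<nu>)) \<nu>s)) =
      cls ((0, False) # eB (rw \<nu>)) + g0 \<nu>s"
      unfolding cls_simps(2) Cons ..
    ultimately show ?case by (simp add: add.assoc)
  qed simp
  then show ?thesis by (simp add: cword_def gA_def)
qed

text \<open>The certificate found for a word need not single out one canonical class form.
  Separating the classes reduces conjugacy of class forms to comparing exponents and finitely many
  rotations.\<close>

lemma csame_iff:
  assumes "cvalid c" "cvalid d"
  shows "cj (cls (cword c)) (cls (cword d)) \<longleftrightarrow> csame c d"
proof -
  obtain k m \<nu>s where c: "c = (k, m, \<nu>s)" by (cases c)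
  obtain k' m' \<mu>s where d: "d = (k', m', \<mu>s)" by (cases d)
  have g0_nz: "\<nu>s \<noteq> [] \<Longrightarrow> g0 \<nu>s \<noteq> 0" for \<nu>s using not_cj_g0_gA[of \<nu>s "[]"] by auto
  have sym: "\<not> cj g h \<Longrightarrow> \<not> cj h g" for g h using cj_sym by blast
  have n: "m \<noteq> 0 \<Longrightarrow> \<not> cj gt (gA (apow m)) \<and> \<not> cj (gA (apow m)) gt" for m
    using not_cj_gt_apow sym by blast
  have g: "\<nu>s \<noteq> [] \<Longrightarrow> \<not> cj (g0 \<nu>s) gt \<and> \<not> cj gt (g0 \<nu>s) \<and>
    \<not> cj (g0 \<nu>s) (gA (apow m)) \<and> \<not> cj (gA (apow m)) (g0 \<nu>s)" for \<nu>s m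
    using not_cj_g0_gA[of \<nu>s] sym by blast
  have rot: "\<nu>s \<noteq> [] \<Longrightarrow> (\<exists>k. \<mu>s = rotate k \<nu>s) \<longleftrightarrow> (\<exists>i<length \<nu>s. \<mu>s = drop i \<nu>s @ take i \<nu>s)"
  proof -
    assume "\<nu>s \<noteq> []"
    then have k: "k mod length \<nu>s < length \<nu>s" for k by simp
    show ?thesis
    proof
      assume "\<exists>k. \<mu>s = rotate k \<nu>s"
      then show "\<exists>i<length \<nu>s. \<mu>s = drop i \<nu>s @ take i \<nu>s" using k unfolding rotate_drop_take by blast
    next
      assume "\<exists>i<length \<nu>s. \<mu>s = drop i \<nu>s @ take i \<nu>s"
      then obtain i where "i < length \<nu>s" "\<mu>s = drop i \<nu>s @ take i \<nu>s" by blast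
      then have "\<mu>s = rotate i \<nu>s" by (simp add: rotate_drop_take)
      then show "\<exists>k. \<mu>s = rotate k \<nu>s" by blast
    qed
  qed
  have "k \<in> {0, 1, 2, 3}" "k' \<in> {0, 1, 2, 3}" using assms by (auto simp: c d cvalid_def)
  moreover have "cvalid (k, m, \<nu>s)" "cvalid (k', m', \<mu>s)" using assms by (simp_all only: c d)
  moreover have "cj (gA (apow m)) (gA (apow m')) \<longleftrightarrow> m = m'" using cj_apow cj_refl by blast
  ultimately show ?thesis
    using gt_nz gA_apow_nz[of m] gA_apow_nz[of m'] g0_nz[of \<nu>s] g0_nz[of \<mu>s] n[of m] n[of m']
      rot g[of \<nu>s m'] g[of \<mu>s m] cj_g0_iff[of \<nu>s \<mu>s]
    unfolding c d cls_cword csame_def cvalid_def list_all_123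
    by (elim insertE emptyE) simp_all
qed

lemma cform_ex: "\<exists>c. cvalid c \<and> cj (cls w) (cls (cword c))"
proof (cases "cls w" rule: cj_cases)
  case 1
  then show ?thesis by (intro exI[of _ "(0, 0, [])"]) (simp add: cvalid_def cls_cword)
next
  case (2 m)
  then show ?thesis by (intro exI[of _ "(2, m, [])"]) (simp add: cvalid_def cls_cword)
next
  case 3
  then show ?thesis by (intro exI[of _ "(1, 0, [])"]) (simp add: cvalid_def cls_cword)
next
  case (4 \<nu>s)
  then show ?thesis by (intro exI[of _ "(3, 0, \<nu>s)"]) (simp add: cvalid_def cls_cword list_all_123[simplified])
qed

text \<open>\<open>x\<close> conjugates \<open>w\<close> into the listed form \<open>c\<close>, and
  \<open>js\<close> is the derivation proving it; the test only compares freely reduced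
  words.\<close>

definition cert :: "nat word \<Rightarrow> cform \<Rightarrow> nat word \<Rightarrow> (nat word \<times> int \<times> bool) list \<Rightarrow> bool" where
  "cert w c x js \<longleftrightarrow> cvalid c \<and> rd (x @ w) = rd (conjs js @ cword c @ x)"

lemma cert_sound: "cert w c x js \<Longrightarrow> cvalid c \<and> cj (cls w) (cls (cword c))"
proof -
  assume *: "cert w c x js"
  then have "x @ w \<doteq> conjs js @ cword c @ x" by (simp add: cert_def feq_iff_rd)
  then have "x @ w \<approx> cword c @ x" using geq_conjs by blast
  then have "cls x + cls w = cls (cword c) + cls x" unfolding cls_eq[symmetric] by simp
  then show ?thesis using * unfolding cj_def cert_def by blast
qed

lemma cert_ex: "\<exists>c x js. cert w c x js"
proof -
  obtain c where c: "cvalid c" "cj (cls w) (cls (cword c))" using cform_ex by blast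
  then obtain g where g: "g + cls w = cls (cword c) + g" unfolding cj_def by blast
  obtain x where "g = cls x" by (rule cls_surj)
  then have "x @ w \<approx> cword c @ x" using g by (simp only: cls_eq[symmetric] cls_simps)
  then obtain js where "x @ w \<doteq> conjs js @ cword c @ x" using geq_conjs by blast
  then show ?thesis using c(1) unfolding cert_def feq_iff_rd by blast
qed

text \<open>The unbounded search always ends because every element is conjugate to a listed form;
  this is where the classification of classes yields a total algorithm.\<close>

definition nform :: "nat word \<Rightarrow> cform" where
  "nform w = fst (dec (LEAST n. case dec n of (c, x, js) \<Rightarrow> cert w c x js)
     :: cform \<times> nat word \<times> (nat word \<times> int \<times> bool) list)"

lemma nform: "cvalid (nform w)" "cj (cls w) (cls (cword (nform w)))"
proof -
  obtain c x js where "cert w c x js" using cert_ex by blast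
  then have "case dec (enc (c, x, js)) of (c, x, js) \<Rightarrow> cert w c x js" by simp
  then have "case dec (LEAST n. case dec n of (c, x, js) \<Rightarrow> cert w c x js) of (c, x, js) \<Rightarrow> cert w c x js"
    by (rule LeastI)
  then obtain x js where "cert w (nform w) x js" by (auto simp: nform_def split: prod.splits)
  then show "cvalid (nform w)" "cj (cls w) (cls (cword (nform w)))" using cert_sound by blast+
qed

lemma cmp_rw [cmp_intros]: "cmp f \<Longrightarrow> cmp (\<lambda>x. rw (f x))"
  unfolding rw_def by (intro cmp_intros)

lemma cmp_cword [cmp_intros]: "cmp f \<Longrightarrow> cmp (\<lambda>x. cword (f x))"
  unfolding cword_def by (intro cmp_intros)

lemma cmp_cvalid [cmp_intros]: "cmp f \<Longrightarrow> cmp (\<lambda>x. cvalid (f x))"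
  unfolding cvalid_def by (intro cmp_intros)

lemma cmp_csame [cmp_intros]:
  assumes "cmp f" "cmp g" shows "cmp (\<lambda>x. csame (f x) (g x))"
  unfolding csame_def by (intro cmp_intros assms cmp_comp[OF assms(1)] cmp_comp[OF assms(2)])

lemma cmp_nform [cmp_intros]:
  assumes "cmp f" shows "cmp (\<lambda>x. nform (f x))"
proof -
  have ex: "\<exists>n. case dec n of (c, x, js) \<Rightarrow> cert w c x js" for w
    using cert_ex[of w] by (metis dec_enc case_prod_conv)
  have "cmp (\<lambda>w. fst (dec (LEAST n. case dec n of (c, x, js) \<Rightarrow> cert w c x js) :: cform \<times> nat word \<times> (nat word \<times> int \<times> bool) list))"
    unfolding cert_def by (intro cmp_intros) (rule ex[unfolded cert_def])
  then have "cmp nform" unfolding nform_def .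
  from cmp_comp[OF this assms] show ?thesis .
qed

lemma cls_eq_0_iff: "cls w = 0 \<longleftrightarrow> fst (nform w) = 0"
proof -
  have "cls w = 0 \<longleftrightarrow> cls (cword (nform w)) = 0"
    using nform(2)[of w] by (metis cj_0)
  also have "\<dots> \<longleftrightarrow> cj (cls (cword (nform w))) (cls (cword (0, 0, [])))" by (simp add: cword_def)
  also have "\<dots> \<longleftrightarrow> csame (nform w) (0, 0, [])"
    by (rule csame_iff[OF nform(1)]) (simp add: cvalid_def)
  also have "\<dots> \<longleftrightarrow> fst (nform w) = 0" by (auto simp: csame_def)
  finally show ?thesis .
qed

lemma cj_iff: "cj (cls u) (cls v) \<longleftrightarrow> csame (nform u) (nform v)"
proof -
  have "cj (cls u) (cls v) \<longleftrightarrow> cj (cls (cword (nform u))) (cls (cword (nform v)))"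
    using nform(2)[of u] nform(2)[of v] cj_trans cj_sym by metis
  then show ?thesis using csame_iff[OF nform(1) nform(1)] by simp
qed

section \<open>The group on the natural numbers\<close>

text \<open>A chosen representative word names each element, which merely transports the group to
  the natural numbers. The decision procedures work on words and never evaluate this choice.\<close>

definition encG :: "grp \<Rightarrow> nat" where
  "encG g = enc (rep_grp g)"

definition decG :: "nat \<Rightarrow> grp" where
  "decG = inv_into UNIV encG"

definition GG :: "nat monoid" where
  "GG = \<lparr>carrier = range encG, mult = \<lambda>x y. encG (decG x + decG y), one = encG 0\<rparr>"

lemma encG_inject [simp]: "encG g = encG h \<longleftrightarrow> g = h"
  by (metis encG_def enc_inject Quotient3_grp Quotient3_abs_rep)

lemma decG_encG [simp]: "decG (encG g) = g"
  unfolding decG_def by (rule inv_into_f_f) (simp_all add: inj_def)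

lemma GG_simps [simp]: "carrier GG = range encG" "encG g \<otimes>\<^bsub>GG\<^esub> encG h = encG (g + h)" "\<one>\<^bsub>GG\<^esub> = encG 0"
  by (simp_all add: GG_def)

lemma group_GG: "group GG"
proof (rule groupI)
  fix x assume "x \<in> carrier GG"
  then obtain g where "x = encG g" by auto
  then show "\<exists>y\<in>carrier GG. y \<otimes>\<^bsub>GG\<^esub> x = \<one>\<^bsub>GG\<^esub>" by (intro bexI[of _ "encG (- g)"]) simp_all
qed (auto simp: add.assoc)

interpretation GG: group GG by (rule group_GG)

lemma inv_GG [simp]: "inv\<^bsub>GG\<^esub> (encG g) = encG (- g)"
  by (rule GG.inv_equality) simp_all

lemma pow_GG [simp]: "encG g [^]\<^bsub>GG\<^esub> (n :: nat) = encG (mul n g)"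
proof (induction n)
  case (Suc n)
  have "g + mul n g = mul n g + g" by (rule mul_intertwine) simp
  then show ?case using Suc by simp
qed simp

lemma simple_GG: "simple GG"
  unfolding simple_def
proof (intro conjI allI impI group_GG)
  show "carrier GG \<noteq> {\<one>\<^bsub>GG\<^esub>}"
  proof
    assume "carrier GG = {\<one>\<^bsub>GG\<^esub>}"
    then have "encG gt \<in> {\<one>\<^bsub>GG\<^esub>}" by (metis GG_simps(1) rangeI)
    then show False using gt_nz by simp
  qed
  fix N assume N: "N \<lhd> GG"
  interpret N: normal N GG by (rule N)
  show "N = carrier GG \<or> N = {\<one>\<^bsub>GG\<^esub>}"
  proof (cases "N = {\<one>\<^bsub>GG\<^esub>}")
    case False
    have "\<one>\<^bsub>GG\<^esub> \<in> N" by (rule N.one_closed)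
    then obtain x where x: "x \<in> N" "x \<noteq> \<one>\<^bsub>GG\<^esub>" using False by blast
    then obtain g where g: "x = encG g" using N.mem_carrier by auto
    have "h \<in> {g. encG g \<in> N}" for h
    proof (rule normal_UNIV[of _ g])
      show "0 \<in> {g. encG g \<in> N}" using N.one_closed by simp
      show "g + h \<in> {g. encG g \<in> N}" if "g \<in> {g. encG g \<in> N}" "h \<in> {g. encG g \<in> N}" for g h
        using N.m_closed[of "encG g" "encG h"] that by simp
      show "- g \<in> {g. encG g \<in> N}" if "g \<in> {g. encG g \<in> N}" for g
        using N.m_inv_closed[of "encG g"] that by simp
      show "x + g + - x \<in> {g. encG g \<in> N}" if "g \<in> {g. encG g \<in> N}" for x g
        using N.inv_op_closed2[of "encG x" "encG g"] that by (simp del: add_uminus_conv_diff)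
    qed (use x g in simp_all)
    then have "carrier GG \<subseteq> N" by auto
    then show ?thesis using N.subset by blast
  qed simp
qed

lemma torsion_free_GG: "torsion_free GG"
  unfolding torsion_free_def by (auto simp: mul_nz)

lemma generate_GG: "generate GG {encG ga, encG gb} = carrier GG"
proof (intro equalityI subsetI)
  fix x assume "x \<in> carrier GG"
  then obtain g where g: "x = encG g" by auto
  let ?S = "{g. encG g \<in> generate GG {encG ga, encG gb}}"
  have "g \<in> ?S"
  proof (rule generators)
    show "0 \<in> ?S" using generate.one[of GG "{encG ga, encG gb}"] by simp
    show "g + h \<in> ?S" if "g \<in> ?S" "h \<in> ?S" for g h
      using generate.eng[of "encG g" GG "{encG ga, encG gb}" "encG h"] that by simp
    show "- g \<in> ?S" if "g \<in> ?S" for g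
      using GG.generate_m_inv_closed[of "{encG ga, encG gb}" "encG g"] that by simp
  qed (auto intro: generate.incl)
  then show "x \<in> generate GG {encG ga, encG gb}" by (simp add: g)
qed (use GG.generate_in_carrier[of "{encG ga, encG gb}"] in auto)

lemma two_generated_GG: "two_generated GG"
  unfolding two_generated_def using generate_GG by (intro bexI[of _ "encG ga"] bexI[of _ "encG gb"]) simp_all

definition HH :: "nat set" where
  "HH = range (\<lambda>w. encG (hw w))"

lemma subgroup_HH: "subgroup HH GG"
proof (rule GG.subgroupI)
  show "HH \<subseteq> carrier GG" by (auto simp: HH_def)
  show "HH \<noteq> {}" by (simp add: HH_def)
  fix x assume "x \<in> HH"
  then obtain w where "x = encG (hw w)" by (auto simp: HH_def)
  then have "inv\<^bsub>GG\<^esub> x = encG (hw (winv w))" by simp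
  then show "inv\<^bsub>GG\<^esub> x \<in> HH" unfolding HH_def by blast
next
  fix x y assume "x \<in> HH" "y \<in> HH"
  then obtain v w where "x = encG (hw v)" "y = encG (hw w)" by (auto simp: HH_def)
  then have "x \<otimes>\<^bsub>GG\<^esub> y = encG (hw (v @ w))" by simp
  then show "x \<otimes>\<^bsub>GG\<^esub> y \<in> HH" unfolding HH_def by blast
qed

lemma hw_feq: "u \<doteq> v \<Longrightarrow> hw u = hw v"
proof (induction rule: feq.induct)
  case (cancel u g e v)
  then show ?case by (cases e) simp_all
qed simp_all

lemma hw_rd: "hw (rd w) = hw w"
  by (rule hw_feq) (rule feq_rd)

lemma hw_inj: "reduced u \<Longrightarrow> reduced v \<Longrightarrow> hw u = hw v \<Longrightarrow> u = v"
proof -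
  assume u: "reduced u" and v: "reduced v" and eq: "hw u = hw v"
  have "hw (rd (u @ winv v)) = 0" unfolding hw_rd by (simp add: eq)
  then have "rd (u @ winv v) = []" using hw_nz[OF reduced_rd] by blast
  then have "u @ winv v \<doteq> []" by (simp add: feq_iff_rd rd_def)
  from feq_append_right[OF this, of v] have 1: "u @ winv v @ v \<doteq> v" by simp
  have 2: "u @ winv v @ v \<doteq> u" using feq_cancel_mid(2)[of u v "[]"] by simp
  have "u \<doteq> v" by (rule feq.trans[OF feq.sym[OF 2] 1])
  then show "u = v" using u v by (simp add: feq_iff_rd rd_reduced)
qed

definition lt :: "bool \<times> bool \<Rightarrow> nat \<times> bool" where
  "lt x = (encG (hel (fst x)), snd x)"

lemma inj_hel: "hel i = hel j \<longleftrightarrow> i = j"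
  using hw_inj[of "[(i, False)]" "[(j, False)]"] by (auto simp: reduced_def)

lemma reduced_lt: "reduced (map lt w) \<longleftrightarrow> reduced w"
  unfolding reduced_def successively_map by (simp add: lt_def inj_hel)

lemma free_HH: "free_of_finite_rank (GG\<lparr>carrier := HH\<rparr>) 2"
proof -
  let ?F = "GG\<lparr>carrier := HH\<rparr>"
  let ?X = "{encG (hel False), encG (hel True)}"
  have inHH: "encG (hel i) \<in> HH" for i
    unfolding HH_def by (rule range_eqI[of _ _ "[(i, False)]"]) simp
  have val: "word_val ?F (\<lambda>x. x) (map lt w) = encG (hw w)" for w
  proof (induction w)
    case (Cons x w)
    have i: "inv\<^bsub>?F\<^esub> (encG (hel (fst x))) = encG (- hel (fst x))"
      using GG.m_inv_consistent[OF subgroup_HH inHH] by simp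
    have "word_val ?F (\<lambda>x. x) (map lt (x # w)) = letter_val ?F (\<lambda>x. x) (lt x) \<otimes>\<^bsub>GG\<^esub> encG (hw w)"
      using Cons by (simp add: word_val_def)
    also have "letter_val ?F (\<lambda>x. x) (lt x) = encG (if snd x then - hel (fst x) else hel (fst x))"
      using i by (simp add: letter_val_def lt_def)
    finally show ?case by simp
  qed (simp add: word_val_def)
  have words: "{w \<in> words_over ?X. reduced w} = map lt ` {w. reduced w}"
  proof (intro equalityI subsetI)
    fix w assume w: "w \<in> {w \<in> words_over ?X. reduced w}"
    then have "\<forall>y\<in>set w. \<exists>x. y = lt x"
      by (fastforce simp: words_over_def lt_def)
    then have "\<exists>v. w = map lt v" unfolding ex_map_conv .
    then obtain v where v: "w = map lt v" by (elim exE that)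
    then show "w \<in> map lt ` {w. reduced w}" using w reduced_lt by auto
  next
    fix w assume "w \<in> map lt ` {w. reduced w}"
    then obtain v where v: "w = map lt v" "reduced v" by auto
    have lt: "lt x \<in> ?X \<times> UNIV" for x by (cases "fst x") (simp_all add: lt_def)
    have "map lt v \<in> words_over ?X" unfolding words_over_def
      by (induction v) (simp_all only: list.map lists.Nil lists.Cons lt)
    then show "w \<in> {w \<in> words_over ?X. reduced w}" using v reduced_lt by simp
  qed
  have "bij_betw (word_val ?F (\<lambda>x. x)) {w \<in> words_over ?X. reduced w} (carrier ?F)"
    unfolding words
  proof (rule bij_betw_imageI)
    show "inj_on (word_val ?F (\<lambda>x. x)) (map lt ` {w. reduced w})"
      by (rule inj_onI) (auto simp: val dest: hw_inj)
    have "encG (hw w) \<in> (\<lambda>w. encG (hw w)) ` {w. reduced w}" for w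
      by (rule image_eqI[of _ _ "rd w"]) (simp_all add: hw_rd reduced_rd)
    then show "word_val ?F (\<lambda>x. x) ` map lt ` {w. reduced w} = carrier ?F"
      unfolding image_image val by (auto simp: HH_def)
  qed
  moreover have "?X \<subseteq> carrier ?F" using inHH by simp
  moreover have "card ?X = 2" by (simp add: inj_hel)
  moreover have "group ?F" by (rule subgroup.subgroup_is_group[OF subgroup_HH group_GG])
  ultimately show ?thesis
    unfolding free_of_finite_rank_def free_basis_def by (intro conjI exI[of _ ?X]) simp_all
qed

section \<open>Commutator length\<close>

lemma derived_set_GG: "derived_set GG (carrier GG) = {encG (gcomm x y) | x y. True}"
proof -
  have "encG x \<otimes>\<^bsub>GG\<^esub> encG y \<otimes>\<^bsub>GG\<^esub> inv\<^bsub>GG\<^esub> encG x \<otimes>\<^bsub>GG\<^esub> inv\<^bsub>GG\<^esub> encG y = encG (gcomm x y)" for x y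
    by (simp add: gcomm_def del: add_uminus_conv_diff)
  then show ?thesis by (auto simp del: inv_GG)
qed

lemma foldr_GG: "foldr (\<lambda>c h. c \<otimes>\<^bsub>GG\<^esub> h) (map encG cs) \<one>\<^bsub>GG\<^esub> = encG (foldr (+) cs 0)"
  by (induction cs) simp_all

lemma product_of_commutators_GG:
  "product_of_commutators GG k (encG g) \<longleftrightarrow>
    (\<exists>cs. length cs = k \<and> (\<forall>c\<in>set cs. \<exists>x y. c = gcomm x y) \<and> g = foldr (+) cs 0)"
proof
  assume "product_of_commutators GG k (encG g)"
  then obtain ds where ds: "length ds = k" "set ds \<subseteq> derived_set GG (carrier GG)"
    "encG g = foldr (\<lambda>c h. c \<otimes>\<^bsub>GG\<^esub> h) ds \<one>\<^bsub>GG\<^esub>" unfolding product_of_commutators_def by blast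
  have "\<forall>d\<in>set ds. \<exists>c. d = encG c" using ds(2) unfolding derived_set_GG by blast
  then have "\<exists>cs. ds = map encG cs" unfolding ex_map_conv .
  then obtain cs where cs: "ds = map encG cs" by (elim exE that)
  have "\<forall>c\<in>set cs. \<exists>x y. c = gcomm x y"
  proof
    fix c assume "c \<in> set cs"
    then have "encG c \<in> set ds" by (simp add: cs)
    with ds(2) have "encG c \<in> derived_set GG (carrier GG)" by (rule subsetD)
    then have "encG c \<in> {encG (gcomm x y) | x y. True}" unfolding derived_set_GG .
    then show "\<exists>x y. c = gcomm x y" by auto
  qed
  moreover have "g = foldr (+) cs 0" using ds(3) unfolding cs foldr_GG by simp
  ultimately show "\<exists>cs. length cs = k \<and> (\<forall>c\<in>set cs. \<exists>x y. c = gcomm x y) \<and> g = foldr (+) cs 0"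
    using ds(1) cs by auto
next
  assume "\<exists>cs. length cs = k \<and> (\<forall>c\<in>set cs. \<exists>x y. c = gcomm x y) \<and> g = foldr (+) cs 0"
  then obtain cs where cs: "length cs = k" "\<forall>c\<in>set cs. \<exists>x y. c = gcomm x y" "g = foldr (+) cs 0" by blast
  have "set (map encG cs) \<subseteq> derived_set GG (carrier GG)" unfolding derived_set_GG using cs(2) by auto
  then show "product_of_commutators GG k (encG g)"
    unfolding product_of_commutators_def using cs(1,3) foldr_GG by (intro exI[of _ "map encG cs"]) simp
qed

text \<open>The products of commutators form a normal subgroup, nontrivial because the free subgroup
  has a nontrivial commutator, so they exhaust the simple group. Hence the minimum defining
  commutator length is attained for every element.\<close>

lemma commutators_UNIV: "\<exists>cs. (\<forall>c\<in>set cs. \<exists>x y. c = gcomm x y) \<and> g = foldr (+) cs 0"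
proof -
  define N where "N = {foldr (+) cs 0 | cs. \<forall>c\<in>set cs. \<exists>x y. c = gcomm x y}"
  have NI: "foldr (+) cs 0 \<in> N" if "\<forall>c\<in>set cs. \<exists>x y. c = gcomm x y" for cs
    unfolding N_def using that by blast
  have plus: "foldr (+) cs 0 + h = foldr (+) cs h" for cs and h :: grp
    by (induction cs) (simp_all add: add.assoc)
  have add: "g + h \<in> N" if g: "g \<in> N" and h: "h \<in> N" for g h
  proof -
    obtain cs ds where cs: "g = foldr (+) cs 0" "\<forall>c\<in>set cs. \<exists>x y. c = gcomm x y"
      and ds: "h = foldr (+) ds 0" "\<forall>c\<in>set ds. \<exists>x y. c = gcomm x y"
      using g h unfolding N_def by blast
    have "g + h = foldr (+) (cs @ ds) 0" by (simp add: cs(1) ds(1) plus)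
    moreover have "\<forall>c\<in>set (cs @ ds). \<exists>x y. c = gcomm x y" using cs(2) ds(2) by auto
    ultimately show ?thesis using NI by metis
  qed
  have one: "gcomm x y \<in> N" for x y using NI[of "[gcomm x y]"] by auto
  have zero: "0 \<in> N" using NI[of "[]"] by simp
  have ind: "Q g" if N: "g \<in> N" and Q: "Q 0" "\<And>x y h. h \<in> N \<Longrightarrow> Q h \<Longrightarrow> Q (gcomm x y + h)" for Q g
  proof -
    obtain cs where cs: "g = foldr (+) cs 0" "\<forall>c\<in>set cs. \<exists>x y. c = gcomm x y" using N unfolding N_def by blast
    have "Q (foldr (+) cs 0)" using cs(2)
    proof (induction cs)
      case (Cons c cs)
      then have "foldr (+) cs 0 \<in> N" by (intro NI) simp
      then show ?case using Cons Q(2) by auto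
    qed (use Q(1) in simp)
    then show ?thesis using cs(1) by simp
  qed
  have "- gcomm x y = gcomm y x" for x y
    by (simp add: gcomm_def grp_simps del: add_uminus_conv_diff)
  then have neg: "- g \<in> N" if "g \<in> N" for g
    using that by (rule_tac ind[of g]) (simp_all add: zero minus_add add one del: add_uminus_conv_diff)
  have conj: "x + g + - x \<in> N" if "g \<in> N" for x g
    using that
  proof (rule ind)
    fix y z h assume h: "h \<in> N" "x + h + - x \<in> N"
    have "x + (gcomm y z + h) + - x = gcomm (x + y + - x) (x + z + - x) + (x + h + - x)"
      by (simp add: gcomm_def grp_simps del: add_uminus_conv_diff)
    then show "x + (gcomm y z + h) + - x \<in> N" using add[OF one h(2)] by simp
  qed (simp add: zero)
  let ?w = "[(False, False), (True, False), (False, True), (True, True)]"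
  have "hw ?w \<noteq> 0" by (rule hw_nz) (simp_all add: reduced_def)
  moreover have "hw ?w = gcomm (hel False) (hel True)" by (simp add: gcomm_def add.assoc del: add_uminus_conv_diff)
  ultimately have nz: "gcomm (hel False) (hel True) \<noteq> 0" by simp
  have "g \<in> N" by (rule normal_UNIV[OF zero add neg conj one nz])
  then show ?thesis unfolding N_def by blast
qed

lemma commutator_length_GG:
  "product_of_commutators GG (commutator_length GG (encG g)) (encG g)"
proof -
  have "\<exists>k. product_of_commutators GG k (encG g)"
    unfolding product_of_commutators_GG using commutators_UNIV[of g] by blast
  then show ?thesis unfolding commutator_length_def by (rule LeastI_ex)
qed

lemma commutator_length_powers:
  assumes "h \<in> HH - {\<one>\<^bsub>GG\<^esub>}"
  shows "filterlim (\<lambda>n::nat. commutator_length GG (h [^]\<^bsub>GG\<^esub> n)) at_top sequentially"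
proof -
  obtain w where w: "h = encG (hw w)" "hw w \<noteq> 0" using assms by (auto simp: HH_def)
  have "rd w \<noteq> []" using w(2) hw_rd[of w] by auto
  from hw_commutators[OF reduced_rd this] obtain D where
    D: "\<And>n cs. (\<forall>c\<in>set cs. \<exists>x y. c = gcomm x y) \<Longrightarrow> mul n (hw w) = foldr (+) cs 0 \<Longrightarrow>
      int n \<le> D * (int (length cs) + 1)" unfolding hw_rd by blast
  define k where "k n = commutator_length GG (h [^]\<^bsub>GG\<^esub> n)" for n :: nat
  have k: "int n \<le> \<bar>D\<bar> * (int (k n) + 1)" for n
  proof -
    have "product_of_commutators GG (k n) (encG (mul n (hw w)))"
      unfolding k_def w(1) pow_GG by (rule commutator_length_GG)
    then obtain cs where "length cs = k n" "\<forall>c\<in>set cs. \<exists>x y. c = gcomm x y" "mul n (hw w) = foldr (+) cs 0"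
      unfolding product_of_commutators_GG by blast
    then have "int n \<le> D * (int (k n) + 1)" using D by metis
    also have "\<dots> \<le> \<bar>D\<bar> * (int (k n) + 1)" by (intro mult_right_mono) auto
    finally show ?thesis .
  qed
  have "filterlim k at_top sequentially"
    unfolding filterlim_at_top
  proof
    fix Z :: nat
    show "\<forall>\<^sub>F n in sequentially. Z \<le> k n"
      unfolding eventually_sequentially
    proof (intro exI allI impI)
      fix n assume n: "nat (\<bar>D\<bar> * int Z) + 1 \<le> n"
      show "Z \<le> k n"
      proof (rule ccontr)
        assume "\<not> Z \<le> k n"
        then have "\<bar>D\<bar> * (int (k n) + 1) \<le> \<bar>D\<bar> * int Z" by (intro mult_left_mono) auto
        then show False using k[of n] n by linarith
      qed
    qed
  qed
  then show ?thesis by (simp add: k_def[abs_def])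
qed

lemma commutator_width_GG: "commutator_width GG = \<infinity>"
proof -
  have der: "encG g \<in> derived GG (carrier GG)" for g
  proof -
    obtain cs where cs: "\<forall>c\<in>set cs. \<exists>x y. c = gcomm x y" "g = foldr (+) cs 0" using commutators_UNIV by blast
    have "encG (foldr (+) cs 0) \<in> generate GG (derived_set GG (carrier GG))" using cs(1)
    proof (induction cs)
      case Nil
      then show ?case using generate.one[of GG] by simp
    next
      case (Cons c cs)
      have "encG c \<in> generate GG (derived_set GG (carrier GG))"
        by (rule generate.incl) (use Cons.prems in \<open>auto simp: derived_set_GG simp del: GG_simps(1)\<close>)
      then show ?case using generate.eng[of "encG c" GG _ "encG (foldr (+) cs 0)"] Cons by simp
    qed
    then show ?thesis by (simp add: derived_def cs(2))
  qed
  define h where "h = encG (hw [(False, False)])"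
  have "hw [(False, False)] \<noteq> 0" by (rule hw_nz) (simp_all add: reduced_def)
  then have "h \<in> HH - {\<one>\<^bsub>GG\<^esub>}" by (auto simp: h_def HH_def simp del: hw.simps)
  then have lim: "filterlim (\<lambda>n::nat. commutator_length GG (h [^]\<^bsub>GG\<^esub> n)) at_top sequentially"
    by (rule commutator_length_powers)
  have "enat m \<le> commutator_width GG" for m
  proof -
    have "\<forall>\<^sub>F n in sequentially. m \<le> commutator_length GG (h [^]\<^bsub>GG\<^esub> n)"
      using lim unfolding filterlim_at_top by (rule spec)
    then obtain n :: nat where n: "\<forall>k\<ge>n. m \<le> commutator_length GG (h [^]\<^bsub>GG\<^esub> k)"
      unfolding eventually_sequentially by meson
    have "m \<le> commutator_length GG (h [^]\<^bsub>GG\<^esub> n)" by (rule n[rule_format, OF order_refl])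
    then have "enat m \<le> enat (commutator_length GG (h [^]\<^bsub>GG\<^esub> n))" by simp
    also have "\<dots> \<le> commutator_width GG"
      unfolding commutator_width_def by (rule SUP_upper) (simp add: h_def der[unfolded GG_simps] del: hw.simps)
    finally show ?thesis .
  qed
  note le = this
  show ?thesis
  proof (cases "commutator_width GG")
    case (enat m)
    then show ?thesis using le[of "Suc m"] by simp
  qed
qed

section \<open>Decidability\<close>

abbreviation gens :: "nat list" where "gens \<equiv> [encG ga, encG gb]"

lemma generating_tuple_GG: "generating_tuple GG gens"
  unfolding generating_tuple_def using generate_GG by simp

text \<open>The letters 0 and 1 of the presentation are \<open>a\<close> and \<open>b\<close>
  themselves, so a word over the two generators is already a word of the presentation.\<close>

lemma word_val_GG:
  "w \<in> words_over {..<length gens} \<Longrightarrow> word_val GG (\<lambda>i. gens ! i) w = encG (cls w)"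
proof (induction w)
  case (Cons x w)
  obtain i e where x: "x = (i, e)" by fastforce
  have i: "i < 2" and w: "w \<in> words_over {..<length gens}" using Cons.prems by (auto simp: words_over_def x)
  then consider "i = 0" | "i = Suc 0" by linarith
  then have l: "letter_val GG (\<lambda>i. gens ! i) x = encG (cls [x])"
    by cases (simp_all add: x letter_val_def cls_letter gX_inv)
  have "word_val GG (\<lambda>i. gens ! i) (x # w) = letter_val GG (\<lambda>i. gens ! i) x \<otimes>\<^bsub>GG\<^esub> word_val GG (\<lambda>i. gens ! i) w"
    by (simp add: word_val_def)
  also have "\<dots> = encG (cls [x] + cls w)" unfolding l Cons.IH[OF w] by simp
  also have "cls [x] + cls w = cls (x # w)" using cls_simps(2)[of "[x]" w] by simp
  finally show ?case .
qed (simp add: word_val_def)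

text \<open>Inverse to \<open>word_code\<close> on both sides: every number is the code of a word,
  so membership in a set of codes becomes a predicate on decoded words.\<close>

definition wdec :: "nat \<Rightarrow> nat word" where
  "wdec n = map (\<lambda>m. (m div 2, m mod 2 = 1)) (dec n)"

definition wgood :: "nat word \<Rightarrow> bool" where
  "wgood w \<longleftrightarrow> list_all (\<lambda>x. fst x < 2) w"

lemma wgood_iff: "wgood w \<longleftrightarrow> w \<in> words_over {..<length gens}"
  by (auto simp: wgood_def words_over_def list_all_iff numeral_2_eq_2)

lemma wdec_code [simp]: "wdec (word_code w) = w"
proof -
  have "map dec ms = ms" for ms :: "nat list" by (induction ms) (simp_all add: dec_nat_def)
  then have "dec (list_encode ms) = ms" for ms :: "nat list" by (simp add: dec_list_def)
  then show ?thesis by (auto simp: wdec_def word_code_def o_def case_prod_unfold of_bool_def intro!: map_idI split: if_splits)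
qed

lemma code_wdec [simp]: "word_code (wdec n) = n"
proof -
  have "2 * (m div 2) + of_bool (m mod 2 = 1) = m" for m :: nat by (cases "m mod 2 = 1") (auto; presburger)+
  moreover have "map dec ms = ms" for ms :: "nat list" by (induction ms) (simp_all add: dec_nat_def)
  ultimately show ?thesis by (simp add: wdec_def word_code_def o_def dec_list_def)
qed

lemma cmp_wdec [cmp_intros]: "cmp f \<Longrightarrow> cmp (\<lambda>x. wdec (f x))"
  unfolding wdec_def by (intro cmp_intros) simp_all

lemma cmp_wgood [cmp_intros]: "cmp f \<Longrightarrow> cmp (\<lambda>x. wgood (f x))"
  unfolding wgood_def by (intro cmp_intros)

lemma decidable_set_cmp: "cmp (\<lambda>n::nat. n \<in> A) \<Longrightarrow> decidable_set A"
proof -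
  assume "cmp (\<lambda>n::nat. n \<in> A)"
  then have "cf (\<lambda>n. if n \<in> A then 1 else 0)" by (simp add: cmp_def enc_bool_def dec_nat_def)
  then show ?thesis unfolding cf_iff decidable_set_def by simp
qed

lemma decidable_word_problem_GG: "decidable_word_problem GG"
proof -
  have "n \<in> word_code ` word_problem GG gens \<longleftrightarrow> wgood (wdec n) \<and> fst (nform (wdec n)) = 0" for n
  proof -
    have "n \<in> word_code ` word_problem GG gens \<longleftrightarrow> wdec n \<in> word_problem GG gens"
      by (metis (no_types, lifting) code_wdec wdec_code image_iff)
    also have "\<dots> \<longleftrightarrow> wgood (wdec n) \<and> cls (wdec n) = 0"
      using word_val_GG[of "wdec n"] by (auto simp: word_problem_def wgood_iff)
    finally show ?thesis by (simp only: cls_eq_0_iff)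
  qed
  moreover have "cmp (\<lambda>n. wgood (wdec n) \<and> fst (nform (wdec n)) = 0)" by (intro cmp_intros)
  ultimately have "decidable_set (word_code ` word_problem GG gens)" by (intro decidable_set_cmp) simp
  then show ?thesis unfolding decidable_word_problem_def using generating_tuple_GG by blast
qed

lemma conjugate_GG: "conjugate_in GG (encG g) (encG h) \<longleftrightarrow> cj g h"
proof -
  have "h = x + g + - x \<longleftrightarrow> x + g = h + x" for x
    by (metis add.assoc add.left_inverse add.right_inverse add.right_neutral)
  then show ?thesis
    unfolding conjugate_in_def cj_def by (simp del: add_uminus_conv_diff)
qed

lemma decidable_conjugacy_problem_GG: "decidable_conjugacy_problem GG"
proof -
  let ?f = "\<lambda>(u, v). prod_encode (word_code u, word_code v)"
  define d where "d n = (wdec (fst (prod_decode n)), wdec (snd (prod_decode n)))" for n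
  have fd: "?f (d n) = n" "d (?f p) = p" for n p by (simp_all add: d_def split: prod.splits)
  have "n \<in> ?f ` conjugacy_problem GG gens \<longleftrightarrow>
    (wgood (fst (d n)) \<and> wgood (snd (d n))) \<and> csame (nform (fst (d n))) (nform (snd (d n)))" for n
  proof -
    have "n \<in> ?f ` conjugacy_problem GG gens \<longleftrightarrow> d n \<in> conjugacy_problem GG gens"
      by (metis (no_types, lifting) fd image_iff)
    also have "\<dots> \<longleftrightarrow> (wgood (fst (d n)) \<and> wgood (snd (d n))) \<and> cj (cls (fst (d n))) (cls (snd (d n)))"
      using word_val_GG[of "fst (d n)"] word_val_GG[of "snd (d n)"] conjugate_GG
      by (auto simp: conjugacy_problem_def wgood_iff case_prod_unfold)
    finally show ?thesis by (simp only: cj_iff)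
  qed
  moreover have "cmp (\<lambda>n. (wgood (fst (d n)) \<and> wgood (snd (d n))) \<and> csame (nform (fst (d n))) (nform (snd (d n))))"
    unfolding d_def by (intro cmp_intros)
  ultimately have "decidable_set (?f ` conjugacy_problem GG gens)" by (intro decidable_set_cmp) simp
  then show ?thesis unfolding decidable_conjugacy_problem_def using generating_tuple_GG by blast
qed

theorem theorem5:
  shows "(\<exists>(G :: nat monoid) H.
            simple G \<and> torsion_free G \<and> two_generated G \<and>
            subgroup H G \<and> free_of_finite_rank (G\<lparr>carrier := H\<rparr>) 2 \<and>
            (\<forall>h \<in> H - {\<one>\<^bsub>G\<^esub>}.
               filterlim (\<lambda>n::nat. commutator_length G (h [^]\<^bsub>G\<^esub> n)) at_top sequentially) \<and>
            commutator_width G = \<infinity>)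
       \<and> (\<exists>(G :: nat monoid) H.
            simple G \<and> torsion_free G \<and> two_generated G \<and>
            subgroup H G \<and> free_of_finite_rank (G\<lparr>carrier := H\<rparr>) 2 \<and>
            (\<forall>h \<in> H - {\<one>\<^bsub>G\<^esub>}.
               filterlim (\<lambda>n::nat. commutator_length G (h [^]\<^bsub>G\<^esub> n)) at_top sequentially) \<and>
            commutator_width G = \<infinity> \<and>
            decidable_word_problem G \<and> decidable_conjugacy_problem G)"
  by (intro conjI exI[of _ GG] exI[of _ HH] ballI simple_GG torsion_free_GG two_generated_GG subgroup_HH
      free_HH commutator_length_powers commutator_width_GG decidable_word_problem_GG
      decidable_conjugacy_problem_GG)

end
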